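(* Let $d\in\{2,3\}$ and let $\mu,\alpha,\beta>0$. Let $\Upsilon\in\mathcal L_{\mathrm Q}(\mathbb H)$ (a fixed operator, independent of the solution) and let $\mathcal I_\theta$ satisfy the approximation property of the context with constant $c_0$ and resolution $\theta>0$. Let $u$ be the solution of (SCBF) and $U$ the solution of the data assimilation system (DA) with nudging parameter $\sigma>0$. Suppose that one of the following holds: (1) $\varpi=3$, $2\beta\mu>1$, and $$0<\sigma\le\frac{1}{c_0\theta^2}\left(2\mu-\frac1\beta\right);$$ (2) $\varpi>3$ and $$2\widehat{\varpi}<2\alpha+\sigma\le2\alpha+\frac{\mu}{c_0\theta^2},\qquad\text{where }\ \widehat{\varpi}=\frac{\varpi-3}{2\mu(\varpi-1)}\left(\frac{4}{\mu\beta(\varpi-1)}\right)^{\frac{2}{\varpi-3}};$$ (3) $\varpi>3$, $2\beta\mu>1$, and $$\beta<2\alpha+\sigma\le2\alpha+\frac{1}{c_0\theta^2}\left(2\mu-\frac1\beta\right).$$ Then $\|u(t)-U(t)\|_2\to0$ exponentially fast as $t\to+\infty$, $\mathbb P$-a.s.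
   Context: Spaces. $\mathcal Q\subset\mathbb R^d$ is a bounded domain with smooth boundary. $\mathcal V$ is the set of divergence-free functions in $C_0^\infty(\mathcal Q;\mathbb R^d)$; $\mathbb H$, $\mathbb V$, $\widetilde{\mathbb L}^p$ are the closures of $\mathcal V$ in $L^2(\mathcal Q;\mathbb R^d)$, $H^1(\mathcal Q;\mathbb R^d)$, $L^p(\mathcal Q;\mathbb R^d)$. $\|\cdot\|_2$ and $(\cdot,\cdot)$ are the $L^2$ norm and inner product, $\|\cdot\|_p$ the $L^p$ norm, $\|v\|_{\mathbb V}=\|\nabla v\|_2$, and $\|\cdot\|_{\mathbb V^*}$ is the dual norm. Operators (defined by duality with $v\in\mathbb V\cap\widetilde{\mathbb L}^{\varpi+1}$): $\langle v,\mathcal A u\rangle=(\nabla u,\nabla v)$; $\langle v,\mathcal B(u,u)\rangle=\int_{\mathcal Q}(u\cdot\nabla)u\cdot v\,dx$; $\langle v,\mathcal K(u)\rangle=\int_{\mathcal Q}|u|^{\varpi-1}u\cdot v\,dx$. Noise. $(\Omega,\mathscr F,\{\mathscr F_t\}_{t\ge0},\mathbb P)$ is a filtered probability space satisfying the usual conditions, $\mathcal W$ is an $\mathbb H$-valued $\mathscr F_t$-adapted $\mathrm Q$-Wiener process with trace-class covariance $\mathrm Q$. $\mathcal L_{\mathrm Q}=\mathcal L_{\mathrm Q}(\mathbb H)$ is the space of Hilbert-Schmidt operators from $\mathrm Q^{1/2}\mathbb H$ to $\mathbb H$, with $\|\Phi\|_{\mathcal L_{\mathrm Q}}^2=\mathrm{Tr}(\Phi\mathrm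 Q\Phi^* )$. Equations. Let $f\in\mathbb V^*$ and $u_0,U_0\in\mathbb H$ (deterministic). (SCBF): $du+[\mu\mathcal A u+\mathcal B(u,u)+\alpha u+\beta\mathcal K(u)]dt=f\,dt+\Upsilon\,d\mathcal W$, $u(0)=u_0$. (DA): $dU+[\mu\mathcal A U+\mathcal B(U,U)+\alpha U+\beta\mathcal K(U)]dt=f\,dt+\Upsilon\,d\mathcal W-\sigma\mathcal P\mathcal I_\theta(U-u)\,dt$, $U(0)=U_0$, where $\mathcal P$ is the Helmholtz-Hodge projection. Solutions are the unique strong (in the probabilistic sense) solutions: progressively measurable processes with $\mathbb P$-a.s. paths in $C([0,\infty);\mathbb H)\cap L^2_{loc}(0,\infty;\mathbb V)\cap L^{\varpi+1}_{loc}(0,\infty;\widetilde{\mathbb L}^{\varpi+1})$ satisfying the equation in integrated form tested against every $v\in\mathbb V\cap\widetilde{\mathbb L}^{\varpi+1}$, $\mathbb P$-a.s. Interpolant. $\mathcal I_\theta:H^1(\mathcal Q;\mathbb R^d)\to L^2(\mathcal Q;\mathbb R^d)$ is linear, and the approximation property is $\|v-\mathcal I_\theta(v)\|_2^2\le c_0\theta^2\|v\|_{H^1}^2$ for all $v\in H^1(\mathcal Q;\mathbb R^d)$, where for $v\in\mathbb V$ the norm on the right is $\|v\|_{\mathbb V}=\|\nabla v\|_2$. Rates. Exponentially fast, $\mathbb P$-a.s.: for $\mathbb P$-almost every $\omega$ the quantity is bounded by $\widetilde a e^{-at}$ for some $a,\widetilde a>0$. *)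

theory Defs
  imports "HOL-Probability.Probability"
begin

section \<open>The Hilbert space of square-integrable functions\<close>

definition square_integrable :: "('a::euclidean_space \<Rightarrow> 'b::euclidean_space) \<Rightarrow> bool" where
  "square_integrable f \<longleftrightarrow> f \<in> borel_measurable lborel \<and> integrable lborel (\<lambda>x. (norm (f x))\<^sup>2)"

definition L2_rel :: "('a::euclidean_space \<Rightarrow> 'b::euclidean_space) \<Rightarrow> ('a \<Rightarrow> 'b) \<Rightarrow> bool" where
  "L2_rel f g \<longleftrightarrow> square_integrable f \<and> square_integrable g \<and> (AE x in lborel. f x = g x)"

lemma square_integrable_0: "square_integrable (\<lambda>x. 0)"
  by (simp add: square_integrable_def)

lemma square_integrable_scaleR:
  assumes "square_integrable f" shows "square_integrable (\<lambda>x. c *\<^sub>R f x)"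
  using assms by (auto simp: square_integrable_def power_mult_distrib)

lemma square_integrable_add:
  assumes "square_integrable f" "square_integrable g"
  shows "square_integrable (\<lambda>x. f x + g x)"
  unfolding square_integrable_def
proof
  have [measurable]: "f \<in> borel_measurable borel" "g \<in> borel_measurable borel"
    using assms by (auto simp: square_integrable_def)
  show "(\<lambda>x. f x + g x) \<in> borel_measurable lborel"
    by measurable
  have dom: "integrable lborel (\<lambda>x. 2 * (norm (f x))\<^sup>2 + 2 * (norm (g x))\<^sup>2)"
    using assms by (auto simp: square_integrable_def)
  have le: "(norm (f x + g x))\<^sup>2 \<le> 2 * (norm (f x))\<^sup>2 + 2 * (norm (g x))\<^sup>2" for x
  proof -
    have "(norm (f x + g x))\<^sup>2 \<le> (norm (f x) + norm (g x))\<^sup>2"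
      by (intro power_mono norm_triangle_ineq norm_ge_zero)
    also have "\<dots> \<le> 2 * (norm (f x))\<^sup>2 + 2 * (norm (g x))\<^sup>2"
      using sum_squares_bound[of "norm (f x)" "norm (g x)"] by (simp add: power2_sum)
    finally show ?thesis .
  qed
  show "integrable lborel (\<lambda>x. (norm (f x + g x))\<^sup>2)"
    by (rule Bochner_Integration.integrable_bound[OF dom]) (auto simp: le)
qed

lemma integrable_inner_square_integrable:
  assumes "square_integrable f" "square_integrable g"
  shows "integrable lborel (\<lambda>x. f x \<bullet> g x)"
proof -
  have [measurable]: "f \<in> borel_measurable borel" "g \<in> borel_measurable borel"
    using assms by (auto simp: square_integrable_def)
  have dom: "integrable lborel (\<lambda>x. (norm (f x))\<^sup>2 + (norm (g x))\<^sup>2)"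
    using assms by (auto simp: square_integrable_def)
  have le: "\<bar>f x \<bullet> g x\<bar> \<le> (norm (f x))\<^sup>2 + (norm (g x))\<^sup>2" for x
  proof -
    have "\<bar>f x \<bullet> g x\<bar> \<le> norm (f x) * norm (g x)"
      by (rule Cauchy_Schwarz_ineq2)
    also have "\<dots> \<le> (norm (f x))\<^sup>2 + (norm (g x))\<^sup>2"
      using sum_squares_bound[of "norm (f x)" "norm (g x)"]
        mult_nonneg_nonneg[of "norm (f x)" "norm (g x)"] norm_ge_zero[of "f x"] norm_ge_zero[of "g x"]
      by linarith
    finally show ?thesis .
  qed
  show ?thesis
    by (rule Bochner_Integration.integrable_bound[OF dom]) (auto simp: le)
qed

quotient_type (overloaded) ('a, 'b) L2 = "'a::euclidean_space \<Rightarrow> 'b::euclidean_space" / partial: L2_rel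
proof (rule part_equivpI)
  show "\<exists>f::'a \<Rightarrow> 'b. L2_rel f f"
    using square_integrable_0 by (auto simp: L2_rel_def)
  show "symp (L2_rel :: ('a \<Rightarrow> 'b) \<Rightarrow> _)"
    by (auto intro!: sympI simp: L2_rel_def elim: AE_mp)
  show "transp (L2_rel :: ('a \<Rightarrow> 'b) \<Rightarrow> _)"
    by (rule transpI) (auto simp: L2_rel_def)
qed

instantiation L2 :: (euclidean_space, euclidean_space) real_inner
begin

lift_definition zero_L2 :: "('a, 'b) L2" is "\<lambda>x. 0"
  by (simp add: L2_rel_def square_integrable_0)

lift_definition plus_L2 :: "('a, 'b) L2 \<Rightarrow> ('a, 'b) L2 \<Rightarrow> ('a, 'b) L2" is "\<lambda>f g x. f x + g x"
  by (auto simp: L2_rel_def square_integrable_add)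

lift_definition scaleR_L2 :: "real \<Rightarrow> ('a, 'b) L2 \<Rightarrow> ('a, 'b) L2" is "\<lambda>c f x. c *\<^sub>R f x"
  by (auto simp: L2_rel_def square_integrable_scaleR)

lift_definition inner_L2 :: "('a, 'b) L2 \<Rightarrow> ('a, 'b) L2 \<Rightarrow> real" is "\<lambda>f g. LINT x|lborel. f x \<bullet> g x"
proof -
  fix f f' g g' :: "'a \<Rightarrow> 'b"
  assume *: "L2_rel f f'" "L2_rel g g'"
  then have [measurable]: "f \<in> borel_measurable borel" "g \<in> borel_measurable borel"
      "f' \<in> borel_measurable borel" "g' \<in> borel_measurable borel"
    by (auto simp: L2_rel_def square_integrable_def)
  show "(LINT x|lborel. f x \<bullet> g x) = (LINT x|lborel. f' x \<bullet> g' x)"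
    using * by (intro integral_cong_AE) (auto simp: L2_rel_def)
qed

definition uminus_L2 :: "('a, 'b) L2 \<Rightarrow> ('a, 'b) L2" where "uminus_L2 u = (-1) *\<^sub>R u"
definition minus_L2 :: "('a, 'b) L2 \<Rightarrow> ('a, 'b) L2 \<Rightarrow> ('a, 'b) L2" where "minus_L2 u v = u + (-1) *\<^sub>R v"
definition norm_L2 :: "('a, 'b) L2 \<Rightarrow> real" where "norm_L2 u = sqrt (u \<bullet> u)"
definition dist_L2 :: "('a, 'b) L2 \<Rightarrow> ('a, 'b) L2 \<Rightarrow> real" where "dist_L2 u v = norm (u - v)"
definition sgn_L2 :: "('a, 'b) L2 \<Rightarrow> ('a, 'b) L2" where "sgn_L2 u = inverse (norm u) *\<^sub>R u"
definition uniformity_L2 :: "(('a, 'b) L2 \<times> ('a, 'b) L2) filter" where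
  "uniformity_L2 = (INF e\<in>{0<..}. principal {(x, y). dist x y < e})"
definition open_L2 :: "('a, 'b) L2 set \<Rightarrow> bool" where
  "open_L2 S \<longleftrightarrow> (\<forall>x\<in>S. \<forall>\<^sub>F (x', y) in uniformity. x' = x \<longrightarrow> y \<in> S)"

instance
proof
  fix u v w :: "('a, 'b) L2" and a b :: real
  show "u + v + w = u + (v + w)"
    by transfer (auto simp: L2_rel_def add.assoc intro!: square_integrable_add)
  show "u + v = v + u"
    by transfer (auto simp: L2_rel_def add.commute intro!: square_integrable_add)
  show "0 + u = u"
    by transfer (auto simp: L2_rel_def)
  show "- u + u = 0"
    unfolding uminus_L2_def
    by transfer
      (auto simp: L2_rel_def square_integrable_0
        intro!: square_integrable_add square_integrable_scaleR[of _ "-1", simplified])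
  show "u - v = u + - v"
    by (simp add: uminus_L2_def minus_L2_def)
  show "a *\<^sub>R (u + v) = a *\<^sub>R u + a *\<^sub>R v"
    by transfer (auto simp: L2_rel_def scaleR_add_right
        intro!: square_integrable_add square_integrable_scaleR)
  show "(a + b) *\<^sub>R u = a *\<^sub>R u + b *\<^sub>R u"
    by transfer (auto simp: L2_rel_def scaleR_add_left
        intro!: square_integrable_add square_integrable_scaleR)
  show "a *\<^sub>R b *\<^sub>R u = (a * b) *\<^sub>R u"
    by transfer (auto simp: L2_rel_def intro!: square_integrable_scaleR)
  show "1 *\<^sub>R u = u"
    by transfer (auto simp: L2_rel_def)
  show "dist u v = norm (u - v)" by (rule dist_L2_def)
  show "sgn u = inverse (norm u) *\<^sub>R u" by (simp only: sgn_L2_def)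
  show "uniformity = (INF e\<in>{0<..}. principal {(x, y :: ('a, 'b) L2). dist x y < e})"
    by (rule uniformity_L2_def)
  show "open S = (\<forall>x\<in>S. \<forall>\<^sub>F (x', y) in uniformity. x' = x \<longrightarrow> y \<in> S)" for S :: "('a, 'b) L2 set"
    by (rule open_L2_def)
  show "u \<bullet> v = v \<bullet> u"
    by transfer (simp add: inner_commute)
  show "(u + v) \<bullet> w = u \<bullet> w + v \<bullet> w"
    by transfer (auto simp: L2_rel_def inner_add_left
        intro!: Bochner_Integration.integral_add integrable_inner_square_integrable)
  show "(a *\<^sub>R u) \<bullet> v = a * (u \<bullet> v)"
    by transfer simp
  show "0 \<le> u \<bullet> u"
    by transfer simp
  show "u \<bullet> u = 0 \<longleftrightarrow> u = 0"
  proof transfer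
    fix f :: "'a \<Rightarrow> 'b" assume f: "L2_rel f f"
    then have "(LINT x|lborel. f x \<bullet> f x) = 0 \<longleftrightarrow> (AE x in lborel. f x \<bullet> f x = 0)"
      by (intro integral_nonneg_eq_0_iff_AE integrable_inner_square_integrable)
         (auto simp: L2_rel_def)
    then show "((LINT x|lborel. f x \<bullet> f x) = 0) = L2_rel f (\<lambda>x. 0)"
      using f by (auto simp: L2_rel_def square_integrable_0)
  qed
  show "norm u = sqrt (u \<bullet> u)" by (rule norm_L2_def)
qed

end


section \<open>Smooth functions and domains\<close>

primrec Ck_on :: "nat \<Rightarrow> 'a::real_normed_vector set \<Rightarrow> ('a \<Rightarrow> 'b::real_normed_vector) \<Rightarrow> bool" where
  "Ck_on 0 S f \<longleftrightarrow> continuous_on S f"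
| "Ck_on (Suc k) S f \<longleftrightarrow>
     (\<forall>x\<in>S. f differentiable (at x)) \<and> (\<forall>v. Ck_on k S (\<lambda>x. frechet_derivative f (at x) v))"

text \<open>Only used for open \<open>S\<close>.\<close>
definition smooth_on :: "'a::real_normed_vector set \<Rightarrow> ('a \<Rightarrow> 'b::real_normed_vector) \<Rightarrow> bool" where
  "smooth_on S f \<longleftrightarrow> (\<forall>k. Ck_on k S f)"

text \<open>\<open>C\<^sub>0\<^sup>\<infinity>(Q)\<close>, each function being extended by zero to the whole space.\<close>
definition test_functions :: "'a::real_normed_vector set \<Rightarrow> ('a \<Rightarrow> 'b::real_normed_vector) set" where
  "test_functions Q = {\<phi>. smooth_on UNIV \<phi> \<and>
     compact (closure {x. \<phi> x \<noteq> 0}) \<and> closure {x. \<phi> x \<noteq> 0} \<subseteq> Q}"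

text \<open>The boundary is locally the regular zero level set of a smooth function \<open>\<rho>\<close>, and the domain
  lies on the side where \<open>\<rho>\<close> is negative.\<close>
definition smooth_boundary :: "'a::euclidean_space set \<Rightarrow> bool" where
  "smooth_boundary Q \<longleftrightarrow> (\<forall>x\<in>frontier Q. \<exists>N (\<rho> :: 'a \<Rightarrow> real).
     open N \<and> x \<in> N \<and> smooth_on N \<rho> \<and> (\<forall>y\<in>N. frechet_derivative \<rho> (at y) \<noteq> (\<lambda>_. 0)) \<and>
     Q \<inter> N = {y\<in>N. \<rho> y < 0})"

definition bounded_smooth_domain :: "'a::euclidean_space set \<Rightarrow> bool" where
  "bounded_smooth_domain Q \<longleftrightarrow>
     Q \<noteq> {} \<and> open Q \<and> connected Q \<and> bounded Q \<and> smooth_boundary Q"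


section \<open>Function spaces\<close>

text \<open>Functions on \<open>Q\<close> are identified with their extensions by zero. As \<open>Q\<close> is bounded and all
  exponents that occur are at least 2, all function spaces below are realised as sets of elements
  of \<open>L\<^sup>2\<close>; \<open>norm\<close> and \<open>inner\<close> on this type are the \<open>L\<^sup>2\<close> norm and inner product.\<close>

type_synonym 'd vfield = "(real^'d, real^'d) L2"
type_synonym 'd tfield = "(real^'d, real^'d^'d) L2"

definition L2_on :: "'a::euclidean_space set \<Rightarrow> ('a, 'b::euclidean_space) L2 set" where
  "L2_on Q = {u. AE x in lborel. x \<notin> Q \<longrightarrow> rep_L2 u x = 0}"

text \<open>\<open>G $ i $ j\<close> is the weak partial derivative on \<open>Q\<close> of the \<open>i\<close>-th component in direction \<open>j\<close>.\<close>
definition is_weak_grad :: "(real^'d) set \<Rightarrow> 'd::finite vfield \<Rightarrow> 'd tfield \<Rightarrow> bool" where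
  "is_weak_grad Q u G \<longleftrightarrow> G \<in> L2_on Q \<and> (\<forall>\<psi>\<in>test_functions Q. \<forall>i j.
     (LINT x:Q|lborel. rep_L2 u x $ i * frechet_derivative \<psi> (at x) (axis j 1)) =
     - (LINT x:Q|lborel. rep_L2 G x $ i $ j * \<psi> x))"

definition weak_grad :: "(real^'d) set \<Rightarrow> 'd::finite vfield \<Rightarrow> 'd tfield" where
  "weak_grad Q u = (THE G. is_weak_grad Q u G)"

definition H1 :: "(real^'d) set \<Rightarrow> 'd::finite vfield set" where
  "H1 Q = {u \<in> L2_on Q. \<exists>G. is_weak_grad Q u G}"

definition H1_norm :: "(real^'d) set \<Rightarrow> 'd::finite vfield \<Rightarrow> real" where
  "H1_norm Q u = sqrt ((norm u)\<^sup>2 + (norm (weak_grad Q u))\<^sup>2)"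

definition Lp_integrable :: "real \<Rightarrow> 'd::finite vfield \<Rightarrow> bool" where
  "Lp_integrable p u \<longleftrightarrow> integrable lborel (\<lambda>x. norm (rep_L2 u x) powr p)"

definition Lp_norm :: "real \<Rightarrow> 'd::finite vfield \<Rightarrow> real" where
  "Lp_norm p u = (LINT x|lborel. norm (rep_L2 u x) powr p) powr (1 / p)"

text \<open>The divergence is the trace of the Jacobian matrix.\<close>
definition solenoidal_test_fields :: "(real^'d) set \<Rightarrow> 'd::finite vfield set" where
  "solenoidal_test_fields Q =
     abs_L2 ` {\<phi> \<in> test_functions Q. \<forall>x. trace (jacobian \<phi> (at x)) = 0}"

definition H_space :: "(real^'d) set \<Rightarrow> 'd::finite vfield set" where
  "H_space Q = closure (solenoidal_test_fields Q)"

definition V_space :: "(real^'d) set \<Rightarrow> 'd::finite vfield set" where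
  "V_space Q = {u \<in> H1 Q. \<forall>\<epsilon>>0. \<exists>\<phi>\<in>solenoidal_test_fields Q. H1_norm Q (u - \<phi>) < \<epsilon>}"

definition V_norm :: "(real^'d) set \<Rightarrow> 'd::finite vfield \<Rightarrow> real" where
  "V_norm Q u = norm (weak_grad Q u)"

definition Lp_space :: "(real^'d) set \<Rightarrow> real \<Rightarrow> 'd::finite vfield set" where
  "Lp_space Q p = {u. Lp_integrable p u \<and>
     (\<forall>\<epsilon>>0. \<exists>\<phi>\<in>solenoidal_test_fields Q. Lp_norm p (u - \<phi>) < \<epsilon>)}"

definition helmholtz :: "(real^'d) set \<Rightarrow> 'd::finite vfield \<Rightarrow> 'd vfield" where
  "helmholtz Q g = (THE h. h \<in> H_space Q \<and> (\<forall>w\<in>H_space Q. (g - h) \<bullet> w = 0))"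

definition linear_map_on ::
    "'a::real_vector set \<Rightarrow> 'b::real_vector set \<Rightarrow> ('a \<Rightarrow> 'b) \<Rightarrow> bool" where
  "linear_map_on S K T \<longleftrightarrow> (\<forall>x\<in>S. T x \<in> K) \<and>
     (\<forall>x\<in>S. \<forall>y\<in>S. T (x + y) = T x + T y) \<and> (\<forall>c. \<forall>x\<in>S. T (c *\<^sub>R x) = c *\<^sub>R T x)"

definition V_dual :: "(real^'d) set \<Rightarrow> ('d::finite vfield \<Rightarrow> real) set" where
  "V_dual Q = {f. linear_map_on (V_space Q) UNIV f \<and>
     (\<exists>C. \<forall>v\<in>V_space Q. \<bar>f v\<bar> \<le> C * V_norm Q v)}"

text \<open>On \<open>\<bbbV>\<close> the approximation property is required with the smaller norm \<open>\<parallel>\<nabla>v\<parallel>\<^sub>2\<close>.\<close>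
definition interpolant ::
    "(real^'d) set \<Rightarrow> real \<Rightarrow> real \<Rightarrow> ('d::finite vfield \<Rightarrow> 'd vfield) \<Rightarrow> bool" where
  "interpolant Q c\<^sub>0 \<theta> J \<longleftrightarrow> linear_map_on (H1 Q) (L2_on Q) J \<and>
     (\<forall>v\<in>H1 Q. (norm (v - J v))\<^sup>2 \<le> c\<^sub>0 * \<theta>\<^sup>2 * (H1_norm Q v)\<^sup>2) \<and>
     (\<forall>v\<in>V_space Q. (norm (v - J v))\<^sup>2 \<le> c\<^sub>0 * \<theta>\<^sup>2 * (V_norm Q v)\<^sup>2)"


section \<open>Operators on Hilbert spaces\<close>

text \<open>Here and in the next section \<open>H\<close> is a closed subspace of the ambient inner product space,
  and operators on \<open>H\<close> are functions whose values off \<open>H\<close> are irrelevant.\<close>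

definition bounded_operator_on :: "'h::real_inner set \<Rightarrow> ('h \<Rightarrow> 'h) \<Rightarrow> bool" where
  "bounded_operator_on H T \<longleftrightarrow>
     linear_map_on H H T \<and> (\<exists>C. \<forall>x\<in>H. norm (T x) \<le> C * norm x)"

definition positive_operator_on :: "'h::real_inner set \<Rightarrow> ('h \<Rightarrow> 'h) \<Rightarrow> bool" where
  "positive_operator_on H T \<longleftrightarrow> bounded_operator_on H T \<and>
     (\<forall>x\<in>H. \<forall>y\<in>H. T x \<bullet> y = x \<bullet> T y) \<and> (\<forall>x\<in>H. 0 \<le> T x \<bullet> x)"

definition sqrt_operator :: "'h::real_inner set \<Rightarrow> ('h \<Rightarrow> 'h) \<Rightarrow> 'h \<Rightarrow> 'h" where
  "sqrt_operator H T = (SOME R. positive_operator_on H R \<and> (\<forall>x\<in>H. R (R x) = T x))"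

definition orthonormal_basis :: "'h::real_inner set \<Rightarrow> 'h set \<Rightarrow> bool" where
  "orthonormal_basis H E \<longleftrightarrow>
     E \<subseteq> H \<and> pairwise orthogonal E \<and> (\<forall>e\<in>E. norm e = 1) \<and> closure (span E) = H"

text \<open>Traces and Hilbert-Schmidt norms do not depend on the choice of the basis.\<close>
definition hilbert_basis :: "'h::real_inner set \<Rightarrow> 'h set" where
  "hilbert_basis H = (SOME E. orthonormal_basis H E)"

definition trace_class_covariance :: "'h::real_inner set \<Rightarrow> ('h \<Rightarrow> 'h) \<Rightarrow> bool" where
  "trace_class_covariance H C \<longleftrightarrow>
     positive_operator_on H C \<and> (\<lambda>e. C e \<bullet> e) summable_on hilbert_basis H"

text \<open>Hilbert-Schmidt operators from \<open>C\<^sup>1\<^sup>/\<^sup>2 H\<close> to \<open>H\<close>: the square of their norm is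
  \<open>Tr(\<Phi> C \<Phi>\<^sup>*) = \<parallel>\<Phi> C\<^sup>1\<^sup>/\<^sup>2\<parallel>\<^sup>2\<close>, the latter being the Hilbert-Schmidt norm on \<open>H\<close>.\<close>
definition L_Q :: "'h::real_inner set \<Rightarrow> ('h \<Rightarrow> 'h) \<Rightarrow> ('h \<Rightarrow> 'h) set" where
  "L_Q H C = {\<Phi>. linear_map_on (sqrt_operator H C ` H) H \<Phi> \<and>
     (\<lambda>e. (norm (\<Phi> (sqrt_operator H C e)))\<^sup>2) summable_on hilbert_basis H}"

definition L_Q_norm :: "'h::real_inner set \<Rightarrow> ('h \<Rightarrow> 'h) \<Rightarrow> ('h \<Rightarrow> 'h) \<Rightarrow> real" where
  "L_Q_norm H C \<Phi> = sqrt (\<Sum>\<^sub>\<infinity>e\<in>hilbert_basis H. (norm (\<Phi> (sqrt_operator H C e)))\<^sup>2)"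


section \<open>Noise\<close>

text \<open>Time is modelled by \<open>real\<close>; only times \<open>t \<ge> 0\<close> matter.\<close>

definition usual_conditions :: "'w measure \<Rightarrow> (real \<Rightarrow> 'w measure) \<Rightarrow> bool" where
  "usual_conditions M F \<longleftrightarrow> prob_space M \<and> (\<forall>t\<ge>0. subalgebra M (F t)) \<and>
     (\<forall>s t. 0 \<le> s \<and> s \<le> t \<longrightarrow> sets (F s) \<subseteq> sets (F t)) \<and>
     (\<forall>t\<ge>0. sets (F t) = (\<Inter>s\<in>{t<..}. sets (F s))) \<and>
     (\<forall>N\<in>null_sets M. \<forall>A\<subseteq>N. A \<in> sets (F 0))"

definition centered_gaussian :: "'w measure \<Rightarrow> ('w \<Rightarrow> real) \<Rightarrow> real \<Rightarrow> bool" where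
  "centered_gaussian M X v \<longleftrightarrow>
     (if v = 0 then AE \<omega> in M. X \<omega> = 0 else distributed M lborel X (normal_density 0 (sqrt v)))"

definition wiener_process ::
    "'w measure \<Rightarrow> (real \<Rightarrow> 'w measure) \<Rightarrow> 'h::real_inner set \<Rightarrow> ('h \<Rightarrow> 'h) \<Rightarrow> (real \<Rightarrow> 'w \<Rightarrow> 'h) \<Rightarrow> bool"
  where
  "wiener_process M F H C W \<longleftrightarrow>
     (\<forall>t\<ge>0. W t \<in> F t \<rightarrow>\<^sub>M borel) \<and> (\<forall>t\<ge>0. \<forall>\<omega>\<in>space M. W t \<omega> \<in> H) \<and>
     (AE \<omega> in M. W 0 \<omega> = 0 \<and> continuous_on {0..} (\<lambda>t. W t \<omega>)) \<and>
     (\<forall>s t. 0 \<le> s \<and> s < t \<longrightarrow>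
        prob_space.indep_set M (sets (F s))
          {(\<lambda>\<omega>. W t \<omega> - W s \<omega>) -` A \<inter> space M | A. A \<in> sets borel} \<and>
        (\<forall>h\<in>H. centered_gaussian M (\<lambda>\<omega>. (W t \<omega> - W s \<omega>) \<bullet> h) ((t - s) * (C h \<bullet> h))))"

text \<open>The Ito integral \<open>Z t = \<integral>\<^sub>0\<^sup>t \<Phi> dW\<close> of a constant integrand \<open>\<Phi> \<in> L_Q\<close>, which need not be
  defined on all of \<open>H\<close>: it is the mean-square limit of \<open>\<integral>\<^sub>0\<^sup>t \<Psi>\<^sub>n dW = \<Psi>\<^sub>n (W t)\<close> for bounded
  operators \<open>\<Psi>\<^sub>n\<close> on \<open>H\<close> converging to \<open>\<Phi>\<close> in \<open>L_Q\<close>. This determines the continuous process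
  \<open>Z\<close> up to indistinguishability.\<close>
definition is_ito_integral ::
    "'w measure \<Rightarrow> (real \<Rightarrow> 'w measure) \<Rightarrow> 'h::real_inner set \<Rightarrow> ('h \<Rightarrow> 'h) \<Rightarrow> (real \<Rightarrow> 'w \<Rightarrow> 'h) \<Rightarrow>
     ('h \<Rightarrow> 'h) \<Rightarrow> (real \<Rightarrow> 'w \<Rightarrow> 'h) \<Rightarrow> bool"
  where
  "is_ito_integral M F H C W \<Phi> Z \<longleftrightarrow>
     (\<forall>t\<ge>0. Z t \<in> F t \<rightarrow>\<^sub>M borel) \<and> (\<forall>t\<ge>0. \<forall>\<omega>\<in>space M. Z t \<omega> \<in> H) \<and>
     (AE \<omega> in M. continuous_on {0..} (\<lambda>t. Z t \<omega>)) \<and>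
     (\<exists>\<Psi>. (\<forall>n. bounded_operator_on H (\<Psi> n)) \<and>
        (\<lambda>n. L_Q_norm H C (\<lambda>x. \<Psi> n x - \<Phi> x)) \<longlonglongrightarrow> 0 \<and>
        (\<forall>t\<ge>0. (\<lambda>n::nat. \<integral>\<^sup>+\<omega>. ennreal ((norm (Z t \<omega> - \<Psi> n (W t \<omega>)))\<^sup>2) \<partial>M) \<longlonglongrightarrow> 0))"

definition ito_integral ::
    "'w measure \<Rightarrow> (real \<Rightarrow> 'w measure) \<Rightarrow> 'h::real_inner set \<Rightarrow> ('h \<Rightarrow> 'h) \<Rightarrow> (real \<Rightarrow> 'w \<Rightarrow> 'h) \<Rightarrow>
     ('h \<Rightarrow> 'h) \<Rightarrow> real \<Rightarrow> 'w \<Rightarrow> 'h"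
  where
  "ito_integral M F H C W \<Phi> = (SOME Z. is_ito_integral M F H C W \<Phi> Z)"

definition progressively_measurable ::
    "(real \<Rightarrow> 'w measure) \<Rightarrow> (real \<Rightarrow> 'w \<Rightarrow> 'h::topological_space) \<Rightarrow> bool" where
  "progressively_measurable F X \<longleftrightarrow>
     (\<forall>T\<ge>0. (\<lambda>(s, \<omega>). X s \<omega>) \<in> restrict_space borel {0..T} \<Otimes>\<^sub>M F T \<rightarrow>\<^sub>M borel)"


section \<open>The stochastic convective Brinkman-Forchheimer equations\<close>

definition stokes_form :: "(real^'d) set \<Rightarrow> 'd::finite vfield \<Rightarrow> 'd vfield \<Rightarrow> real" where
  "stokes_form Q u v = weak_grad Q u \<bullet> weak_grad Q v"

text \<open>\<open>(u \<cdot> \<nabla>)u\<close> is the Jacobian matrix of \<open>u\<close> applied to \<open>u\<close>.\<close>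
definition convection_form :: "(real^'d) set \<Rightarrow> 'd::finite vfield \<Rightarrow> 'd vfield \<Rightarrow> real" where
  "convection_form Q u v =
     (LINT x:Q|lborel. (rep_L2 (weak_grad Q u) x *v rep_L2 u x) \<bullet> rep_L2 v x)"

definition forchheimer_form :: "(real^'d) set \<Rightarrow> real \<Rightarrow> 'd::finite vfield \<Rightarrow> 'd vfield \<Rightarrow> real" where
  "forchheimer_form Q varpi u v =
     (LINT x:Q|lborel. norm (rep_L2 u x) powr (varpi - 1) * (rep_L2 u x \<bullet> rep_L2 v x))"

definition cbf_form ::
    "(real^'d) set \<Rightarrow> real \<Rightarrow> real \<Rightarrow> real \<Rightarrow> real \<Rightarrow> 'd::finite vfield \<Rightarrow> 'd vfield \<Rightarrow> real" where
  "cbf_form Q \<mu> \<alpha> \<beta> varpi u v = \<mu> * stokes_form Q u v + convection_form Q u v +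
     \<alpha> * (u \<bullet> v) + \<beta> * forchheimer_form Q varpi u v"

text \<open>Paths in \<open>C([0,\<infinity>);\<bbbH>)\<close>, in \<open>L\<^sup>2(0,T;\<bbbV>)\<close> and in \<open>L\<^sup>p(0,T;L\<^sup>p)\<close> for
  \<open>p = varpi + 1\<close> and every \<open>T > 0\<close>. Strong measurability into the latter two spaces follows from
  continuity into \<open>\<bbbH>\<close>. As \<open>lebesgue\<close> is complete, the values at the exceptional times are
  irrelevant.\<close>
definition solution_path :: "(real^'d) set \<Rightarrow> real \<Rightarrow> (real \<Rightarrow> 'd::finite vfield) \<Rightarrow> bool" where
  "solution_path Q varpi w \<longleftrightarrow>
     (\<forall>t\<ge>0. w t \<in> H_space Q) \<and> continuous_on {0..} w \<and>
     (AE t in lebesgue. 0 \<le> t \<longrightarrow> w t \<in> V_space Q \<inter> Lp_space Q (varpi + 1)) \<and>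
     (\<forall>T>0. set_integrable lebesgue {0..T} (\<lambda>t. (V_norm Q (w t))\<^sup>2)) \<and>
     (\<forall>T>0. set_integrable lebesgue {0..T} (\<lambda>t. (Lp_norm (varpi + 1) (w t)) powr (varpi + 1)))"

text \<open>The process \<open>Z\<close> is the noise term \<open>\<integral>\<^sub>0\<^sup>t \<Upsilon> dW\<close>.\<close>
definition scbf_solution ::
    "(real^'d) set \<Rightarrow> real \<Rightarrow> real \<Rightarrow> real \<Rightarrow> real \<Rightarrow> ('d::finite vfield \<Rightarrow> real) \<Rightarrow>
     'w measure \<Rightarrow> (real \<Rightarrow> 'w measure) \<Rightarrow> (real \<Rightarrow> 'w \<Rightarrow> 'd vfield) \<Rightarrow>
     'd vfield \<Rightarrow> (real \<Rightarrow> 'w \<Rightarrow> 'd vfield) \<Rightarrow> bool"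
  where
  "scbf_solution Q \<mu> \<alpha> \<beta> varpi f M F Z u\<^sub>0 u \<longleftrightarrow>
     progressively_measurable F u \<and>
     (AE \<omega> in M. solution_path Q varpi (\<lambda>t. u t \<omega>) \<and> u 0 \<omega> = u\<^sub>0 \<and>
        (\<forall>v \<in> V_space Q \<inter> Lp_space Q (varpi + 1). \<forall>t\<ge>0.
           u t \<omega> \<bullet> v + (LINT s:{0..t}|lebesgue. cbf_form Q \<mu> \<alpha> \<beta> varpi (u s \<omega>) v) =
           u\<^sub>0 \<bullet> v + t * f v + Z t \<omega> \<bullet> v))"

definition da_solution ::
    "(real^'d) set \<Rightarrow> real \<Rightarrow> real \<Rightarrow> real \<Rightarrow> real \<Rightarrow> ('d::finite vfield \<Rightarrow> real) \<Rightarrow>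
     'w measure \<Rightarrow> (real \<Rightarrow> 'w measure) \<Rightarrow> (real \<Rightarrow> 'w \<Rightarrow> 'd vfield) \<Rightarrow>
     real \<Rightarrow> ('d vfield \<Rightarrow> 'd vfield) \<Rightarrow> (real \<Rightarrow> 'w \<Rightarrow> 'd vfield) \<Rightarrow>
     'd vfield \<Rightarrow> (real \<Rightarrow> 'w \<Rightarrow> 'd vfield) \<Rightarrow> bool"
  where
  "da_solution Q \<mu> \<alpha> \<beta> varpi f M F Z \<sigma> J u U\<^sub>0 U \<longleftrightarrow>
     progressively_measurable F U \<and>
     (AE \<omega> in M. solution_path Q varpi (\<lambda>t. U t \<omega>) \<and> U 0 \<omega> = U\<^sub>0 \<and>
        (\<forall>v \<in> V_space Q \<inter> Lp_space Q (varpi + 1). \<forall>t\<ge>0.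
           U t \<omega> \<bullet> v + (LINT s:{0..t}|lebesgue. cbf_form Q \<mu> \<alpha> \<beta> varpi (U s \<omega>) v) =
           U\<^sub>0 \<bullet> v + t * f v + Z t \<omega> \<bullet> v
           - \<sigma> * (LINT s:{0..t}|lebesgue. helmholtz Q (J (U s \<omega> - u s \<omega>)) \<bullet> v)))"

text \<open>Meaningful for \<open>varpi > 3\<close> and \<open>\<mu>, \<beta> > 0\<close>.\<close>
definition varpi_hat :: "real \<Rightarrow> real \<Rightarrow> real \<Rightarrow> real" where
  "varpi_hat \<mu> \<beta> varpi =
     (varpi - 3) / (2 * \<mu> * (varpi - 1)) * (4 / (\<mu> * \<beta> * (varpi - 1))) powr (2 / (varpi - 3))"

definition exponentially_fast :: "(real \<Rightarrow> real) \<Rightarrow> bool" where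
  "exponentially_fast g \<longleftrightarrow> (\<exists>a>0. \<exists>b>0. \<forall>t\<ge>0. g t \<le> b * exp (- a * t))"

end

theory Submission
  imports Defs
begin

text \<open>The noise is additive and common to both equations, so it cancels in the difference \<open>w = u - U\<close>.
For almost every \<open>\<omega>\<close> the path of \<open>w\<close> solves the deterministic equation
\<open>w' + \<mu> A w + B(u,u) - B(U,U) + \<alpha> w + \<beta> (K(u) - K(U)) + \<sigma> P J w = 0\<close>, and the claim becomes
a deterministic energy estimate for each path: formally,
\<open>d/dt \<parallel>w\<parallel>\<^sup>2 = - 2 G(w)\<close>, where \<open>G(w)\<close> is the sum of the terms after \<open>w'\<close> tested with \<open>w\<close>,
and \<open>2 G(w) \<ge> \<kappa> \<parallel>w\<parallel>\<^sup>2\<close> with a rate \<open>\<kappa> > 0\<close> yields \<open>\<parallel>w(t)\<parallel> \<le> \<parallel>w(0)\<parallel> exp (- \<kappa> t / 2)\<close>.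

Coercivity (\<open>nudged_difference_coercive\<close>). Antisymmetry of the trilinear form turns
\<open>B(u,u) - B(U,U)\<close> tested with \<open>w\<close> into \<open>- \<integral>(w \<cdot> \<nabla>)w \<cdot> u\<close>. Its integrand is at most
\<open>l/2 \<bar>\<nabla>w\<bar>\<^sup>2 + \<bar>u\<bar>\<^sup>2 \<bar>w\<bar>\<^sup>2 / (2 l)\<close>; the first part is taken from the viscosity. The monotonicity of the
damping provides \<open>\<beta>/2 \<bar>u\<bar>\<^bsup>varpi - 1\<^esup> \<bar>w\<bar>\<^sup>2\<close>, and this absorbs the second part up to \<open>c \<bar>w\<bar>\<^sup>2\<close> as
soon as \<open>r\<^sup>2 / (2 l) \<le> \<beta>/2 r\<^bsup>varpi - 1\<^esup> + c\<close> for all \<open>r \<ge> 0\<close>. The approximation property of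
the interpolant gives \<open>\<sigma> (J w, w) \<ge> \<sigma>/2 \<parallel>w\<parallel>\<^sup>2 - \<sigma> c\<^sub>0 \<theta>\<^sup>2 / 2 \<parallel>\<nabla>w\<parallel>\<^sup>2\<close>. Hence
\<open>\<kappa> = 2 \<alpha> + \<sigma> - 2 c\<close> under the condition \<open>\<sigma> c\<^sub>0 \<theta>\<^sup>2 \<le> 2 \<mu> - l\<close>. The three hypotheses are the choices
\<open>l = 1/\<beta>, c = 0\<close>, then \<open>l = \<mu>, c = varpi_hat\<close>, and \<open>l = 1/\<beta>, c = \<beta>/2\<close>.

The energy inequality (\<open>energy_inequality\<close>). Testing the equation for \<open>w\<close> with \<open>w\<close> itself is not
allowed as it stands, since the test functions do not depend on time. However,
\<open>\<parallel>w(t + h)\<parallel>\<^sup>2 - \<parallel>w(t)\<parallel>\<^sup>2 = (w(t + h) - w(t)) \<bullet> w(t) + (w(t + h) - w(t)) \<bullet> w(t + h)\<close>, and for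
almost every \<open>t\<close> both \<open>w(t)\<close> and \<open>w(t + h)\<close> are admissible fixed test functions. Averaging over
\<open>t\<close> and letting \<open>h \<rightarrow> 0\<close> gives the claim, provided that translations are continuous along
the path: \<open>\<integral> E(w(t + h) - w(t)) dt \<rightarrow> 0\<close> for the energy
\<open>E(v) = \<parallel>v\<parallel>\<^sup>2 + \<parallel>\<nabla>v\<parallel>\<^sup>2 + \<integral>\<bar>v\<bar>\<^bsup>varpi + 1\<^esup>\<close>, which controls every term of the equation. This continuity
(\<open>translation_continuity\<close>) comes from convexity. The energy satisfies Clarkson's inequality
\<open>E((a - b)/2) + E((a + b)/2) \<le> (E(a) + E(b))/2\<close>, it is lower
semicontinuous for convergence in \<open>L\<^sup>2\<close>, and the path is continuous in \<open>L\<^sup>2\<close>; so Fatou's lemma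
bounds \<open>\<integral> E((w(t + h) + w(t))/2) dt\<close> from below in the limit and leaves nothing for the differences.

Two more ingredients make these steps rigorous. The weak gradient must be
unique and agree with the classical one on test fields, which rests on the fundamental lemma of
the calculus of variations. And every term of the equation must be measurable in time along the
path: each is a pointwise limit of functionals that are continuous on \<open>L\<^sup>2\<close>; for the interpolant
this follows from an approximate Riesz representation. The Helmholtz projection disappears from the
tested equation because \<open>L\<^sup>2\<close> functions supported in \<open>Q\<close> form a complete space.\<close>

section \<open>Representatives and superposition operators\<close>

lemma square_integrable_rep: "square_integrable (rep_L2 u)"
  using Quotient3_rep_reflp[OF Quotient3_L2] by (auto simp: L2_rel_def)

lemma borel_measurable_rep_L2 [measurable]: "rep_L2 u \<in> borel_measurable borel"
  using square_integrable_rep[of u] by (simp add: square_integrable_def)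

lemma rep_abs_L2:
  assumes "square_integrable f"
  shows "AE x in lborel. rep_L2 (abs_L2 f) x = f x"
proof -
  have "L2_rel f (rep_L2 (abs_L2 f))"
    by (rule rep_abs_rsp[OF Quotient3_L2]) (use assms in \<open>auto simp: L2_rel_def\<close>)
  then show ?thesis
    by (auto simp: L2_rel_def elim: AE_mp)
qed

lemma abs_rep_L2: "abs_L2 (rep_L2 u) = u"
  by (rule Quotient3_abs_rep[OF Quotient3_L2])

lemma abs_L2_cong_AE:
  assumes "square_integrable f" "square_integrable g" "AE x in lborel. f x = g x"
  shows "abs_L2 f = abs_L2 g"
  using Quotient3_rel[OF Quotient3_L2, of f g] assms by (auto simp: L2_rel_def)

lemma L2_eqI:
  assumes "AE x in lborel. rep_L2 u x = rep_L2 v x"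
  shows "u = v"
  using abs_L2_cong_AE[OF square_integrable_rep square_integrable_rep assms]
  by (simp add: abs_rep_L2)

lemma rep_L2_add: "AE x in lborel. rep_L2 (u + v) x = rep_L2 u x + rep_L2 v x"
proof -
  have "u + v = abs_L2 (\<lambda>x. rep_L2 u x + rep_L2 v x)"
    using plus_L2.abs_eq[of "rep_L2 u" "rep_L2 v"]
    by (simp add: abs_rep_L2 L2_rel_def square_integrable_rep)
  then show ?thesis
    by (simp add: rep_abs_L2 square_integrable_add square_integrable_rep)
qed

lemma rep_L2_scaleR: "AE x in lborel. rep_L2 (c *\<^sub>R u) x = c *\<^sub>R rep_L2 u x"
proof -
  have "c *\<^sub>R u = abs_L2 (\<lambda>x. c *\<^sub>R rep_L2 u x)"
    using scaleR_L2.abs_eq[of "rep_L2 u" c]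
    by (simp add: abs_rep_L2 L2_rel_def square_integrable_rep)
  then show ?thesis
    by (simp add: rep_abs_L2 square_integrable_scaleR square_integrable_rep)
qed

lemma rep_L2_diff: "AE x in lborel. rep_L2 (u - v) x = rep_L2 u x - rep_L2 v x"
  using rep_L2_add[of u "(-1) *\<^sub>R v"] rep_L2_scaleR[of "-1" v] by auto

lemma integrable_norm_sq_L2: "integrable lborel (\<lambda>x. (norm (rep_L2 u x))\<^sup>2)"
  using square_integrable_rep[of u] by (simp add: square_integrable_def)

lemma norm_L2_sq: "(norm u)\<^sup>2 = (LINT x|lborel. (norm (rep_L2 u x))\<^sup>2)"
  by (simp add: power2_norm_eq_inner inner_L2.rep_eq)

lemma inner_abs_L2:
  assumes "square_integrable f" "square_integrable g"
  shows "abs_L2 f \<bullet> abs_L2 g = (LINT x|lborel. f x \<bullet> g x)"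
  using assms by (intro inner_L2.abs_eq) (auto simp: L2_rel_def)

lemma inner_abs_L2_right:
  assumes "square_integrable g"
  shows "u \<bullet> abs_L2 g = (LINT x|lborel. rep_L2 u x \<bullet> g x)"
  using inner_abs_L2[OF square_integrable_rep assms, of u] by (simp add: abs_rep_L2)

text \<open>The Nemytskii operator of \<open>b\<close>.\<close>

definition superposition :: "('a::euclidean_space \<Rightarrow> 'b::euclidean_space \<Rightarrow> 'c::euclidean_space)
    \<Rightarrow> ('a, 'b) L2 \<Rightarrow> ('a, 'c) L2" where
  "superposition b u = abs_L2 (\<lambda>x. b x (rep_L2 u x))"

text \<open>The Lipschitz bound together with \<open>b x 0 = 0\<close> gives linear growth, so the operator maps \<open>L\<^sup>2\<close>
  into \<open>L\<^sup>2\<close>. The resulting continuity is the source of all measurability statements below: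
  multiplication by a bounded matrix field and truncated powers are of this kind.\<close>

locale lipschitz_superposition =
  fixes b :: "'a::euclidean_space \<Rightarrow> 'b::euclidean_space \<Rightarrow> 'c::euclidean_space" and L :: real
  assumes measurable_comp: "\<And>f. f \<in> borel_measurable borel \<Longrightarrow> (\<lambda>x. b x (f x)) \<in> borel_measurable borel"
    and zero: "\<And>x. b x 0 = 0"
    and lipschitz: "\<And>x y z. norm (b x y - b x z) \<le> L * norm (y - z)"
begin

lemma square_integrable: "square_integrable (\<lambda>x. b x (rep_L2 u x))"
  unfolding square_integrable_def
proof
  have [measurable]: "(\<lambda>x. b x (rep_L2 u x)) \<in> borel_measurable borel"
    by (rule measurable_comp) measurable
  then show "(\<lambda>x. b x (rep_L2 u x)) \<in> borel_measurable lborel"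
    by simp
  have le: "norm (b x y) \<le> L * norm y" for x y
    using lipschitz[of x y 0] by (simp add: zero)
  have "(norm (b x y))\<^sup>2 \<le> L\<^sup>2 * (norm y)\<^sup>2" for x y
    using power_mono[OF le[of x y] norm_ge_zero, of 2] by (simp add: power_mult_distrib)
  then show "integrable lborel (\<lambda>x. (norm (b x (rep_L2 u x)))\<^sup>2)"
    by (intro Bochner_Integration.integrable_bound[OF integrable_mult_right[OF integrable_norm_sq_L2[of u], of "L\<^sup>2"]])
       auto
qed

lemma rep: "AE x in lborel. rep_L2 (superposition b u) x = b x (rep_L2 u x)"
  unfolding superposition_def by (rule rep_abs_L2[OF square_integrable])

lemma norm_diff_sq_le: "(norm (superposition b u - superposition b v))\<^sup>2 \<le> L\<^sup>2 * (norm (u - v))\<^sup>2"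
proof -
  have "(LINT x|lborel. (norm (rep_L2 (superposition b u - superposition b v) x))\<^sup>2)
      \<le> (LINT x|lborel. L\<^sup>2 * (norm (rep_L2 (u - v) x))\<^sup>2)"
  proof (rule integral_mono_AE)
    show "AE x in lborel. (norm (rep_L2 (superposition b u - superposition b v) x))\<^sup>2
        \<le> L\<^sup>2 * (norm (rep_L2 (u - v) x))\<^sup>2"
      using rep[of u] rep[of v] rep_L2_diff[of u v]
        rep_L2_diff[of "superposition b u" "superposition b v"]
    proof eventually_elim
      case (elim x)
      then show ?case
        using power_mono[OF lipschitz[of x "rep_L2 u x" "rep_L2 v x"] norm_ge_zero, of 2]
        by (simp add: power_mult_distrib)
    qed
  qed (auto intro: integrable_norm_sq_L2)
  then show ?thesis
    by (simp add: norm_L2_sq)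
qed

lemma continuous: "continuous_on UNIV (superposition b)"
proof (rule continuous_onI)
  fix u :: "('a, 'b) L2" and e :: real
  assume "0 < e"
  have le: "dist (superposition b v) (superposition b u) \<le> \<bar>L\<bar> * dist v u" for v
    using norm_diff_sq_le[of v u]
    by (auto simp: dist_norm power_mult_distrib[symmetric] power2_le_iff_abs_le
        abs_le_square_iff[symmetric] abs_mult)
  show "\<exists>d>0. \<forall>v\<in>UNIV. dist v u < d \<longrightarrow> dist (superposition b v) (superposition b u) \<le> e"
  proof (intro exI[of _ "e / (\<bar>L\<bar> + 1)"] conjI ballI impI)
    fix v assume "dist v u < e / (\<bar>L\<bar> + 1)"
    then have "\<bar>L\<bar> * dist v u + dist v u \<le> e"
      by (simp add: pos_less_divide_eq algebra_simps)
    then show "dist (superposition b v) (superposition b u) \<le> e"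
      using le[of v] zero_le_dist[of v u] by linarith
  qed (use \<open>0 < e\<close> in simp)
qed

end

section \<open>Smooth functions and test functions\<close>

lemma Ck_on_continuous:
  assumes "Ck_on k UNIV f" shows "continuous_on UNIV f"
  using assms
  by (cases k) (auto intro!: continuous_at_imp_continuous_on differentiable_imp_continuous_within)

lemma Ck_on_lower:
  assumes "Ck_on (Suc k) UNIV f" shows "Ck_on k UNIV f"
  using assms
proof (induction k arbitrary: f)
  case 0
  then show ?case using Ck_on_continuous[OF 0] by simp
next
  case (Suc k)
  then show ?case by (metis Ck_on.simps(2))
qed

lemma Ck_on_SucI:
  assumes "\<And>x. (f has_derivative f' x) (at x)" "\<And>v. Ck_on k UNIV (\<lambda>x. f' x v)"
  shows "Ck_on (Suc k) UNIV f"
proof -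
  have "frechet_derivative f (at x) = f' x" for x
    using frechet_derivative_at[OF assms(1)] by simp
  then show ?thesis
    using assms by (auto simp: differentiable_def)
qed

lemma Ck_on_Suc_has_derivative:
  assumes "Ck_on (Suc k) UNIV f"
  shows "(f has_derivative frechet_derivative f (at x)) (at x)"
  using assms by (simp add: frechet_derivative_works)

lemma Ck_on_const: "Ck_on k UNIV (\<lambda>x. c)"
proof (induction k arbitrary: c)
  case (Suc k)
  show ?case by (rule Ck_on_SucI[where f' = "\<lambda>x v. 0"]) (auto intro: Suc)
qed simp

lemma Ck_on_linear:
  assumes "bounded_linear L" shows "Ck_on k UNIV L"
proof (cases k)
  case 0
  then show ?thesis using assms by (simp add: linear_continuous_on)
next
  case (Suc n)
  show ?thesis unfolding Suc
    by (rule Ck_on_SucI[where f' = "\<lambda>x. L"])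
       (use assms in \<open>auto intro: Ck_on_const bounded_linear_imp_has_derivative\<close>)
qed

lemma Ck_on_compose_linear:
  assumes L: "bounded_linear L"
  shows "Ck_on k UNIV f \<Longrightarrow> Ck_on k UNIV (\<lambda>x. L (f x))"
proof (induction k arbitrary: f)
  case 0
  then show ?case using bounded_linear.continuous_on[OF L] by simp
next
  case (Suc k)
  show ?case
  proof (rule Ck_on_SucI)
    show "((\<lambda>x. L (f x)) has_derivative (\<lambda>v. L (frechet_derivative f (at x) v))) (at x)" for x
      by (rule bounded_linear.has_derivative[OF L Ck_on_Suc_has_derivative[OF Suc.prems]])
    show "Ck_on k UNIV (\<lambda>x. L (frechet_derivative f (at x) v))" for v
      using Suc.prems by (intro Suc.IH) simp
  qed
qed

lemma Ck_on_add:
  "Ck_on k UNIV f \<Longrightarrow> Ck_on k UNIV g \<Longrightarrow> Ck_on k UNIV (\<lambda>x. f x + g x)"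
proof (induction k arbitrary: f g)
  case 0
  then show ?case by (auto intro: continuous_on_add)
next
  case (Suc k)
  show ?case
  proof (rule Ck_on_SucI)
    show "((\<lambda>x. f x + g x) has_derivative
        (\<lambda>v. frechet_derivative f (at x) v + frechet_derivative g (at x) v)) (at x)" for x
      by (intro has_derivative_add Ck_on_Suc_has_derivative[OF Suc.prems(1)]
          Ck_on_Suc_has_derivative[OF Suc.prems(2)])
    show "Ck_on k UNIV (\<lambda>x. frechet_derivative f (at x) v + frechet_derivative g (at x) v)" for v
      using Suc.prems by (intro Suc.IH) simp_all
  qed
qed

lemma Ck_on_mult:
  fixes f g :: "'a::real_normed_vector \<Rightarrow> real"
  shows "Ck_on k UNIV f \<Longrightarrow> Ck_on k UNIV g \<Longrightarrow> Ck_on k UNIV (\<lambda>x. f x * g x)"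
proof (induction k arbitrary: f g)
  case 0
  then show ?case by (auto intro: continuous_on_mult)
next
  case (Suc k)
  show ?case
  proof (rule Ck_on_SucI)
    show "((\<lambda>x. f x * g x) has_derivative
        (\<lambda>v. f x * frechet_derivative g (at x) v + frechet_derivative f (at x) v * g x)) (at x)" for x
      by (intro has_derivative_mult Ck_on_Suc_has_derivative[OF Suc.prems(1)]
          Ck_on_Suc_has_derivative[OF Suc.prems(2)])
    show "Ck_on k UNIV (\<lambda>x. f x * frechet_derivative g (at x) v + frechet_derivative f (at x) v * g x)"
      for v
      using Suc.prems Ck_on_lower[OF Suc.prems(1)] Ck_on_lower[OF Suc.prems(2)]
      by (intro Ck_on_add Suc.IH) simp_all
  qed
qed

lemma Ck_on_prod:
  fixes f :: "'i \<Rightarrow> 'a::real_normed_vector \<Rightarrow> real"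
  assumes "\<And>i. i \<in> I \<Longrightarrow> Ck_on k UNIV (f i)"
  shows "Ck_on k UNIV (\<lambda>x. \<Prod>i\<in>I. f i x)"
  using assms
proof (induction I rule: infinite_finite_induct)
  case (insert i I)
  then show ?case by (simp add: Ck_on_mult)
qed (simp_all add: Ck_on_const)

text \<open>A single function \<open>h\<close> does not suffice for the induction, because the chain rule replaces \<open>h\<close> by its
  derivative; a class that is closed under differentiation does.\<close>

lemma Ck_on_compose_class:
  fixes f :: "'a::real_normed_vector \<Rightarrow> real"
  assumes closed: "\<And>h. h \<in> A \<Longrightarrow> \<exists>h'\<in>A. \<forall>y. (h has_real_derivative h' y) (at y)"
  shows "h \<in> A \<Longrightarrow> Ck_on k UNIV f \<Longrightarrow> Ck_on k UNIV (\<lambda>x. h (f x))"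
proof (induction k arbitrary: h)
  case 0
  then obtain h' where "\<forall>y. (h has_real_derivative h' y) (at y)"
    using closed by blast
  then have "continuous_on UNIV h"
    by (meson DERIV_isCont continuous_at_imp_continuous_on)
  then show ?case
    using 0 by (auto intro: continuous_on_compose2)
next
  case (Suc k)
  then obtain h' where h': "h' \<in> A" "\<And>y. (h has_real_derivative h' y) (at y)"
    using closed by blast
  show ?case
  proof (rule Ck_on_SucI)
    show "((\<lambda>x. h (f x)) has_derivative (\<lambda>v. h' (f x) * frechet_derivative f (at x) v)) (at x)" for x
      using has_derivative_compose[OF Ck_on_Suc_has_derivative[OF Suc.prems(2), of x]
          h'(2)[of "f x", unfolded has_field_derivative_def]]
      by simp
    show "Ck_on k UNIV (\<lambda>x. h' (f x) * frechet_derivative f (at x) v)" for v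
      using Suc.prems(2)
      by (intro Ck_on_mult Suc.IH[OF h'(1) Ck_on_lower[OF Suc.prems(2)]]) simp
  qed
qed

lemma test_function_Ck: "\<phi> \<in> test_functions Q \<Longrightarrow> Ck_on k UNIV \<phi>"
  by (simp add: test_functions_def smooth_on_def)

lemma test_function_has_derivative:
  assumes "\<phi> \<in> test_functions Q"
  shows "(\<phi> has_derivative frechet_derivative \<phi> (at x)) (at x)"
  using Ck_on_Suc_has_derivative[OF test_function_Ck[OF assms, of "Suc 0"]] .

text \<open>All closure properties of test functions reduce to this: the result of the operation is smooth and its
  support does not grow.\<close>

lemma test_functions_support_subset:
  assumes "\<phi> \<in> test_functions Q" "smooth_on UNIV f" "{x. f x \<noteq> 0} \<subseteq> closure {x. \<phi> x \<noteq> 0}"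
  shows "f \<in> test_functions Q"
proof -
  have sub: "closure {x. f x \<noteq> 0} \<subseteq> closure {x. \<phi> x \<noteq> 0}"
    using assms(3) by (simp add: closure_minimal)
  have "compact (closure {x. f x \<noteq> 0})"
    using assms(1) compact_Int_closed[of "closure {x. \<phi> x \<noteq> 0}" "closure {x. f x \<noteq> 0}"] sub
    by (simp add: test_functions_def inf.absorb2)
  then show ?thesis
    using assms(1,2) sub unfolding test_functions_def by blast
qed

lemma test_function_zero_outside:
  assumes "\<phi> \<in> test_functions Q" "x \<notin> Q" shows "\<phi> x = 0"
  using assms closure_subset[of "{x. \<phi> x \<noteq> 0}"] by (auto simp: test_functions_def)

lemma test_function_deriv_zero_off_support:
  assumes "x \<notin> closure {x. \<phi> x \<noteq> 0}"
  shows "frechet_derivative \<phi> (at x) = (\<lambda>v. 0)"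
proof -
  have "eventually (\<lambda>y. y \<in> - closure {x. \<phi> x \<noteq> 0}) (nhds x)"
    using assms by (intro eventually_nhds_in_open) auto
  then have "eventually (\<lambda>y. \<phi> y = 0) (nhds x)"
    by eventually_elim (use closure_subset[of "{x. \<phi> x \<noteq> 0}"] in auto)
  then have "(\<phi> has_derivative (\<lambda>v. 0)) (at x)"
    by (intro has_derivative_transform_eventually[OF has_derivative_const[of 0]])
       (auto simp: eventually_at_filter elim: eventually_mono dest: eventually_nhds_x_imp_x)
  then show ?thesis
    using frechet_derivative_at by metis
qed

lemma test_function_deriv:
  assumes "\<phi> \<in> test_functions Q"
  shows "(\<lambda>x. frechet_derivative \<phi> (at x) v) \<in> test_functions Q"
proof (rule test_functions_support_subset[OF assms])
  show "smooth_on UNIV (\<lambda>x. frechet_derivative \<phi> (at x) v)"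
    unfolding smooth_on_def using test_function_Ck[OF assms, of "Suc k" for k] by simp
  show "{x. frechet_derivative \<phi> (at x) v \<noteq> 0} \<subseteq> closure {x. \<phi> x \<noteq> 0}"
    using test_function_deriv_zero_off_support[of _ \<phi>] by (metis (mono_tags, lifting) mem_Collect_eq subsetI)
qed

lemma Ck_on_sum:
  assumes "\<And>i. i \<in> I \<Longrightarrow> Ck_on k UNIV (f i)"
  shows "Ck_on k UNIV (\<lambda>x. \<Sum>i\<in>I. f i x)"
  using assms
proof (induction I rule: infinite_finite_induct)
  case (insert i I)
  then show ?case by (simp add: Ck_on_add)
qed (simp_all add: Ck_on_const)

lemma test_function_add:
  assumes "f \<in> test_functions Q" "g \<in> test_functions Q"
  shows "(\<lambda>x. f x + g x) \<in> test_functions Q"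
proof -
  let ?S = "closure {x. f x \<noteq> 0} \<union> closure {x. g x \<noteq> 0}"
  have "closure {x. f x + g x \<noteq> 0} \<subseteq> ?S"
  proof (rule closure_minimal)
    have "{x. f x + g x \<noteq> 0} \<subseteq> {x. f x \<noteq> 0} \<union> {x. g x \<noteq> 0}"
      by auto
    then show "{x. f x + g x \<noteq> 0} \<subseteq> ?S"
      using closure_subset[of "{x. f x \<noteq> 0}"] closure_subset[of "{x. g x \<noteq> 0}"] by blast
  qed auto
  moreover have "compact ?S" "?S \<subseteq> Q"
    using assms by (auto simp: test_functions_def)
  ultimately have "closure {x. f x + g x \<noteq> 0} \<subseteq> Q" "compact (closure {x. f x + g x \<noteq> 0})"
    using compact_Int_closed[of ?S "closure {x. f x + g x \<noteq> 0}"] by (auto simp: inf.absorb2)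
  moreover have "smooth_on UNIV (\<lambda>x. f x + g x)"
    using assms unfolding smooth_on_def by (auto intro: Ck_on_add test_function_Ck)
  ultimately show ?thesis
    by (simp add: test_functions_def)
qed

lemma test_function_zero: "(\<lambda>x. 0) \<in> test_functions Q"
  by (simp add: test_functions_def smooth_on_def Ck_on_const)

lemma test_function_compose_linear:
  assumes "\<phi> \<in> test_functions Q" "bounded_linear L"
  shows "(\<lambda>x. L (\<phi> x)) \<in> test_functions Q"
proof (rule test_functions_support_subset[OF assms(1)])
  show "smooth_on UNIV (\<lambda>x. L (\<phi> x))"
    unfolding smooth_on_def using test_function_Ck[OF assms(1)] Ck_on_compose_linear[OF assms(2)] by blast
  show "{x. L (\<phi> x) \<noteq> 0} \<subseteq> closure {x. \<phi> x \<noteq> 0}"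
    using closure_subset[of "{x. \<phi> x \<noteq> 0}"] linear_0[OF bounded_linear.linear[OF assms(2)]] by auto
qed

lemma test_function_mult:
  fixes \<phi> g :: "'a::real_normed_vector \<Rightarrow> real"
  assumes "\<phi> \<in> test_functions Q" "smooth_on UNIV g"
  shows "(\<lambda>x. \<phi> x * g x) \<in> test_functions Q"
proof (rule test_functions_support_subset[OF assms(1)])
  show "smooth_on UNIV (\<lambda>x. \<phi> x * g x)"
    using assms(2) unfolding smooth_on_def by (intro allI Ck_on_mult test_function_Ck[OF assms(1)]) auto
  show "{x. \<phi> x * g x \<noteq> 0} \<subseteq> closure {x. \<phi> x \<noteq> 0}"
    using closure_subset[of "{x. \<phi> x \<noteq> 0}"] by auto
qed

lemma test_function_smooth: "\<phi> \<in> test_functions Q \<Longrightarrow> smooth_on UNIV \<phi>"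
  by (simp add: test_functions_def)

lemma test_function_continuous:
  assumes "\<phi> \<in> test_functions Q" shows "continuous_on UNIV \<phi>"
  by (rule Ck_on_continuous[OF test_function_Ck[OF assms, of 0]])

lemma test_function_bounded_support:
  fixes \<phi> :: "'a::euclidean_space \<Rightarrow> 'b::real_normed_vector"
  assumes "\<phi> \<in> test_functions Q"
  obtains R where "R > 0" "\<And>x. \<phi> x \<noteq> 0 \<Longrightarrow> norm x \<le> R"
proof -
  have "bounded (closure {x. \<phi> x \<noteq> 0})"
    using assms by (auto simp: test_functions_def compact_imp_bounded)
  then obtain R where "R > 0" "\<forall>x\<in>closure {x. \<phi> x \<noteq> 0}. norm x \<le> R"
    by (auto simp: bounded_pos)
  then show thesis
    using closure_subset[of "{x. \<phi> x \<noteq> 0}"] by (intro that[of R]) auto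
qed

lemma test_function_bounded:
  fixes \<phi> :: "'a::euclidean_space \<Rightarrow> 'b::real_normed_vector"
  assumes "\<phi> \<in> test_functions Q"
  obtains B where "B > 0" "\<And>x. norm (\<phi> x) \<le> B"
proof -
  obtain R where R: "R > 0" "\<And>x. \<phi> x \<noteq> 0 \<Longrightarrow> norm x \<le> R"
    using test_function_bounded_support[OF assms] by blast
  have "compact (\<phi> ` cball 0 R)"
    by (intro compact_continuous_image continuous_on_subset[OF test_function_continuous[OF assms]]) auto
  then obtain B where B: "B > 0" "\<forall>y\<in>\<phi> ` cball 0 R. norm y \<le> B"
    using compact_imp_bounded bounded_pos by metis
  have "norm (\<phi> x) \<le> B" for x
    using B R(2)[of x] by (cases "\<phi> x = 0") (auto simp: dist_norm)
  with B(1) show thesis by (rule that)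
qed

lemma test_function_integrable:
  fixes \<phi> :: "'a::euclidean_space \<Rightarrow> 'b::euclidean_space"
  assumes "\<phi> \<in> test_functions Q" shows "integrable lborel \<phi>"
proof -
  obtain R where R: "R > 0" "\<And>x. \<phi> x \<noteq> 0 \<Longrightarrow> norm x \<le> R"
    using test_function_bounded_support[OF assms] by blast
  have "(\<lambda>x. indicator (cball 0 R) x *\<^sub>R \<phi> x) = \<phi>"
    using R(2) by (auto simp: indicator_def dist_norm fun_eq_iff)
  then show ?thesis
    using borel_integrable_compact[OF compact_cball continuous_on_subset[OF test_function_continuous[OF assms]],
        of 0 R] by simp
qed

lemma test_function_borel_measurable:
  fixes \<phi> :: "'a::euclidean_space \<Rightarrow> 'b::euclidean_space"
  assumes "\<phi> \<in> test_functions Q" shows "\<phi> \<in> borel_measurable borel"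
  by (intro borel_measurable_continuous_onI test_function_continuous[OF assms])

lemma test_function_square_integrable:
  fixes \<phi> :: "'a::euclidean_space \<Rightarrow> 'b::euclidean_space"
  assumes "\<phi> \<in> test_functions Q" shows "square_integrable \<phi>"
  unfolding square_integrable_def
proof
  obtain B where B: "B > 0" "\<And>x. norm (\<phi> x) \<le> B"
    using test_function_bounded[OF assms] by blast
  have [measurable]: "\<phi> \<in> borel_measurable borel"
    by (rule test_function_borel_measurable[OF assms])
  then show "\<phi> \<in> borel_measurable lborel" by simp
  show "integrable lborel (\<lambda>x. (norm (\<phi> x))\<^sup>2)"
    by (rule Bochner_Integration.integrable_bound[OF
          integrable_mult_right[OF integrable_norm[OF test_function_integrable[OF assms]], of B]])
       (use B in \<open>auto simp: power2_eq_square intro!: mult_right_mono\<close>)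
qed

text \<open>By translation invariance the difference quotients of \<open>f\<close> in direction \<open>v\<close> have integral zero, and they
  converge boundedly to the derivative.\<close>

lemma integral_test_function_deriv:
  fixes f :: "'a::euclidean_space \<Rightarrow> real"
  assumes f: "f \<in> test_functions Q"
  shows "(LINT x|lborel. frechet_derivative f (at x) v) = 0"
proof -
  let ?D = "\<lambda>x. frechet_derivative f (at x) v"
  define h where "h n = 1 / real (Suc n)" for n
  have h: "h n > 0" "h n \<le> 1" for n by (auto simp: h_def)
  have h_lim: "h \<longlonglongrightarrow> 0" unfolding h_def by (rule LIMSEQ_Suc[OF lim_1_over_n])
  obtain B where B: "B > 0" "\<And>x. norm (?D x) \<le> B"
    using test_function_bounded[OF test_function_deriv[OF f]] by blast
  obtain R where R: "R > 0" "\<And>x. f x \<noteq> 0 \<Longrightarrow> norm x \<le> R"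
    using test_function_bounded_support[OF f] by blast
  have [measurable]: "f \<in> borel_measurable borel" "?D \<in> borel_measurable borel"
    using f test_function_deriv[OF f] by (auto intro: test_function_borel_measurable)
  have line: "((\<lambda>s. f (x + s *\<^sub>R v)) has_real_derivative ?D (x + s *\<^sub>R v)) (at s)" for x s
  proof -
    have "((\<lambda>s. f (x + s *\<^sub>R v)) has_derivative
        (\<lambda>t. frechet_derivative f (at (x + s *\<^sub>R v)) (t *\<^sub>R v))) (at s)"
      by (rule has_derivative_compose[OF _ test_function_has_derivative[OF f]])
         (auto intro!: derivative_eq_intros)
    moreover have "frechet_derivative f (at (x + s *\<^sub>R v)) (t *\<^sub>R v) = ?D (x + s *\<^sub>R v) * t" for t
      using linear_cmul[OF has_derivative_linear[OF test_function_has_derivative[OF f]], of _ t v]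
      by (simp add: mult.commute)
    ultimately show ?thesis
      by (simp add: has_field_derivative_def)
  qed
  define g where "g n x = (f (x + h n *\<^sub>R v) - f x) / h n" for n x
  have "(\<lambda>n. LINT x|lborel. g n x) \<longlonglongrightarrow> (LINT x|lborel. ?D x)"
  proof (rule integral_dominated_convergence[where w = "\<lambda>x. B * indicator (cball 0 (R + norm v)) x"])
    show "integrable lborel (\<lambda>x. B * indicator (cball 0 (R + norm v)) x)"
      by (intro integrable_mult_right integrable_real_indicator) (auto simp: emeasure_bounded_finite[OF bounded_cball, unfolded infinity_ennreal_def])
    show "AE x in lborel. (\<lambda>n. g n x) \<longlonglongrightarrow> ?D x"
    proof (rule AE_I2)
      fix x
      have "((\<lambda>t. (f (x + (0 + t) *\<^sub>R v) - f (x + 0 *\<^sub>R v)) / t) \<longlongrightarrow> ?D x) (at 0)"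
        using line[of x 0] by (simp add: DERIV_def)
      moreover have "filterlim h (at 0) sequentially"
        using h_lim h(1) by (auto simp: filterlim_at less_imp_neq[THEN not_sym])
      ultimately show "(\<lambda>n. g n x) \<longlonglongrightarrow> ?D x"
        unfolding g_def by (auto dest: filterlim_compose)
    qed
    show "AE x in lborel. norm (g n x) \<le> B * indicator (cball 0 (R + norm v)) x" for n
    proof (rule AE_I2)
      fix x
      show "norm (g n x) \<le> B * indicator (cball 0 (R + norm v)) x"
      proof (cases "norm x \<le> R + norm v")
        case True
        obtain z where "f (x + h n *\<^sub>R v) - f (x + 0 *\<^sub>R v) = (h n - 0) * ?D (x + z *\<^sub>R v)"
          using MVT2[OF h(1)[of n], of "\<lambda>s. f (x + s *\<^sub>R v)" "\<lambda>s. ?D (x + s *\<^sub>R v)"] line by blast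
        then have "g n x = ?D (x + z *\<^sub>R v)"
          using h(1)[of n] by (simp add: g_def)
        then show ?thesis using B True by (simp add: dist_norm)
      next
        case False
        have "norm x \<le> norm (x + h n *\<^sub>R v) + norm (h n *\<^sub>R v)"
          using norm_triangle_ineq4[of "x + h n *\<^sub>R v" "h n *\<^sub>R v"] by simp
        moreover have "norm (h n *\<^sub>R v) \<le> norm v"
          using h[of n] by (simp add: mult_left_le_one_le)
        ultimately have "\<not> norm (x + h n *\<^sub>R v) \<le> R" "\<not> norm x \<le> R"
          using False norm_ge_zero[of v] by linarith+
        then have "f (x + h n *\<^sub>R v) = 0" "f x = 0"
          using R(2) by blast+
        then show ?thesis by (simp add: g_def B less_imp_le)
      qed
    qed
  qed (auto simp: g_def)
  moreover have "(LINT x|lborel. g n x) = 0" for n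
  proof -
    have int: "integrable lborel f" by (rule test_function_integrable[OF f])
    have eq: "(LINT x|lborel. f (h n *\<^sub>R v + x)) = (LINT x|lborel. f x)"
      using lborel_distr_plus[of "h n *\<^sub>R v"] integral_distr[of "(+) (h n *\<^sub>R v)" lborel borel f] by simp
    have "integrable (distr lborel borel ((+) (h n *\<^sub>R v))) f"
      using int by (simp add: lborel_distr_plus)
    then have "integrable lborel (\<lambda>x. f (h n *\<^sub>R v + x))"
      by (subst (asm) integrable_distr_eq) auto
    with int have "(LINT x|lborel. f (h n *\<^sub>R v + x) - f x) = 0"
      by (simp add: eq)
    then show ?thesis by (simp add: g_def add.commute)
  qed
  ultimately have "(\<lambda>n. 0) \<longlonglongrightarrow> (LINT x|lborel. ?D x)"
    by simp
  then show ?thesis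
    using LIMSEQ_unique[OF tendsto_const] by metis
qed

lemma frechet_derivative_mult_real:
  fixes f g :: "'a::real_normed_vector \<Rightarrow> real"
  assumes "(f has_derivative f') (at x)" "(g has_derivative g') (at x)"
  shows "frechet_derivative (\<lambda>x. f x * g x) (at x) v = f x * g' v + f' v * g x"
  using frechet_derivative_at[OF has_derivative_mult[OF assms]] by metis

lemma test_function_integration_by_parts:
  fixes f g :: "'a::euclidean_space \<Rightarrow> real"
  assumes f: "f \<in> test_functions Q" and g: "g \<in> test_functions Q'"
  shows "(LINT x|lborel. f x * frechet_derivative g (at x) v) =
    - (LINT x|lborel. frechet_derivative f (at x) v * g x)"
proof -
  have "(\<lambda>x. f x * g x) \<in> test_functions Q"
    by (rule test_function_mult[OF f test_function_smooth[OF g]])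
  then have "(LINT x|lborel. frechet_derivative (\<lambda>x. f x * g x) (at x) v) = 0"
    by (rule integral_test_function_deriv)
  moreover have "integrable lborel (\<lambda>x. f x * frechet_derivative g (at x) v)"
    by (rule test_function_integrable[OF test_function_mult[OF f test_function_smooth[OF test_function_deriv[OF g]]]])
  moreover have "integrable lborel (\<lambda>x. frechet_derivative f (at x) v * g x)"
    by (rule test_function_integrable[OF test_function_mult[OF test_function_deriv[OF f] test_function_smooth[OF g]]])
  ultimately show ?thesis
    by (simp add: frechet_derivative_mult_real[OF test_function_has_derivative[OF f] test_function_has_derivative[OF g]])
qed

section \<open>Smooth cut-off functions and the fundamental lemma of the calculus of variations\<close>

text \<open>The functions \<open>y \<mapsto> p(1/y) exp (-1/y)\<close>, extended by zero to \<open>y \<le> 0\<close>. The polynomial factor makes the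
  family closed under differentiation; \<open>p = 1\<close> is the standard flat function.\<close>

definition flat_exp :: "real poly \<Rightarrow> real \<Rightarrow> real" where
  "flat_exp p y = (if 0 < y then poly p (1 / y) * exp (- (1 / y)) else 0)"

lemma tendsto_poly_times_exp_minus:
  "((\<lambda>y. y ^ k * poly p y * exp (- y)) \<longlongrightarrow> (0::real)) at_top"
proof (induction p arbitrary: k)
  case (pCons a p)
  have "((\<lambda>y. a * (y ^ k / exp y) + y ^ Suc k * poly p y * exp (- y)) \<longlongrightarrow> a * 0 + 0) at_top"
    by (intro tendsto_add tendsto_mult tendsto_const tendsto_power_div_exp_0 pCons.IH)
  then show ?case
    by (simp add: algebra_simps exp_minus divide_inverse)
qed simp

text \<open>Away from zero this is calculus: as a function of \<open>x = 1/y\<close>, differentiation replaces \<open>p\<close> by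
  \<open>x\<^sup>2 (p - p')\<close>. At zero the exponential beats every power of \<open>1/y\<close>.\<close>

lemma flat_exp_has_derivative:
  "(flat_exp p has_real_derivative flat_exp (monom 1 2 * (p - pderiv p)) y) (at y)"
proof -
  consider "y > 0" | "y < 0" | "y = 0" by linarith
  then show ?thesis
  proof cases
    case 1
    have "((\<lambda>y. poly p (1 / y) * exp (- (1 / y))) has_real_derivative
        poly p (1 / y) * (exp (- (1 / y)) * (1 / y\<^sup>2)) + poly (pderiv p) (1 / y) * (- (1 / y\<^sup>2)) * exp (- (1 / y))) (at y)"
      using 1 by (auto intro!: derivative_eq_intros DERIV_chain2[OF poly_DERIV]
          simp: power2_eq_square field_simps)
    also have "poly p (1 / y) * (exp (- (1 / y)) * (1 / y\<^sup>2)) + poly (pderiv p) (1 / y) * (- (1 / y\<^sup>2)) * exp (- (1 / y))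
        = flat_exp (monom 1 2 * (p - pderiv p)) y"
      using 1 by (simp add: flat_exp_def poly_monom power2_eq_square field_simps)
    finally show ?thesis
    proof (rule has_field_derivative_transform_within_open)
      show "open {0::real<..}" "y \<in> {0<..}" using 1 by auto
    qed (simp add: flat_exp_def)
  next
    case 2
    have "((\<lambda>y. 0) has_real_derivative 0) (at y)" by simp
    then have "(flat_exp p has_real_derivative 0) (at y)"
    proof (rule has_field_derivative_transform_within_open)
      show "open {..<0::real}" "y \<in> {..<0}" using 2 by auto
    qed (simp add: flat_exp_def)
    then show ?thesis using 2 by (simp add: flat_exp_def)
  next
    case 3
    have "((\<lambda>t. flat_exp p t / t) \<longlongrightarrow> 0) (at_right 0)"
    proof -
      have "((\<lambda>t. (1 / t) ^ 1 * poly p (1 / t) * exp (- (1 / t))) \<longlongrightarrow> 0) (at_right 0)"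
        using filterlim_compose[OF tendsto_poly_times_exp_minus[of 1 p] filterlim_inverse_at_top_right]
        by (simp add: divide_inverse)
      then show ?thesis
        by (rule Lim_transform_eventually)
           (auto simp: flat_exp_def eventually_at_filter)
    qed
    moreover have "((\<lambda>t. flat_exp p t / t) \<longlongrightarrow> 0) (at_left 0)"
      by (rule Lim_transform_eventually[OF tendsto_const]) (auto simp: flat_exp_def eventually_at_filter)
    ultimately have "((\<lambda>t. flat_exp p t / t) \<longlongrightarrow> 0) (at 0)"
      by (simp add: filterlim_at_split)
    then show ?thesis
      using 3 by (simp add: DERIV_def flat_exp_def)
  qed
qed

lemma smooth_on_flat_exp_compose:
  assumes "smooth_on UNIV f"
  shows "smooth_on UNIV (\<lambda>x. flat_exp p (f x))"
  unfolding smooth_on_def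
proof
  fix k
  show "Ck_on k UNIV (\<lambda>x. flat_exp p (f x))"
    by (rule Ck_on_compose_class[where A = "range flat_exp"])
       (use flat_exp_has_derivative assms in \<open>auto simp: smooth_on_def\<close>)
qed

lemma smooth_on_one_minus_exp_compose:
  assumes "smooth_on UNIV f"
  shows "smooth_on UNIV (\<lambda>x. 1 - exp (- c * f x :: real))"
  unfolding smooth_on_def
proof
  fix k
  have "Ck_on k UNIV (\<lambda>x. (\<lambda>y. 1 - exp (- c * y)) (f x))"
  proof (rule Ck_on_compose_class[where A = "{\<lambda>y. a + b * exp (- c * y) | a b. True}"
        and h = "\<lambda>y. 1 - exp (- c * y)" and f = f])
    fix h assume "h \<in> {\<lambda>y. a + b * exp (- c * y) | a b. True}"
    then obtain a b where h: "h = (\<lambda>y. a + b * exp (- c * y))" by blast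
    show "\<exists>h'\<in>{\<lambda>y. a + b * exp (- c * y) | a b. True}. \<forall>y. (h has_real_derivative h' y) (at y)"
    proof (intro bexI[of _ "\<lambda>y. 0 + (b * - c) * exp (- c * y)"] allI)
      show "(h has_real_derivative 0 + (b * - c) * exp (- c * y)) (at y)" for y
        unfolding h by (auto intro!: derivative_eq_intros)
    qed blast
  next
    show "(\<lambda>y. 1 - exp (- c * y)) \<in> {\<lambda>y. a + b * exp (- c * y) | a b. True}"
      by (rule CollectI, rule exI[of _ 1], rule exI[of _ "-1"]) simp
  qed (use assms in \<open>auto simp: smooth_on_def\<close>)
  then show "Ck_on k UNIV (\<lambda>x. 1 - exp (- c * f x))" by simp
qed

text \<open>The product \<open>p\<close> of one-dimensional flat bumps is positive exactly on the open box. Passing to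
  \<open>1 - exp (- n p)\<close> keeps the support, involves no division, and converges to the indicator function.\<close>

lemma smooth_approximation_of_box:
  fixes a b :: "'a::euclidean_space"
  assumes "cbox a b \<subseteq> Q"
  obtains \<psi> :: "nat \<Rightarrow> 'a \<Rightarrow> real" where "\<And>n. \<psi> n \<in> test_functions Q"
    "\<And>n x. 0 \<le> \<psi> n x \<and> \<psi> n x \<le> 1" "\<And>x. (\<lambda>n. \<psi> n x) \<longlonglongrightarrow> indicator (box a b) x"
proof -
  define p where "p x = (\<Prod>i\<in>Basis. flat_exp 1 (x \<bullet> i - a \<bullet> i) * flat_exp 1 (b \<bullet> i - x \<bullet> i))" for x :: 'a
  define \<psi> where "\<psi> n x = 1 - exp (- real n * p x)" for n and x :: 'a
  have coord: "smooth_on UNIV (\<lambda>x::'a. x \<bullet> i + c)" "smooth_on UNIV (\<lambda>x::'a. c - x \<bullet> i)" for i c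
    unfolding smooth_on_def
    using Ck_on_add[OF Ck_on_linear[OF bounded_linear_inner_left] Ck_on_const]
      Ck_on_add[OF Ck_on_const Ck_on_linear[OF bounded_linear_minus[OF bounded_linear_inner_left]]]
    by auto
  have "smooth_on UNIV p"
    unfolding smooth_on_def p_def
    using smooth_on_flat_exp_compose[OF coord(1)[of i "- (a \<bullet> i)" for i]]
      smooth_on_flat_exp_compose[OF coord(2)]
    by (intro allI Ck_on_prod Ck_on_mult) (auto simp: smooth_on_def)
  then have smooth: "smooth_on UNIV (\<psi> n)" for n
    unfolding \<psi>_def by (rule smooth_on_one_minus_exp_compose)
  have p_pos: "p x > 0" if "x \<in> box a b" for x
    unfolding p_def using that by (intro prod_pos) (auto simp: flat_exp_def box_def)
  have p_zero: "p x = 0" if "x \<notin> box a b" for x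
    unfolding p_def using that by (force simp: flat_exp_def box_def intro!: prod_zero)
  have p_nonneg: "p x \<ge> 0" for x
    using p_pos[of x] p_zero[of x] by fastforce
  show thesis
  proof (rule that)
    fix n
    have "closure {x. \<psi> n x \<noteq> 0} \<subseteq> cbox a b"
    proof (rule closure_minimal)
      show "{x. \<psi> n x \<noteq> 0} \<subseteq> cbox a b"
        using box_subset_cbox[of a b] by (auto simp: \<psi>_def intro: ccontr[of "_ \<in> cbox a b"] dest: p_zero)
    qed (rule closed_cbox)
    moreover from this have "compact (closure {x. \<psi> n x \<noteq> 0})"
      using bounded_subset[OF bounded_cbox] by (auto simp: compact_eq_bounded_closed)
    ultimately show "\<psi> n \<in> test_functions Q"
      using smooth[of n] assms by (auto simp: test_functions_def)
    show "0 \<le> \<psi> n x \<and> \<psi> n x \<le> 1" for x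
      using p_nonneg[of x] by (simp add: \<psi>_def)
  next
    fix x
    show "(\<lambda>n. \<psi> n x) \<longlonglongrightarrow> indicator (box a b) x"
    proof (cases "x \<in> box a b")
      case True
      have "(\<lambda>n. exp (- p x) ^ n) \<longlonglongrightarrow> 0"
        using p_pos[OF True] by (intro LIMSEQ_power_zero) simp
      then have "(\<lambda>n. 1 - exp (- p x) ^ n) \<longlonglongrightarrow> 1 - 0"
        by (intro tendsto_diff tendsto_const)
      then show ?thesis
        using True by (simp add: \<psi>_def exp_of_nat_mult[symmetric])
    qed (simp add: \<psi>_def p_zero)
  qed
qed

text \<open>The boxes are stable under intersection and generate the Borel sets, so by Dynkin's argument the
  integral over every Borel set vanishes.\<close>

lemma AE_zero_if_box_integrals_zero:
  fixes f :: "'a::euclidean_space \<Rightarrow> real"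
  assumes f: "integrable lborel f"
    and zero: "\<And>a b. (LINT x:box a b|lborel. f x) = 0"
  shows "AE x in lborel. f x = 0"
proof (rule density_unique_real[OF f integrable_zero])
  have set_int: "set_integrable lborel A f" if "A \<in> sets borel" for A
    unfolding set_integrable_def using integrable_mult_indicator[OF _ f, of A] that by simp
  have total: "(LINT x|lborel. f x) = 0"
  proof -
    have "(\<lambda>n. LINT x:box (- (real n *\<^sub>R One)) (real n *\<^sub>R One)|lborel. f x) \<longlonglongrightarrow>
        (LINT x:(\<Union>n. box (- (real n *\<^sub>R One)) (real n *\<^sub>R One))|lborel. f x)"
    proof (rule set_integral_cont_up)
      show "incseq (\<lambda>n. box (- (real n *\<^sub>R One)) (real n *\<^sub>R One :: 'a))"
        unfolding incseq_def by (intro allI impI subset_box_imp) auto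
    qed (auto intro: set_int)
    then have "(LINT x:(\<Union>n. box (- (real n *\<^sub>R One)) (real n *\<^sub>R One))|lborel. f x) = 0"
      unfolding zero LIMSEQ_const_iff ..
    then show ?thesis
      by (simp add: UN_box_eq_UNIV set_lebesgue_integral_def)
  qed
  fix A :: "'a set" assume "A \<in> sets lborel"
  then have A: "A \<in> sigma_sets UNIV (range (\<lambda>(a, b). box a b))"
    by (simp add: borel_eq_box)
  have stable: "Int_stable (range (\<lambda>(a, b). box a b :: 'a set))"
    by (auto simp: Int_stable_def box_Int_box)
  have pow: "range (\<lambda>(a, b). box a b :: 'a set) \<subseteq> Pow UNIV"
    by simp
  from stable pow A have "(LINT x:A|lborel. f x) = 0"
  proof (induction rule: sigma_sets_induct_disjoint)
  next
    case (compl A)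
    then have "A \<in> sets borel" by (simp add: borel_eq_box)
    then show ?case
      using compl total set_int[of A] set_int[of "-A"] set_integral_Un[of A "- A" lborel f]
      by (auto simp: Compl_eq_Diff_UNIV set_lebesgue_integral_def)
  next
    case (union A)
    then have "\<And>i. A i \<in> sets borel" by (auto simp: borel_eq_box)
    then have "(LINT x:(\<Union>i. A i)|lborel. f x) = (\<Sum>i. LINT x:A i|lborel. f x)"
      using union(1) by (intro lebesgue_integral_countable_add set_int)
        (auto simp: disjoint_family_on_def)
    then show ?case by (simp add: union)
  qed (auto simp: zero set_lebesgue_integral_def[of _ "{}"])
  then show "(LINT x:A|lborel. f x) = (LINT x:A|lborel. 0)"
    by simp
qed

text \<open>Cut-off functions that approximate boxes show that \<open>g\<close> has integral zero over every box
  whose closure lies in \<open>Q\<close>. Countably many closed boxes cover \<open>Q\<close>, and their faces are null sets.\<close>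

lemma fundamental_lemma_of_variations:
  fixes g :: "'a::euclidean_space \<Rightarrow> real"
  assumes Q: "open Q" and g: "set_integrable lborel Q g"
    and zero: "\<And>\<psi>. \<psi> \<in> test_functions Q \<Longrightarrow> (LINT x:Q|lborel. g x * \<psi> x) = 0"
  shows "AE x in lborel. x \<in> Q \<longrightarrow> g x = 0"
proof -
  have [measurable]: "Q \<in> sets borel" using Q by simp
  have box_zero: "(LINT x:box a b|lborel. g x) = 0" if ab: "cbox a b \<subseteq> Q" for a b
  proof -
    obtain \<psi> :: "nat \<Rightarrow> 'a \<Rightarrow> real" where \<psi>: "\<And>n. \<psi> n \<in> test_functions Q"
      "\<And>n x. 0 \<le> \<psi> n x \<and> \<psi> n x \<le> 1" "\<And>x. (\<lambda>n. \<psi> n x) \<longlonglongrightarrow> indicator (box a b) x"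
      using smooth_approximation_of_box[OF ab] by blast
    have [measurable]: "\<psi> n \<in> borel_measurable borel" for n
      by (rule test_function_borel_measurable[OF \<psi>(1)])
    have gm: "(\<lambda>x. indicator Q x *\<^sub>R g x) \<in> borel_measurable lborel"
      using g by (auto simp: set_integrable_def)
    have "(\<lambda>n. LINT x|lborel. (indicator Q x *\<^sub>R g x) * \<psi> n x) \<longlonglongrightarrow>
        (LINT x|lborel. (indicator Q x *\<^sub>R g x) * indicator (box a b) x)"
    proof (rule integral_dominated_convergence[where w = "\<lambda>x. norm (indicator Q x *\<^sub>R g x)"])
      show "integrable lborel (\<lambda>x. norm (indicator Q x *\<^sub>R g x))"
        using g unfolding set_integrable_def by (rule integrable_norm)
      show "AE x in lborel. (\<lambda>n. (indicator Q x *\<^sub>R g x) * \<psi> n x) \<longlonglongrightarrow> (indicator Q x *\<^sub>R g x) * indicator (box a b) x"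
        by (intro AE_I2 tendsto_mult tendsto_const \<psi>(3))
      show "AE x in lborel. norm ((indicator Q x *\<^sub>R g x) * \<psi> n x) \<le> norm (indicator Q x *\<^sub>R g x)" for n
        using \<psi>(2) by (auto simp: abs_mult intro!: mult_right_le_one_le)
    qed (use gm in measurable)
    moreover have eq0: "(LINT x|lborel. (indicator Q x *\<^sub>R g x) * \<psi> n x) = 0" for n
      using zero[OF \<psi>(1)[of n]] by (simp add: set_lebesgue_integral_def mult.assoc)
    ultimately have "(LINT x|lborel. (indicator Q x *\<^sub>R g x) * indicator (box a b) x) = 0"
      unfolding eq0 LIMSEQ_const_iff by simp
    also have "(\<lambda>x. (indicator Q x *\<^sub>R g x) * indicator (box a b) x) = (\<lambda>x. indicator (box a b) x *\<^sub>R g x)"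
      using ab box_subset_cbox[of a b] by (auto simp: fun_eq_iff indicator_def)
    finally show ?thesis by (simp add: set_lebesgue_integral_def)
  qed
  have AE_box: "AE x in lborel. x \<in> box c d \<longrightarrow> g x = 0" if cd: "cbox c d \<subseteq> Q" for c d
  proof -
    let ?f = "\<lambda>x. indicator (box c d) x *\<^sub>R g x"
    have sub: "box c d \<subseteq> Q" using cd box_subset_cbox[of c d] by blast
    have "set_integrable lborel (box c d) g"
      by (rule set_integrable_subset[OF g _ sub]) simp
    then have "integrable lborel ?f" by (simp add: set_integrable_def)
    moreover have "(LINT x:box a b|lborel. ?f x) = 0" for a b
    proof -
      obtain a' b' where ab: "box a b \<inter> box c d = box a' b'"
        using box_Int_box by blast
      have "(LINT x:box a b|lborel. ?f x) = (LINT x:box a' b'|lborel. g x)"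
        by (simp add: set_lebesgue_integral_def indicator_inter_arith mult.assoc flip: ab)
      also have "\<dots> = 0"
      proof (cases "box a' b' = {}")
        case False
        have "cbox a' b' = closure (box a' b')" using False by (simp add: closure_box)
        also have "\<dots> \<subseteq> cbox c d"
          using ab box_subset_cbox[of c d] by (intro closure_minimal) auto
        finally show ?thesis using cd by (intro box_zero) auto
      qed (simp add: set_lebesgue_integral_def)
      finally show ?thesis .
    qed
    ultimately have "AE x in lborel. ?f x = 0"
      by (rule AE_zero_if_box_integrals_zero)
    then show ?thesis by eventually_elim auto
  qed
  have AE_cbox: "AE x in lborel. x \<in> cbox c d \<longrightarrow> g x = 0" if cd: "cbox c d \<subseteq> Q" for c d
  proof -
    have "cbox c d - box c d \<in> null_sets lborel"
      using negligible_frontier_interval[of c d]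
      by (simp add: negligible_iff_null_sets null_sets_completion_iff)
    then have "AE x in lborel. x \<notin> cbox c d - box c d"
      by (rule AE_not_in)
    then show ?thesis
      using AE_box[OF cd] by eventually_elim auto
  qed
  obtain D where D: "countable D" "D \<subseteq> Pow Q" "\<And>X. X \<in> D \<Longrightarrow> \<exists>a b. X = cbox a b" "\<Union>D = Q"
    using open_countable_Union_open_cbox[OF Q] by blast
  have "AE x in lborel. \<forall>X\<in>D. x \<in> X \<longrightarrow> g x = 0"
  proof (subst AE_ball_countable[OF D(1)], rule ballI)
    fix X assume "X \<in> D"
    then obtain c d where "X = cbox c d" "X \<subseteq> Q" using D by blast
    then show "AE x in lborel. x \<in> X \<longrightarrow> g x = 0" using AE_cbox[of c d] by simp
  qed
  then show ?thesis
    by eventually_elim (use D(4) in blast)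
qed

section \<open>Weak gradients and divergence-free fields\<close>

lemma integrable_dominated:
  fixes f g :: "'a \<Rightarrow> real"
  assumes "integrable M g" "f \<in> borel_measurable M" "\<And>x. \<bar>f x\<bar> \<le> g x"
  shows "integrable M f"
  by (rule Bochner_Integration.integrable_bound[OF assms(1,2)])
     (rule AE_I2, use assms(3) order_trans[OF _ abs_ge_self] in auto)

lemma square_integrable_compose_linear:
  fixes L :: "'b::euclidean_space \<Rightarrow> 'c::euclidean_space"
  assumes f: "square_integrable f" and L: "bounded_linear L"
  shows "square_integrable (\<lambda>x. L (f x))"
  unfolding square_integrable_def
proof
  have [measurable]: "L \<in> borel_measurable borel" "f \<in> borel_measurable borel"
    using f L by (auto simp: square_integrable_def intro!: borel_measurable_continuous_onI linear_continuous_on)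
  then show "(\<lambda>x. L (f x)) \<in> borel_measurable lborel"
    by measurable
  obtain K where K: "\<And>y. norm (L y) \<le> norm y * K"
    using bounded_linear.bounded[OF L] by blast
  have le: "(norm (L y))\<^sup>2 \<le> K\<^sup>2 * (norm y)\<^sup>2" for y
    using power_mono[OF K[of y] norm_ge_zero, of 2] by (simp add: power_mult_distrib mult.commute)
  show "integrable lborel (\<lambda>x. (norm (L (f x)))\<^sup>2)"
  proof (rule Bochner_Integration.integrable_bound[where f = "\<lambda>x. K\<^sup>2 * (norm (f x))\<^sup>2"])
    show "integrable lborel (\<lambda>x. K\<^sup>2 * (norm (f x))\<^sup>2)"
      using f by (intro integrable_mult_right) (simp add: square_integrable_def)
    show "AE x in lborel. norm ((norm (L (f x)))\<^sup>2) \<le> norm (K\<^sup>2 * (norm (f x))\<^sup>2)"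
      using le by (intro AE_I2) simp
  qed measurable
qed

locale bounded_open_set =
  fixes Q :: "(real^'d::finite) set"
  assumes open_Q: "open Q" and bounded_Q: "bounded Q"
begin

lemma Q_borel [measurable]: "Q \<in> sets borel"
  using open_Q by simp

lemma L2_on_rep: "u \<in> L2_on Q \<Longrightarrow> AE x in lborel. x \<notin> Q \<longrightarrow> rep_L2 u x = 0"
  by (simp add: L2_on_def)

lemma L2_on_add: "u \<in> L2_on Q \<Longrightarrow> v \<in> L2_on Q \<Longrightarrow> u + v \<in> L2_on Q"
  unfolding L2_on_def using rep_L2_add[of u v] by (auto elim!: eventually_elim2)

lemma L2_on_scaleR: "u \<in> L2_on Q \<Longrightarrow> c *\<^sub>R u \<in> L2_on Q"
  unfolding L2_on_def using rep_L2_scaleR[of c u] by (auto elim!: eventually_elim2)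

lemma L2_on_diff: "u \<in> L2_on Q \<Longrightarrow> v \<in> L2_on Q \<Longrightarrow> u - v \<in> L2_on Q"
  using L2_on_add[of u "(-1) *\<^sub>R v"] L2_on_scaleR[of v "-1"] by simp

lemma square_integrable_set_integrable:
  fixes g :: "real^'d \<Rightarrow> real"
  assumes "square_integrable g" shows "set_integrable lborel Q g"
proof -
  have [measurable]: "g \<in> borel_measurable borel"
    using assms by (simp add: square_integrable_def)
  have fin: "emeasure lborel Q < \<infinity>"
    by (rule emeasure_bounded_finite[OF bounded_Q])
  have int: "integrable lborel (\<lambda>x. (g x)\<^sup>2 + indicator Q x)"
    using assms fin by (auto simp: square_integrable_def)
  have "\<bar>g x\<bar> \<le> (g x)\<^sup>2 + 1" for x
    using sum_squares_bound[of "\<bar>g x\<bar>" 1] by simp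
  then have le: "\<bar>indicator Q x *\<^sub>R g x\<bar> \<le> (g x)\<^sup>2 + indicator Q x" for x
    by (simp add: indicator_def)
  show ?thesis
    unfolding set_integrable_def
  proof (rule integrable_dominated[OF int _ le])
    show "(\<lambda>x. indicator Q x *\<^sub>R g x) \<in> borel_measurable lborel"
      by measurable
  qed
qed

lemma square_integrable_test_scaleR:
  assumes "\<psi> \<in> test_functions Q"
  shows "square_integrable (\<lambda>x. \<psi> x *\<^sub>R (v::'b::euclidean_space))"
  by (rule square_integrable_compose_linear[OF test_function_square_integrable[OF assms] bounded_linear_scaleR_left])

lemma set_integral_test_eq_inner:
  assumes \<psi>: "\<psi> \<in> test_functions Q"
  shows "(LINT x:Q|lborel. rep_L2 u x $ i * \<psi> x) = u \<bullet> abs_L2 (\<lambda>x. \<psi> x *\<^sub>R axis i 1)"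
    and "(LINT x:Q|lborel. rep_L2 G x $ i $ j * \<psi> x) = G \<bullet> abs_L2 (\<lambda>x. \<psi> x *\<^sub>R axis i (axis j 1))"
proof -
  have eq: "indicator Q x *\<^sub>R (c * \<psi> x) = \<psi> x * c" for x and c :: real
    using test_function_zero_outside[OF \<psi>, of x] by (cases "x \<in> Q") auto
  show "(LINT x:Q|lborel. rep_L2 u x $ i * \<psi> x) = u \<bullet> abs_L2 (\<lambda>x. \<psi> x *\<^sub>R axis i 1)"
    and "(LINT x:Q|lborel. rep_L2 G x $ i $ j * \<psi> x) = G \<bullet> abs_L2 (\<lambda>x. \<psi> x *\<^sub>R axis i (axis j 1))"
    unfolding inner_abs_L2_right[OF square_integrable_test_scaleR[OF \<psi>]] set_lebesgue_integral_def
    by (simp_all only: eq inner_axis inner_scaleR_right inner_real_def mult_1_right)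
qed

text \<open>The defining identities written with inner products of \<open>L\<^sup>2\<close>, so that they are
  visibly linear and continuous in \<open>u\<close> and \<open>G\<close>. The restriction to \<open>Q\<close> is absorbed by the test function.\<close>

lemma is_weak_grad_iff:
  "is_weak_grad Q u G \<longleftrightarrow> G \<in> L2_on Q \<and> (\<forall>\<psi>\<in>test_functions Q. \<forall>i j.
     u \<bullet> abs_L2 (\<lambda>x. frechet_derivative \<psi> (at x) (axis j 1) *\<^sub>R axis i 1) =
     - (G \<bullet> abs_L2 (\<lambda>x. \<psi> x *\<^sub>R axis i (axis j 1))))"
  unfolding is_weak_grad_def
  by (simp add: set_integral_test_eq_inner set_integral_test_eq_inner(1)[OF test_function_deriv] cong: ball_cong)

lemma is_weak_grad_add: "is_weak_grad Q u G \<Longrightarrow> is_weak_grad Q v H \<Longrightarrow> is_weak_grad Q (u + v) (G + H)"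
  unfolding is_weak_grad_iff by (auto simp: inner_add_left intro: L2_on_add)

lemma is_weak_grad_scaleR: "is_weak_grad Q u G \<Longrightarrow> is_weak_grad Q (c *\<^sub>R u) (c *\<^sub>R G)"
  unfolding is_weak_grad_iff by (auto intro: L2_on_scaleR)

text \<open>The functions \<open>weak_grad\<close>, \<open>H1_norm\<close> and \<open>V_norm\<close> rest on a definite description, to which this lemma
  gives its meaning.\<close>

lemma is_weak_grad_unique:
  assumes "is_weak_grad Q u G" "is_weak_grad Q u H" shows "G = H"
proof (rule L2_eqI)
  define K where "K = G - H"
  have K: "is_weak_grad Q 0 K"
    using is_weak_grad_add[OF assms(1) is_weak_grad_scaleR[OF assms(2), of "-1"]] by (simp add: K_def)
  have "AE x in lborel. x \<in> Q \<longrightarrow> rep_L2 K x $ i $ j = 0" for i j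
  proof (rule fundamental_lemma_of_variations[OF open_Q])
    have "bounded_linear (\<lambda>y::real^'d^'d. y $ i $ j)"
      by (intro bounded_linear_compose[OF bounded_linear_vec_nth bounded_linear_vec_nth])
    then show "set_integrable lborel Q (\<lambda>x. rep_L2 K x $ i $ j)"
      by (intro square_integrable_set_integrable square_integrable_compose_linear[OF square_integrable_rep])
    fix \<psi> :: "real^'d \<Rightarrow> real" assume \<psi>: "\<psi> \<in> test_functions Q"
    then show "(LINT x:Q|lborel. rep_L2 K x $ i $ j * \<psi> x) = 0"
      using K by (simp add: set_integral_test_eq_inner(2) is_weak_grad_iff)
  qed
  then have "AE x in lborel. \<forall>i j. x \<in> Q \<longrightarrow> rep_L2 K x $ i $ j = 0"
    by (intro AE_all_countable[THEN iffD2] allI)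
  moreover have "AE x in lborel. x \<notin> Q \<longrightarrow> rep_L2 K x = 0"
    using K by (intro L2_on_rep) (simp add: is_weak_grad_def)
  ultimately have "AE x in lborel. rep_L2 K x = 0"
    by eventually_elim (auto simp: vec_eq_iff)
  then show "AE x in lborel. rep_L2 G x = rep_L2 H x"
    using rep_L2_diff[of G H] unfolding K_def[symmetric] by eventually_elim simp
qed

lemma weak_grad_eqI: "is_weak_grad Q u G \<Longrightarrow> weak_grad Q u = G"
  unfolding weak_grad_def using is_weak_grad_unique by blast

lemma is_weak_grad_weak_grad: "u \<in> H1 Q \<Longrightarrow> is_weak_grad Q u (weak_grad Q u)"
  using weak_grad_eqI by (auto simp: H1_def)

lemma weak_grad_L2_on: "u \<in> H1 Q \<Longrightarrow> weak_grad Q u \<in> L2_on Q"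
  using is_weak_grad_weak_grad by (auto simp: is_weak_grad_def)

lemma H1_L2_on: "u \<in> H1 Q \<Longrightarrow> u \<in> L2_on Q"
  by (simp add: H1_def)

lemma H1_add: "u \<in> H1 Q \<Longrightarrow> v \<in> H1 Q \<Longrightarrow> u + v \<in> H1 Q"
  unfolding H1_def using is_weak_grad_add L2_on_add by blast

lemma H1_scaleR: "u \<in> H1 Q \<Longrightarrow> c *\<^sub>R u \<in> H1 Q"
  unfolding H1_def using is_weak_grad_scaleR L2_on_scaleR by blast

lemma H1_diff: "u \<in> H1 Q \<Longrightarrow> v \<in> H1 Q \<Longrightarrow> u - v \<in> H1 Q"
  using H1_add[of u "(-1) *\<^sub>R v"] H1_scaleR[of v "-1"] by simp

lemma weak_grad_add: "u \<in> H1 Q \<Longrightarrow> v \<in> H1 Q \<Longrightarrow> weak_grad Q (u + v) = weak_grad Q u + weak_grad Q v"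
  by (intro weak_grad_eqI is_weak_grad_add is_weak_grad_weak_grad)

lemma weak_grad_scaleR: "u \<in> H1 Q \<Longrightarrow> weak_grad Q (c *\<^sub>R u) = c *\<^sub>R weak_grad Q u"
  by (intro weak_grad_eqI is_weak_grad_scaleR is_weak_grad_weak_grad)

lemma weak_grad_diff: "u \<in> H1 Q \<Longrightarrow> v \<in> H1 Q \<Longrightarrow> weak_grad Q (u - v) = weak_grad Q u - weak_grad Q v"
  using weak_grad_add[of u "(-1) *\<^sub>R v"] weak_grad_scaleR[of v "-1"] H1_scaleR[of v "-1"] by simp

lemma jacobian_nth:
  fixes f :: "real^'d \<Rightarrow> real^'d"
  shows "jacobian f (at x) $ i $ j = frechet_derivative f (at x) (axis j 1) $ i"
  by (simp add: jacobian_def matrix_def)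

lemma frechet_derivative_component:
  fixes f :: "real^'d \<Rightarrow> real^'d"
  assumes "f \<in> test_functions Q"
  shows "frechet_derivative (\<lambda>x. f x $ i) (at x) = (\<lambda>v. frechet_derivative f (at x) v $ i)"
  using frechet_derivative_at[OF bounded_linear.has_derivative[OF bounded_linear_vec_nth
        test_function_has_derivative[OF assms]]] by metis

lemma test_function_component:
  fixes f :: "real^'d \<Rightarrow> real^'d"
  shows "f \<in> test_functions Q \<Longrightarrow> (\<lambda>x. f x $ i) \<in> test_functions Q"
  by (rule test_function_compose_linear[OF _ bounded_linear_vec_nth])

lemma test_function_jacobian_nth:
  fixes f :: "real^'d \<Rightarrow> real^'d"
  assumes "f \<in> test_functions Q"
  shows "(\<lambda>x. jacobian f (at x) $ i $ j) \<in> test_functions Q"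
  unfolding jacobian_nth
  by (rule test_function_component[OF test_function_deriv[OF assms]])

lemma test_function_jacobian:
  fixes f :: "real^'d \<Rightarrow> real^'d"
  assumes f: "f \<in> test_functions Q"
  shows "(\<lambda>x. jacobian f (at x)) \<in> test_functions Q"
proof (rule test_functions_support_subset[OF f])
  define T :: "'d \<Rightarrow> real^'d \<Rightarrow> real^'d^'d" where "T j y = (\<chi> i k. if k = j then y $ i else 0)" for j y
  have T: "bounded_linear (T j)" for j
    unfolding linear_conv_bounded_linear[symmetric]
    by (rule linearI) (simp_all add: T_def vec_eq_iff)
  have "Ck_on k UNIV (\<lambda>x. \<Sum>j\<in>UNIV. T j (frechet_derivative f (at x) (axis j 1)))" for k
    by (rule Ck_on_sum, rule Ck_on_compose_linear[OF T], rule test_function_Ck[OF test_function_deriv[OF f]])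
  moreover have "jacobian f (at x) = (\<Sum>j\<in>UNIV. T j (frechet_derivative f (at x) (axis j 1)))" for x
    unfolding vec_eq_iff jacobian_nth sum_component T_def by simp
  ultimately show "smooth_on UNIV (\<lambda>x. jacobian f (at x))"
    by (simp add: smooth_on_def)
  show "{x. jacobian f (at x) \<noteq> 0} \<subseteq> closure {x. f x \<noteq> 0}"
  proof (rule subsetI, rule ccontr)
    fix x assume "x \<in> {x. jacobian f (at x) \<noteq> 0}" "x \<notin> closure {x. f x \<noteq> 0}"
    then show False
      using test_function_deriv_zero_off_support[of x f] by (simp add: vec_eq_iff jacobian_nth)
  qed
qed

lemma inner_abs_L2_scaleR_axis:
  fixes f :: "real^'d \<Rightarrow> real^'d"
  assumes "f \<in> test_functions Q" "\<psi> \<in> test_functions Q"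
  shows "abs_L2 f \<bullet> abs_L2 (\<lambda>x. \<psi> x *\<^sub>R axis i 1) = (LINT x|lborel. f x $ i * \<psi> x)"
  using assms by (subst inner_abs_L2)
    (auto intro: test_function_square_integrable square_integrable_test_scaleR simp: inner_axis mult.commute)

lemma abs_test_L2_on: "f \<in> test_functions Q \<Longrightarrow> abs_L2 f \<in> L2_on Q"
  for f :: "real^'d \<Rightarrow> 'b::euclidean_space"
  unfolding L2_on_def using rep_abs_L2[OF test_function_square_integrable, of f Q]
  by (auto elim!: eventually_mono simp: test_function_zero_outside)

lemma is_weak_grad_test:
  fixes f :: "real^'d \<Rightarrow> real^'d"
  assumes f: "f \<in> test_functions Q"
  shows "is_weak_grad Q (abs_L2 f) (abs_L2 (\<lambda>x. jacobian f (at x)))"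
  unfolding is_weak_grad_iff
proof (intro conjI ballI allI)
  note J = test_function_jacobian[OF f]
  show "abs_L2 (\<lambda>x. jacobian f (at x)) \<in> L2_on Q"
    by (rule abs_test_L2_on[OF J])
  fix \<psi> :: "real^'d \<Rightarrow> real" and i j assume \<psi>: "\<psi> \<in> test_functions Q"
  have "abs_L2 (\<lambda>x. jacobian f (at x)) \<bullet> abs_L2 (\<lambda>x. \<psi> x *\<^sub>R axis i (axis j 1))
      = (LINT x|lborel. jacobian f (at x) $ i $ j * \<psi> x)"
    by (subst inner_abs_L2[OF test_function_square_integrable[OF J] square_integrable_test_scaleR[OF \<psi>]])
       (simp add: inner_axis mult.commute)
  then show "abs_L2 f \<bullet> abs_L2 (\<lambda>x. frechet_derivative \<psi> (at x) (axis j 1) *\<^sub>R axis i 1) =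
      - (abs_L2 (\<lambda>x. jacobian f (at x)) \<bullet> abs_L2 (\<lambda>x. \<psi> x *\<^sub>R axis i (axis j 1)))"
    using test_function_integration_by_parts[OF test_function_component[OF f] \<psi>, of i "axis j 1"]
    by (simp add: inner_abs_L2_scaleR_axis[OF f test_function_deriv[OF \<psi>]]
        frechet_derivative_component[OF f] jacobian_nth)
qed

lemma weak_grad_test:
  fixes f :: "real^'d \<Rightarrow> real^'d"
  assumes "f \<in> test_functions Q"
  shows "weak_grad Q (abs_L2 f) = abs_L2 (\<lambda>x. jacobian f (at x))" "abs_L2 f \<in> H1 Q"
  using is_weak_grad_test[OF assms] abs_test_L2_on[OF assms] weak_grad_eqI by (auto simp: H1_def)

abbreviation "S \<equiv> solenoidal_test_fields Q"

lemma S_cases: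
  assumes "\<phi> \<in> S"
  obtains f where "\<phi> = abs_L2 f" "f \<in> test_functions Q" "\<And>x. trace (jacobian f (at x)) = 0"
  using assms by (auto simp: solenoidal_test_fields_def)

lemma S_H1: "\<phi> \<in> S \<Longrightarrow> \<phi> \<in> H1 Q"
  using weak_grad_test(2) S_cases by metis

lemma S_add:
  assumes "\<phi> \<in> S" "\<psi> \<in> S" shows "\<phi> + \<psi> \<in> S"
proof -
  obtain f where f: "\<phi> = abs_L2 f" "f \<in> test_functions Q" "\<And>x. trace (jacobian f (at x)) = 0"
    using S_cases[OF assms(1)] by blast
  obtain g where g: "\<psi> = abs_L2 g" "g \<in> test_functions Q" "\<And>x. trace (jacobian g (at x)) = 0"
    using S_cases[OF assms(2)] by blast
  have "frechet_derivative (\<lambda>x. f x + g x) (at x) = (\<lambda>v. frechet_derivative f (at x) v + frechet_derivative g (at x) v)" for x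
    by (rule frechet_derivative_at[symmetric]) (intro has_derivative_add test_function_has_derivative[OF f(2)] test_function_has_derivative[OF g(2)])
  then have "jacobian (\<lambda>x. f x + g x) (at x) = jacobian f (at x) + jacobian g (at x)" for x
    by (simp add: jacobian_def matrix_def vec_eq_iff)
  moreover have "\<phi> + \<psi> = abs_L2 (\<lambda>x. f x + g x)"
    unfolding f g by (rule plus_L2.abs_eq) (use f g test_function_square_integrable in \<open>auto simp: L2_rel_def\<close>)
  ultimately show ?thesis
    using f g test_function_add[OF f(2) g(2)] unfolding solenoidal_test_fields_def
    by (intro image_eqI[where x = "\<lambda>x. f x + g x"]) (auto simp: trace_add)
qed

lemma S_scaleR:
  assumes "\<phi> \<in> S" shows "c *\<^sub>R \<phi> \<in> S"
proof -
  obtain f where f: "\<phi> = abs_L2 f" "f \<in> test_functions Q" "\<And>x. trace (jacobian f (at x)) = 0"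
    using S_cases[OF assms(1)] by blast
  have "frechet_derivative (\<lambda>x. c *\<^sub>R f x) (at x) = (\<lambda>v. c *\<^sub>R frechet_derivative f (at x) v)" for x
    by (rule frechet_derivative_at[symmetric]) (intro has_derivative_scaleR_right test_function_has_derivative[OF f(2)])
  then have "jacobian (\<lambda>x. c *\<^sub>R f x) (at x) = c *\<^sub>R jacobian f (at x)" for x
    by (simp add: jacobian_def matrix_def vec_eq_iff)
  then have "trace (jacobian (\<lambda>x. c *\<^sub>R f x) (at x)) = 0" for x
    using f(3)[of x] by (simp add: trace_def sum_distrib_left[symmetric])
  moreover have "c *\<^sub>R \<phi> = abs_L2 (\<lambda>x. c *\<^sub>R f x)"
    unfolding f by (rule scaleR_L2.abs_eq) (use f test_function_square_integrable in \<open>auto simp: L2_rel_def\<close>)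
  ultimately show ?thesis
    using test_function_compose_linear[OF f(2) bounded_linear_scaleR_right[of c]] unfolding solenoidal_test_fields_def
    by (intro image_eqI[where x = "\<lambda>x. c *\<^sub>R f x"]) auto
qed

lemma S_zero: "0 \<in> S"
proof -
  have "jacobian (\<lambda>x. 0) (at x) = (0::real^'d^'d)" for x :: "real^'d"
    by (simp add: vec_eq_iff jacobian_nth)
  then show ?thesis
    unfolding solenoidal_test_fields_def
    by (intro image_eqI[where x = "\<lambda>x. 0"]) (auto simp: zero_L2.abs_eq test_function_zero trace_def)
qed

text \<open>The second derivatives of a test field exist and are test functions, so the gradient of \<open>u\<close>
  can be integrated by parts once: \<open>l\<close> is minus the Laplacian of \<open>\<phi>\<close>. As a consequence the left-hand side is
  continuous in \<open>u\<close> with respect to the \<open>L\<^sup>2\<close> norm alone.\<close>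

lemma weak_grad_inner_S:
  assumes "\<phi> \<in> S"
  shows "\<exists>l. \<forall>u\<in>H1 Q. weak_grad Q u \<bullet> weak_grad Q \<phi> = u \<bullet> l"
proof -
  obtain f where f: "\<phi> = abs_L2 f" "f \<in> test_functions Q"
    using S_cases[OF assms] by metis
  note J = test_function_jacobian[OF f(2)] and Jij = test_function_jacobian_nth[OF f(2)]
  define \<psi> where "\<psi> i j x = jacobian f (at x) $ i $ j" for i j x
  have \<psi>: "\<psi> i j \<in> test_functions Q" for i j
    unfolding \<psi>_def by (rule Jij)
  define l where "l = - (\<Sum>i\<in>UNIV. \<Sum>j\<in>UNIV. abs_L2 (\<lambda>x. frechet_derivative (\<psi> i j) (at x) (axis j 1) *\<^sub>R axis i (1::real)))"
  have "weak_grad Q u \<bullet> weak_grad Q \<phi> = u \<bullet> l" if "u \<in> H1 Q" for u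
  proof -
    define G where "G = weak_grad Q u"
    have G: "is_weak_grad Q u G"
      unfolding G_def by (rule is_weak_grad_weak_grad[OF that])
    have tm: "G \<bullet> abs_L2 (\<lambda>x. \<psi> i j x *\<^sub>R axis i (axis j 1)) = (LINT x|lborel. rep_L2 G x $ i $ j * \<psi> i j x)"
      "integrable lborel (\<lambda>x. rep_L2 G x $ i $ j * \<psi> i j x)" for i j
      using integrable_inner_square_integrable[OF square_integrable_rep[of G] square_integrable_test_scaleR[OF \<psi>, of i j "axis i (axis j 1)"]]
      by (simp_all add: inner_abs_L2_right[OF square_integrable_test_scaleR[OF \<psi>]] inner_axis mult.commute)
    have "G \<bullet> weak_grad Q \<phi> = (LINT x|lborel. (\<Sum>i\<in>UNIV. \<Sum>j\<in>UNIV. rep_L2 G x $ i $ j * \<psi> i j x))"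
      unfolding f weak_grad_test[OF f(2)] inner_abs_L2_right[OF test_function_square_integrable[OF J]]
      by (simp add: inner_vec_def \<psi>_def)
    also have "\<dots> = (\<Sum>i\<in>UNIV. \<Sum>j\<in>UNIV. G \<bullet> abs_L2 (\<lambda>x. \<psi> i j x *\<^sub>R axis i (axis j 1)))"
      using tm by simp
    also have "\<dots> = u \<bullet> l"
      using G \<psi> unfolding is_weak_grad_iff l_def
      by (simp add: inner_sum_right sum_negf inner_minus_right)
    finally show ?thesis by (simp add: G_def)
  qed
  then show ?thesis by blast
qed

lemma V_H1: "u \<in> V_space Q \<Longrightarrow> u \<in> H1 Q"
  by (simp add: V_space_def)

lemma S_V: "\<phi> \<in> S \<Longrightarrow> \<phi> \<in> V_space Q"
  using weak_grad_scaleR[of 0 0] H1_scaleR[OF S_H1, of \<phi> 0]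
  by (auto simp: V_space_def S_H1 H1_norm_def intro!: bexI[of _ \<phi>])

lemma H1_norm_le: "H1_norm Q u \<le> norm u + norm (weak_grad Q u)"
  unfolding H1_norm_def by (rule sqrt_sum_squares_le_sum) auto

lemma norm_le_H1_norm: "norm u \<le> H1_norm Q u" "norm (weak_grad Q u) \<le> H1_norm Q u"
  unfolding H1_norm_def by (auto intro!: real_le_rsqrt)

lemma V_approx:
  assumes "u \<in> V_space Q"
  obtains \<phi> where "\<And>n. \<phi> n \<in> S" "\<phi> \<longlonglongrightarrow> u" "(\<lambda>n. weak_grad Q (\<phi> n)) \<longlonglongrightarrow> weak_grad Q u"
proof -
  have "\<exists>\<phi>\<in>S. H1_norm Q (u - \<phi>) < 1 / real (Suc n)" for n
    using assms by (simp add: V_space_def)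
  then obtain \<phi> where \<phi>: "\<And>n. \<phi> n \<in> S" "\<And>n. H1_norm Q (u - \<phi> n) < 1 / real (Suc n)"
    by metis
  have lim: "(\<lambda>n. 1 / real (Suc n)) \<longlonglongrightarrow> 0" by (rule LIMSEQ_Suc[OF lim_1_over_n])
  show thesis
  proof (rule that[OF \<phi>(1)])
    have "norm (u - \<phi> n) \<le> 1 / real (Suc n)" for n
      using norm_le_H1_norm(1)[of "u - \<phi> n"] \<phi>(2)[of n] by linarith
    then have "(\<lambda>n. u - \<phi> n) \<longlonglongrightarrow> 0"
      by (intro Lim_null_comparison[OF always_eventually lim]) auto
    then show "\<phi> \<longlonglongrightarrow> u"
      using tendsto_diff[OF tendsto_const, of _ 0 sequentially u] by fastforce
    have "norm (weak_grad Q u - weak_grad Q (\<phi> n)) \<le> 1 / real (Suc n)" for n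
      using norm_le_H1_norm(2)[of "u - \<phi> n"] \<phi>(2)[of n]
      by (simp add: weak_grad_diff[OF V_H1[OF assms] S_H1[OF \<phi>(1)]])
    then have "(\<lambda>n. weak_grad Q u - weak_grad Q (\<phi> n)) \<longlonglongrightarrow> 0"
      by (intro Lim_null_comparison[OF always_eventually lim]) auto
    then show "(\<lambda>n. weak_grad Q (\<phi> n)) \<longlonglongrightarrow> weak_grad Q u"
      using tendsto_diff[OF tendsto_const, of _ 0 sequentially "weak_grad Q u"] by fastforce
  qed
qed

lemma V_spaceI:
  assumes u: "u \<in> H1 Q" and \<phi>: "\<And>n. \<phi> n \<in> S" "\<phi> \<longlonglongrightarrow> u" "(\<lambda>n. weak_grad Q (\<phi> n)) \<longlonglongrightarrow> weak_grad Q u"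
  shows "u \<in> V_space Q"
  unfolding V_space_def
proof (intro CollectI conjI allI impI u)
  fix e :: real assume "e > 0"
  have "(\<lambda>n. norm (u - \<phi> n) + norm (weak_grad Q u - weak_grad Q (\<phi> n))) \<longlonglongrightarrow> norm (u - u) + norm (weak_grad Q u - weak_grad Q u)"
    by (intro tendsto_intros \<phi>)
  then have "eventually (\<lambda>n. norm (u - \<phi> n) + norm (weak_grad Q u - weak_grad Q (\<phi> n)) < e) sequentially"
    using \<open>e > 0\<close> by (auto intro: order_tendstoD(2))
  then obtain n where "norm (u - \<phi> n) + norm (weak_grad Q u - weak_grad Q (\<phi> n)) < e"
    by (auto simp: eventually_sequentially)
  then show "\<exists>\<phi>\<in>S. H1_norm Q (u - \<phi>) < e"
    using H1_norm_le[of "u - \<phi> n"] \<phi>(1)[of n] weak_grad_diff[OF u S_H1[OF \<phi>(1)[of n]]]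
    by (intro bexI[of _ "\<phi> n"]) auto
qed

lemma V_add:
  assumes "u \<in> V_space Q" "v \<in> V_space Q" shows "u + v \<in> V_space Q"
proof -
  obtain \<phi> where \<phi>: "\<And>n. \<phi> n \<in> S" "\<phi> \<longlonglongrightarrow> u" "(\<lambda>n. weak_grad Q (\<phi> n)) \<longlonglongrightarrow> weak_grad Q u"
    using V_approx[OF assms(1)] by blast
  obtain \<psi> where \<psi>: "\<And>n. \<psi> n \<in> S" "\<psi> \<longlonglongrightarrow> v" "(\<lambda>n. weak_grad Q (\<psi> n)) \<longlonglongrightarrow> weak_grad Q v"
    using V_approx[OF assms(2)] by blast
  show ?thesis
    using assms \<phi> \<psi> by (intro V_spaceI[where \<phi> = "\<lambda>n. \<phi> n + \<psi> n"])
      (auto intro: H1_add V_H1 S_add tendsto_add simp: weak_grad_add S_H1 V_H1)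
qed

lemma V_scaleR:
  assumes "u \<in> V_space Q" shows "c *\<^sub>R u \<in> V_space Q"
proof -
  obtain \<phi> where \<phi>: "\<And>n. \<phi> n \<in> S" "\<phi> \<longlonglongrightarrow> u" "(\<lambda>n. weak_grad Q (\<phi> n)) \<longlonglongrightarrow> weak_grad Q u"
    using V_approx[OF assms(1)] by blast
  show ?thesis
    using assms \<phi> by (intro V_spaceI[where \<phi> = "\<lambda>n. c *\<^sub>R \<phi> n"])
      (auto intro: H1_scaleR V_H1 S_scaleR tendsto_scaleR simp: weak_grad_scaleR S_H1 V_H1)
qed

lemma V_diff: "u \<in> V_space Q \<Longrightarrow> v \<in> V_space Q \<Longrightarrow> u - v \<in> V_space Q"
  using V_add[of u "(-1) *\<^sub>R v"] V_scaleR[of v "-1"] by simp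

lemma V_subset_H: "V_space Q \<subseteq> H_space Q"
proof
  fix u assume "u \<in> V_space Q"
  then obtain \<phi> where "\<And>n. \<phi> n \<in> S" "\<phi> \<longlonglongrightarrow> u"
    using V_approx by blast
  then show "u \<in> H_space Q"
    unfolding H_space_def closure_sequential by blast
qed

end

section \<open>Integrability of powers and the space of admissible test functions\<close>

lemma norm_matrix_vector_mult_le:
  fixes A :: "real^'n^'m" and x :: "real^'n"
  shows "norm (A *v x) \<le> norm A * norm x"
proof -
  have "norm (A *v x) \<le> L2_set (\<lambda>i. norm (A $ i) * norm x) UNIV"
    unfolding norm_vec_def[of "A *v x"]
    by (rule L2_set_mono) (simp_all add: matrix_vector_mul_component Cauchy_Schwarz_ineq2)
  also have "\<dots> = norm A * norm x"
    by (simp add: norm_vec_def[of A] L2_set_left_distrib)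
  finally show ?thesis .
qed

lemma powr_add_le:
  fixes a b :: "'a::real_normed_vector"
  assumes "0 \<le> p"
  shows "norm (a + b) powr p \<le> 2 powr p * (norm a powr p + norm b powr p)"
proof -
  have "norm (a + b) powr p \<le> (2 * max (norm a) (norm b)) powr p"
    using norm_triangle_ineq[of a b] assms by (intro powr_mono2) auto
  also have "\<dots> = 2 powr p * max (norm a) (norm b) powr p"
    by (simp add: powr_mult)
  also have "\<dots> \<le> 2 powr p * (norm a powr p + norm b powr p)"
    by (intro mult_left_mono) (auto simp: max_def)
  finally show ?thesis .
qed

lemma power_eq_powr_mult:
  assumes "0 < (r::real)" shows "r ^ n = r powr (real n - p) * r powr p"
proof -
  have "r powr (real n - p) * r powr p = r powr (real n)"
    unfolding powr_add[symmetric] by simp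
  then show ?thesis using powr_realpow[OF assms, of n] by simp
qed

lemma powr_eq_mult_power:
  assumes "0 < (r::real)" shows "r powr p = r powr (p - real n) * r ^ n"
proof -
  have "r powr (p - real n) * r powr (real n) = r powr p"
    unfolding powr_add[symmetric] by simp
  then show ?thesis using powr_realpow[OF assms, of n] by simp
qed

text \<open>For \<open>r \<le> k\<close> the first summand suffices, for \<open>r > k\<close> the second one.\<close>

lemma power4_le_powr:
  fixes r p :: real
  assumes "0 \<le> r" "4 \<le> p" "0 < k"
  shows "r ^ 4 \<le> k\<^sup>2 * r\<^sup>2 + k powr (4 - p) * r powr p"
proof (cases "r \<le> k")
  case True
  then have "r\<^sup>2 * r\<^sup>2 \<le> k\<^sup>2 * r\<^sup>2"
    using assms by (intro mult_right_mono power_mono) auto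
  moreover have "r ^ 4 = r\<^sup>2 * r\<^sup>2" by (simp add: power2_eq_square power4_eq_xxxx)
  moreover have "0 \<le> k powr (4 - p) * r powr p" by simp
  ultimately show ?thesis by linarith
next
  case False
  then have r: "r > 0" "k < r" using assms by auto
  have "r ^ 4 = r powr (4 - p) * r powr p"
    using power_eq_powr_mult[OF r(1), of 4] by simp
  also have "\<dots> \<le> k powr (4 - p) * r powr p"
    using r assms by (intro mult_right_mono powr_mono2') auto
  finally have "r ^ 4 \<le> k powr (4 - p) * r powr p" .
  moreover have "0 \<le> k\<^sup>2 * r\<^sup>2" by simp
  ultimately show ?thesis by linarith
qed

text \<open>The bound on \<open>varpi\<close> makes \<open>p = varpi + 1 \<ge> 4\<close>, so that \<open>L\<^sup>2 \<inter> L\<^sup>p \<subseteq> L\<^sup>4\<close>, and the convection term is controlled by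
  \<open>\<parallel>\<nabla>u\<parallel>\<^sub>2 \<parallel>u\<parallel>\<^sub>4 \<parallel>v\<parallel>\<^sub>4\<close> in every dimension.\<close>

locale brinkman_forchheimer = bounded_open_set Q for Q :: "(real^'d::finite) set" +
  fixes varpi :: real
  assumes varpi_ge: "varpi \<ge> 3"
begin

abbreviation "p \<equiv> varpi + 1"

lemma p_ge: "p \<ge> 4" using varpi_ge by simp

text \<open>The \<open>p\<close>-th power of the norm is additive under the integral and, in contrast to the norm, convenient for
  pointwise estimates. All bounds below are integrals of pointwise Young inequalities.\<close>

definition Lp_pow :: "'d vfield \<Rightarrow> real" where
  "Lp_pow u = (LINT x|lborel. norm (rep_L2 u x) powr p)"

lemma Lp_pow_nonneg: "0 \<le> Lp_pow u"
  unfolding Lp_pow_def by (rule integral_nonneg_AE) simp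

lemma Lp_norm_powr: "Lp_norm p u powr p = Lp_pow u"
  using p_ge Lp_pow_nonneg[of u] by (simp add: Lp_norm_def powr_powr flip: Lp_pow_def)

lemma Lp_norm_less_iff: "0 < e \<Longrightarrow> Lp_norm p u < e \<longleftrightarrow> Lp_pow u < e powr p"
proof
  assume e: "0 < e"
  have nn: "0 \<le> Lp_norm p u" by (simp add: Lp_norm_def)
  show "Lp_norm p u < e" if "Lp_pow u < e powr p"
    using that powr_mono2[of p e "Lp_norm p u"] e p_ge by (fastforce simp: Lp_norm_powr)
  show "Lp_pow u < e powr p" if "Lp_norm p u < e"
    using powr_less_mono2[OF _ nn that, of p] p_ge by (simp add: Lp_norm_powr)
qed

lemma Lp_integrable_add_bound:
  assumes u: "Lp_integrable p u" and v: "Lp_integrable p v"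
    and w: "AE x in lborel. rep_L2 w x = rep_L2 u x + rep_L2 v x \<or> rep_L2 w x = rep_L2 u x - rep_L2 v x"
  shows "Lp_integrable p w" "Lp_pow w \<le> 2 powr p * (Lp_pow u + Lp_pow v)"
proof -
  have int: "integrable lborel (\<lambda>x. 2 powr p * (norm (rep_L2 u x) powr p + norm (rep_L2 v x) powr p))"
    using u v by (auto simp: Lp_integrable_def)
  have le: "AE x in lborel. norm (rep_L2 w x) powr p
      \<le> 2 powr p * (norm (rep_L2 u x) powr p + norm (rep_L2 v x) powr p)"
    using w
  proof eventually_elim
    case (elim x)
    then show ?case
      using powr_add_le[of p "rep_L2 u x" "rep_L2 v x"] powr_add_le[of p "rep_L2 u x" "- rep_L2 v x"] p_ge
      by auto
  qed
  show w': "Lp_integrable p w"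
    unfolding Lp_integrable_def
    by (rule Bochner_Integration.integrable_bound[OF int]) (use le in auto)
  have "Lp_pow w \<le> (LINT x|lborel. 2 powr p * (norm (rep_L2 u x) powr p + norm (rep_L2 v x) powr p))"
    unfolding Lp_pow_def by (rule integral_mono_AE[OF _ int le]) (use w' in \<open>simp add: Lp_integrable_def\<close>)
  also have "\<dots> = 2 powr p * (Lp_pow u + Lp_pow v)"
    using u v by (simp add: Lp_pow_def Lp_integrable_def)
  finally show "Lp_pow w \<le> 2 powr p * (Lp_pow u + Lp_pow v)" .
qed

lemma Lp_integrable_add: "Lp_integrable p u \<Longrightarrow> Lp_integrable p v \<Longrightarrow> Lp_integrable p (u + v)"
  and Lp_integrable_diff: "Lp_integrable p u \<Longrightarrow> Lp_integrable p v \<Longrightarrow> Lp_integrable p (u - v)"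
  and Lp_pow_diff_le: "Lp_integrable p u \<Longrightarrow> Lp_integrable p v \<Longrightarrow> Lp_pow (u - v) \<le> 2 powr p * (Lp_pow u + Lp_pow v)"
proof -
  have "AE x in lborel. rep_L2 (u + v) x = rep_L2 u x + rep_L2 v x \<or> rep_L2 (u + v) x = rep_L2 u x - rep_L2 v x"
    using rep_L2_add[of u v] by eventually_elim simp
  note a = Lp_integrable_add_bound[OF _ _ this]
  have "AE x in lborel. rep_L2 (u - v) x = rep_L2 u x + rep_L2 v x \<or> rep_L2 (u - v) x = rep_L2 u x - rep_L2 v x"
    using rep_L2_diff[of u v] by eventually_elim simp
  note d = Lp_integrable_add_bound[OF _ _ this]
  assume uv: "Lp_integrable p u" "Lp_integrable p v"
  show "Lp_integrable p (u + v)"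
    "Lp_integrable p (u - v)" "Lp_pow (u - v) \<le> 2 powr p * (Lp_pow u + Lp_pow v)"
    using a[OF uv] d[OF uv] by auto
qed

lemma Lp_integrable_scaleR:
  assumes "Lp_integrable p u"
  shows "Lp_integrable p (c *\<^sub>R u)" and Lp_pow_scaleR: "Lp_pow (c *\<^sub>R u) = \<bar>c\<bar> powr p * Lp_pow u"
proof -
  have eq: "AE x in lborel. norm (rep_L2 (c *\<^sub>R u) x) powr p = \<bar>c\<bar> powr p * norm (rep_L2 u x) powr p"
    using rep_L2_scaleR[of c u] by eventually_elim (simp add: powr_mult)
  have "integrable lborel (\<lambda>x. \<bar>c\<bar> powr p * norm (rep_L2 u x) powr p)"
    using assms by (auto simp: Lp_integrable_def)
  then show "Lp_integrable p (c *\<^sub>R u)"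
    unfolding Lp_integrable_def using eq by (subst integrable_cong_AE[OF _ _ eq]) auto
  have "Lp_pow (c *\<^sub>R u) = (LINT x|lborel. \<bar>c\<bar> powr p * norm (rep_L2 u x) powr p)"
    unfolding Lp_pow_def by (rule integral_cong_AE[OF _ _ eq]) auto
  then show "Lp_pow (c *\<^sub>R u) = \<bar>c\<bar> powr p * Lp_pow u"
    by (simp add: Lp_pow_def)
qed

lemma S_Lp_integrable:
  assumes "\<phi> \<in> S" shows "Lp_integrable p \<phi>"
proof -
  obtain f where f: "\<phi> = abs_L2 f" "f \<in> test_functions Q"
    using S_cases[OF assms] by metis
  obtain B where B: "B > 0" "\<And>x. norm (f x) \<le> B"
    using test_function_bounded[OF f(2)] by blast
  have le: "norm (f x) powr p \<le> B powr (p - 2) * (norm (f x))\<^sup>2" for x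
  proof (cases "f x = 0")
    case False
    then have "norm (f x) powr p = norm (f x) powr (p - 2) * (norm (f x))\<^sup>2"
      using powr_eq_mult_power[of "norm (f x)" p 2] by simp
    then show ?thesis
      using B p_ge by (auto intro!: mult_right_mono powr_mono2)
  qed simp
  have "AE x in lborel. norm (norm (rep_L2 \<phi> x) powr p) \<le> norm (B powr (p - 2) * (norm (rep_L2 \<phi> x))\<^sup>2)"
    using rep_abs_L2[OF test_function_square_integrable[OF f(2)]] unfolding f(1)
    by eventually_elim (use le in auto)
  then show ?thesis
    unfolding Lp_integrable_def
    by (rule Bochner_Integration.integrable_bound[OF integrable_mult_right[OF integrable_norm_sq_L2[of \<phi>]], rotated]) measurable
qed

lemma Lp_approx:
  assumes "u \<in> Lp_space Q p"
  obtains \<phi> where "\<And>n. \<phi> n \<in> S" "(\<lambda>n. Lp_pow (u - \<phi> n)) \<longlonglongrightarrow> 0"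
proof -
  have "\<exists>\<phi>\<in>S. Lp_pow (u - \<phi>) < 1 / real (Suc n)" for n
  proof -
    let ?e = "(1 / real (Suc n)) powr (1 / p)"
    have "?e powr p = 1 / real (Suc n)" using p_ge by (simp add: powr_powr)
    moreover have "?e > 0" by simp
    moreover obtain \<phi> where "\<phi> \<in> S" "Lp_norm p (u - \<phi>) < ?e"
      using assms \<open>?e > 0\<close> unfolding Lp_space_def by blast
    ultimately show ?thesis
      using Lp_norm_less_iff[of ?e "u - \<phi>"] by auto
  qed
  then obtain \<phi> where \<phi>: "\<And>n. \<phi> n \<in> S" "\<And>n. Lp_pow (u - \<phi> n) < 1 / real (Suc n)"
    by metis
  have "(\<lambda>n. Lp_pow (u - \<phi> n)) \<longlonglongrightarrow> 0"
    by (rule Lim_null_comparison[OF always_eventually LIMSEQ_Suc[OF lim_1_over_n]])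
       (use \<phi>(2) Lp_pow_nonneg in \<open>simp add: less_imp_le\<close>)
  with \<phi>(1) show thesis by (rule that)
qed

lemma Lp_spaceI:
  assumes u: "Lp_integrable p u" and \<phi>: "\<And>n. \<phi> n \<in> S" "(\<lambda>n. Lp_pow (u - \<phi> n)) \<longlonglongrightarrow> 0"
  shows "u \<in> Lp_space Q p"
  unfolding Lp_space_def
proof (intro CollectI conjI allI impI u)
  fix e :: real assume "e > 0"
  then have "eventually (\<lambda>n. Lp_pow (u - \<phi> n) < e powr p) sequentially"
    by (intro order_tendstoD(2)[OF \<phi>(2)]) simp
  then obtain n where "Lp_pow (u - \<phi> n) < e powr p"
    by (auto simp: eventually_sequentially)
  then show "\<exists>\<phi>\<in>S. Lp_norm p (u - \<phi>) < e"
    using \<phi>(1)[of n] \<open>e > 0\<close> by (auto simp: Lp_norm_less_iff)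
qed

lemma Lp_space_integrable: "u \<in> Lp_space Q p \<Longrightarrow> Lp_integrable p u"
  by (simp add: Lp_space_def)

lemma S_Lp: "\<phi> \<in> S \<Longrightarrow> \<phi> \<in> Lp_space Q p"
  using Lp_pow_scaleR[OF S_Lp_integrable, of \<phi> 0] by (intro Lp_spaceI[of \<phi> "\<lambda>_. \<phi>"] S_Lp_integrable) auto

lemma Lp_scaleR:
  assumes "u \<in> Lp_space Q p" shows "c *\<^sub>R u \<in> Lp_space Q p"
proof -
  obtain \<phi> where \<phi>: "\<And>n. \<phi> n \<in> S" "(\<lambda>n. Lp_pow (u - \<phi> n)) \<longlonglongrightarrow> 0"
    using Lp_approx[OF assms] by blast
  have "Lp_pow (c *\<^sub>R u - c *\<^sub>R \<phi> n) = \<bar>c\<bar> powr p * Lp_pow (u - \<phi> n)" for n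
    using Lp_pow_scaleR[OF Lp_integrable_diff[OF Lp_space_integrable[OF assms] S_Lp_integrable[OF \<phi>(1)]], of c n]
    by (simp add: scaleR_diff_right)
  then show ?thesis
    using tendsto_mult_right_zero[OF \<phi>(2), of "\<bar>c\<bar> powr p"] \<phi>(1) assms
    by (intro Lp_spaceI[where \<phi> = "\<lambda>n. c *\<^sub>R \<phi> n"]) (auto intro: S_scaleR Lp_integrable_scaleR Lp_space_integrable)
qed

lemma Lp_diff:
  assumes u: "u \<in> Lp_space Q p" and v: "v \<in> Lp_space Q p" shows "u - v \<in> Lp_space Q p"
proof -
  obtain \<phi> where \<phi>: "\<And>n. \<phi> n \<in> S" "(\<lambda>n. Lp_pow (u - \<phi> n)) \<longlonglongrightarrow> 0"
    using Lp_approx[OF u] by blast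
  obtain \<psi> where \<psi>: "\<And>n. \<psi> n \<in> S" "(\<lambda>n. Lp_pow (v - \<psi> n)) \<longlonglongrightarrow> 0"
    using Lp_approx[OF v] by blast
  have le: "Lp_pow (u - v - (\<phi> n + (-1) *\<^sub>R \<psi> n)) \<le> 2 powr p * (Lp_pow (u - \<phi> n) + Lp_pow (v - \<psi> n))" for n
    using Lp_pow_diff_le[OF Lp_integrable_diff[OF Lp_space_integrable[OF u] S_Lp_integrable[OF \<phi>(1)[of n]]]
        Lp_integrable_diff[OF Lp_space_integrable[OF v] S_Lp_integrable[OF \<psi>(1)[of n]]]]
    by (simp add: algebra_simps)
  have "(\<lambda>n. 2 powr p * (Lp_pow (u - \<phi> n) + Lp_pow (v - \<psi> n))) \<longlonglongrightarrow> 2 powr p * (0 + 0)"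
    by (intro tendsto_intros \<phi> \<psi>)
  then have lim: "(\<lambda>n. 2 powr p * (Lp_pow (u - \<phi> n) + Lp_pow (v - \<psi> n))) \<longlonglongrightarrow> 0"
    by simp
  have "(\<lambda>n. Lp_pow (u - v - (\<phi> n + (-1) *\<^sub>R \<psi> n))) \<longlonglongrightarrow> 0"
    by (rule Lim_null_comparison[OF always_eventually lim]) (use le Lp_pow_nonneg in auto)
  from Lp_integrable_diff[OF Lp_space_integrable[OF u] Lp_space_integrable[OF v]]
    S_add[OF \<phi>(1) S_scaleR[OF \<psi>(1)]] this
  show ?thesis by (rule Lp_spaceI)
qed

text \<open>The space of test functions in the weak formulation.\<close>

definition X :: "'d vfield set" where "X = V_space Q \<inter> Lp_space Q p"

lemma X_V: "u \<in> X \<Longrightarrow> u \<in> V_space Q" and X_Lp: "u \<in> X \<Longrightarrow> u \<in> Lp_space Q p"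
  and X_H1: "u \<in> X \<Longrightarrow> u \<in> H1 Q" and X_L2_on: "u \<in> X \<Longrightarrow> u \<in> L2_on Q"
  and X_integrable: "u \<in> X \<Longrightarrow> Lp_integrable p u"
  by (auto simp: X_def V_H1 H1_L2_on Lp_space_integrable)

lemma X_diff: "u \<in> X \<Longrightarrow> v \<in> X \<Longrightarrow> u - v \<in> X" and X_scaleR: "u \<in> X \<Longrightarrow> c *\<^sub>R u \<in> X"
  and S_X: "\<phi> \<in> S \<Longrightarrow> \<phi> \<in> X"
  by (auto simp: X_def V_diff Lp_diff V_scaleR Lp_scaleR S_V S_Lp)

lemma X_add: "u \<in> X \<Longrightarrow> v \<in> X \<Longrightarrow> u + v \<in> X"
  using X_diff[of u "(-1) *\<^sub>R v"] X_scaleR[of v "-1"] by simp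

definition L4_pow :: "'d vfield \<Rightarrow> real" where
  "L4_pow u = (LINT x|lborel. norm (rep_L2 u x) ^ 4)"

lemma L4_pow_nonneg: "0 \<le> L4_pow u"
  unfolding L4_pow_def by (rule integral_nonneg_AE) simp

text \<open>Interpolation between the exponents 2 and \<open>p\<close>; the free parameter \<open>k\<close> allows the contribution of
  the \<open>L\<^sup>2\<close> norm to be made small.\<close>

lemma L4_bound:
  assumes "Lp_integrable p u"
  shows "integrable lborel (\<lambda>x. norm (rep_L2 u x) ^ 4)"
    and "k > 0 \<Longrightarrow> L4_pow u \<le> k\<^sup>2 * (norm u)\<^sup>2 + k powr (4 - p) * Lp_pow u"
proof -
  have int: "integrable lborel (\<lambda>x. k\<^sup>2 * (norm (rep_L2 u x))\<^sup>2 + k powr (4 - p) * norm (rep_L2 u x) powr p)" for k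
    using assms integrable_norm_sq_L2[of u] by (auto simp: Lp_integrable_def)
  note le = power4_le_powr[OF norm_ge_zero p_ge]
  show int4: "integrable lborel (\<lambda>x. norm (rep_L2 u x) ^ 4)"
    by (rule integrable_dominated[OF int[of 1]]) (use le[of 1] in auto)
  assume k: "k > 0"
  have "L4_pow u \<le> (LINT x|lborel. k\<^sup>2 * (norm (rep_L2 u x))\<^sup>2 + k powr (4 - p) * norm (rep_L2 u x) powr p)"
    unfolding L4_pow_def by (rule integral_mono[OF int4 int]) (rule le[OF k])
  also have "\<dots> = k\<^sup>2 * (norm u)\<^sup>2 + k powr (4 - p) * Lp_pow u"
    using assms integrable_norm_sq_L2[of u] by (simp add: norm_L2_sq Lp_pow_def Lp_integrable_def)
  finally show "L4_pow u \<le> k\<^sup>2 * (norm u)\<^sup>2 + k powr (4 - p) * Lp_pow u" .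
qed

lemma norm_sq_le_Lp:
  assumes "Lp_integrable p u" "u \<in> L2_on Q" "k > 0"
  shows "(norm u)\<^sup>2 \<le> k\<^sup>2 * measure lborel Q + k powr (2 - p) * Lp_pow u"
proof -
  have le: "(norm y)\<^sup>2 \<le> k\<^sup>2 + k powr (2 - p) * norm y powr p" for y :: "real^'d"
  proof (cases "norm y \<le> k")
    case True
    then have "(norm y)\<^sup>2 \<le> k\<^sup>2" by (intro power_mono) auto
    moreover have "0 \<le> k powr (2 - p) * norm y powr p" by simp
    ultimately show ?thesis by linarith
  next
    case False
    then have r: "norm y > 0" "k < norm y" using assms(3) by auto
    have "(norm y)\<^sup>2 = norm y powr (2 - p) * norm y powr p"
      using power_eq_powr_mult[OF r(1), of 2 p] by simp
    also have "\<dots> \<le> k powr (2 - p) * norm y powr p"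
      using r assms p_ge by (intro mult_right_mono powr_mono2') auto
    finally have "(norm y)\<^sup>2 \<le> k powr (2 - p) * norm y powr p" .
    moreover have "0 \<le> k\<^sup>2" by simp
    ultimately show ?thesis by linarith
  qed
  have fin: "emeasure lborel Q < \<infinity>" by (rule emeasure_bounded_finite[OF bounded_Q])
  have int: "integrable lborel (\<lambda>x. k\<^sup>2 * indicator Q x + k powr (2 - p) * norm (rep_L2 u x) powr p)"
    using assms(1) fin by (auto simp: Lp_integrable_def)
  have "(norm u)\<^sup>2 \<le> (LINT x|lborel. k\<^sup>2 * indicator Q x + k powr (2 - p) * norm (rep_L2 u x) powr p)"
    unfolding norm_L2_sq
  proof (rule integral_mono_AE[OF integrable_norm_sq_L2 int])
    show "AE x in lborel. (norm (rep_L2 u x))\<^sup>2 \<le> k\<^sup>2 * indicator Q x + k powr (2 - p) * norm (rep_L2 u x) powr p"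
      using L2_on_rep[OF assms(2)]
    proof eventually_elim
      case (elim x)
      then show ?case using le[of "rep_L2 u x"] by (cases "x \<in> Q") auto
    qed
  qed
  also have "\<dots> = k\<^sup>2 * measure lborel Q + k powr (2 - p) * Lp_pow u"
    using assms(1) fin by (simp add: Lp_pow_def Lp_integrable_def)
  finally show ?thesis .
qed

text \<open>Elements of \<open>X\<close> are limits of test fields in \<open>L\<^sup>p\<close>, and on the bounded set \<open>Q\<close> this implies
  convergence in \<open>L\<^sup>4\<close>, which is enough for the convection term. The approximating fields need not converge in \<open>V\<close>;
  the antisymmetry of the convection term is therefore proved one argument at a time.\<close>

lemma L4_approx:
  assumes u: "u \<in> X"
  obtains \<phi> where "\<And>n. \<phi> n \<in> S" "(\<lambda>n. L4_pow (u - \<phi> n)) \<longlonglongrightarrow> 0"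
proof -
  obtain \<phi> where \<phi>: "\<And>n. \<phi> n \<in> S" "(\<lambda>n. Lp_pow (u - \<phi> n)) \<longlonglongrightarrow> 0"
    using Lp_approx[OF X_Lp[OF u]] by blast
  note uX = X_diff[OF u S_X[OF \<phi>(1)]]
  have "(\<lambda>n. L4_pow (u - \<phi> n)) \<longlonglongrightarrow> 0"
  proof (rule order_tendstoI)
    fix e :: real assume "e < 0"
    then show "eventually (\<lambda>n. e < L4_pow (u - \<phi> n)) sequentially"
      by (auto intro!: always_eventually less_le_trans[OF _ L4_pow_nonneg])
  next
    fix e :: real assume "0 < e"
    define m where "m = measure lborel Q"
    have m: "m \<ge> 0" by (simp add: m_def)
    define k where "k = min 1 (e / (2 * (m + 1)))"
    have k: "0 < k" "k \<le> 1" using \<open>0 < e\<close> m by (auto simp: k_def)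
    have "k\<^sup>2 * m \<le> k * (m + 1)"
      using k m by (intro mult_mono) (auto simp: power2_eq_square mult_left_le)
    also have "\<dots> \<le> e / (2 * (m + 1)) * (m + 1)"
      using m by (intro mult_right_mono) (auto simp: k_def)
    also have "\<dots> = e / 2" using m by (simp add: field_simps)
    finally have km: "k\<^sup>2 * (k\<^sup>2 * m) \<le> e / 2"
      using k mult_left_le_one_le[of "k\<^sup>2 * m" "k\<^sup>2"] m by (simp add: power_le_one)
    define C where "C = k\<^sup>2 * k powr (2 - p) + k powr (4 - p)"
    have "L4_pow (u - \<phi> n) \<le> k\<^sup>2 * (k\<^sup>2 * m) + C * Lp_pow (u - \<phi> n)" for n
      using L4_bound(2)[OF X_integrable[OF uX] k(1), of n]
        mult_left_mono[OF norm_sq_le_Lp[OF X_integrable[OF uX] X_L2_on[OF uX] k(1)], of "k\<^sup>2" n]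
      by (simp add: C_def m_def algebra_simps)
    then have le: "L4_pow (u - \<phi> n) \<le> e / 2 + C * Lp_pow (u - \<phi> n)" for n
      using km by (meson add_right_mono order_trans)
    have "(\<lambda>n. C * Lp_pow (u - \<phi> n)) \<longlonglongrightarrow> 0"
      using tendsto_mult_right_zero[OF \<phi>(2)] .
    then have "eventually (\<lambda>n. C * Lp_pow (u - \<phi> n) < e / 2) sequentially"
      using \<open>0 < e\<close> by (intro order_tendstoD(2)) auto
    then show "eventually (\<lambda>n. L4_pow (u - \<phi> n) < e) sequentially"
    proof eventually_elim
      case (elim n)
      then show ?case using le[of n] by simp
    qed
  qed
  with \<phi>(1) show thesis by (rule that)
qed

end

section \<open>The trilinear convection form\<close>

lemma inner_matrix_vector_mult:
  fixes A :: "real^'n^'m"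
  shows "(A *v y) \<bullet> z = (\<Sum>i\<in>UNIV. \<Sum>j\<in>UNIV. A $ i $ j * (y $ j * z $ i))"
  unfolding inner_vec_def matrix_vector_mult_def
  by (simp add: sum_distrib_right mult.assoc)

lemma bounded_bilinear_matrix_vector_mult_real:
  "bounded_bilinear ((*v) :: real^'n^'m \<Rightarrow> real^'n \<Rightarrow> real^'m)"
proof
  show "\<exists>K. \<forall>(A::real^'n^'m) x. norm (A *v x) \<le> norm A * norm x * K"
    using norm_matrix_vector_mult_le by (intro exI[of _ 1] allI) simp
qed (simp_all add: matrix_vector_right_distrib matrix_vector_mult_add_rdistrib
    scaleR_matrix_vector_assoc matrix_vector_mult_scaleR)

lemma borel_measurable_matrix_vector_mult [measurable]:
  fixes f :: "'a \<Rightarrow> real^'n^'m"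
  assumes "f \<in> borel_measurable M" "g \<in> borel_measurable M"
  shows "(\<lambda>x. f x *v g x) \<in> borel_measurable M"
  by (rule borel_measurable_continuous_Pair[OF assms])
     (intro bounded_bilinear.continuous_on[OF bounded_bilinear_matrix_vector_mult_real] continuous_intros)

context brinkman_forchheimer
begin

text \<open>\<open>tri a v z\<close> is the integral of \<open>(a \<cdot> \<nabla>)v \<cdot> z\<close>.\<close>

definition tri :: "'d vfield \<Rightarrow> 'd vfield \<Rightarrow> 'd vfield \<Rightarrow> real" where
  "tri a v z = (LINT x|lborel. (rep_L2 (weak_grad Q v) x *v rep_L2 a x) \<bullet> rep_L2 z x)"

definition dirichlet :: "'d vfield \<Rightarrow> real" where
  "dirichlet v = (norm (weak_grad Q v))\<^sup>2"

lemma dirichlet_nonneg: "0 \<le> dirichlet v"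
  by (simp add: dirichlet_def)

lemma tri_measurable:
  "(\<lambda>x. (rep_L2 (G :: 'd tfield) x *v rep_L2 a x) \<bullet> rep_L2 z x) \<in> borel_measurable lborel"
  by simp

lemma young_product_le:
  fixes g r s :: real
  assumes "0 < k" "0 \<le> g" "0 \<le> r" "0 \<le> s"
  shows "g * r * s \<le> k * g\<^sup>2 + k * s ^ 4 + 1 / k ^ 3 * r ^ 4"
proof -
  have 1: "g * (r * s) \<le> k * g\<^sup>2 + 1 / k * (r * s)\<^sup>2"
  proof -
    have "0 \<le> (k * g - r * s)\<^sup>2" "0 \<le> k * g * (r * s)" using assms by auto
    then have "k * (g * (r * s)) \<le> k * (k * g\<^sup>2 + 1 / k * (r * s)\<^sup>2)"
      using assms(1) by (simp add: power2_eq_square algebra_simps)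
    then show ?thesis using assms(1) by (rule mult_left_le_imp_le)
  qed
  have 2: "r\<^sup>2 * s\<^sup>2 \<le> k\<^sup>2 * s ^ 4 + 1 / k\<^sup>2 * r ^ 4"
  proof -
    have "0 \<le> (k\<^sup>2 * s\<^sup>2 - r\<^sup>2)\<^sup>2" "0 \<le> k\<^sup>2 * (s\<^sup>2 * r\<^sup>2)" by auto
    then have "k\<^sup>2 * (r\<^sup>2 * s\<^sup>2) \<le> k\<^sup>2 * (k\<^sup>2 * s ^ 4 + 1 / k\<^sup>2 * r ^ 4)"
      using assms(1) by (simp add: power2_eq_square power4_eq_xxxx algebra_simps)
    then show ?thesis by (rule mult_left_le_imp_le) (use assms(1) in simp)
  qed
  have "1 / k * (r * s)\<^sup>2 \<le> 1 / k * (k\<^sup>2 * s ^ 4 + 1 / k\<^sup>2 * r ^ 4)"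
    using 2 assms(1) by (intro mult_left_mono) (auto simp: power_mult_distrib)
  also have "\<dots> = k * s ^ 4 + 1 / k ^ 3 * r ^ 4"
    using assms(1) by (simp add: field_simps power2_eq_square power3_eq_cube)
  finally show ?thesis using 1 by (simp add: mult.assoc)
qed

text \<open>Two versions, since the factor \<open>1 / k ^ 3\<close> must go to the argument that is small.\<close>

lemma tri_integrand_le:
  fixes A :: "real^'d^'d"
  assumes "0 < k"
  shows "\<bar>(A *v y) \<bullet> z\<bar> \<le> k * (norm A)\<^sup>2 + k * norm z ^ 4 + 1 / k ^ 3 * norm y ^ 4"
    and "\<bar>(A *v y) \<bullet> z\<bar> \<le> k * (norm A)\<^sup>2 + k * norm y ^ 4 + 1 / k ^ 3 * norm z ^ 4"
proof -
  have "\<bar>(A *v y) \<bullet> z\<bar> \<le> norm (A *v y) * norm z" by (rule Cauchy_Schwarz_ineq2)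
  also have "\<dots> \<le> norm A * norm y * norm z"
    by (intro mult_right_mono norm_matrix_vector_mult_le) simp
  finally have *: "\<bar>(A *v y) \<bullet> z\<bar> \<le> norm A * norm y * norm z" .
  show "\<bar>(A *v y) \<bullet> z\<bar> \<le> k * (norm A)\<^sup>2 + k * norm z ^ 4 + 1 / k ^ 3 * norm y ^ 4"
    using order_trans[OF * young_product_le[OF assms]] by simp
  show "\<bar>(A *v y) \<bullet> z\<bar> \<le> k * (norm A)\<^sup>2 + k * norm y ^ 4 + 1 / k ^ 3 * norm z ^ 4"
    using order_trans[OF * order_trans[OF eq_refl young_product_le[OF assms, of "norm A" "norm z" "norm y"]]]
    by (simp add: mult.commute mult.left_commute)
qed

lemma tri_integrable:
  assumes a: "Lp_integrable p a" and z: "Lp_integrable p z"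
  shows "integrable lborel (\<lambda>x. (rep_L2 (G :: 'd tfield) x *v rep_L2 a x) \<bullet> rep_L2 z x)"
proof (rule integrable_dominated)
  show "integrable lborel (\<lambda>x. 1 * (norm (rep_L2 G x))\<^sup>2 + 1 * norm (rep_L2 z x) ^ 4 + 1 / 1 ^ 3 * norm (rep_L2 a x) ^ 4)"
    using L4_bound(1)[OF a] L4_bound(1)[OF z] integrable_norm_sq_L2[of G] by simp
qed (rule tri_measurable, rule tri_integrand_le(1), simp)

lemma tri_bound:
  assumes a: "Lp_integrable p a" and z: "Lp_integrable p z" and k: "0 < k"
  shows "\<bar>tri a v z\<bar> \<le> k * dirichlet v + k * L4_pow z + 1 / k ^ 3 * L4_pow a"
    and "\<bar>tri a v z\<bar> \<le> k * dirichlet v + k * L4_pow a + 1 / k ^ 3 * L4_pow z"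
proof -
  let ?G = "rep_L2 (weak_grad Q v)"
  note int = L4_bound(1)[OF a] L4_bound(1)[OF z] integrable_norm_sq_L2[of "weak_grad Q v"]
  note ti = tri_integrable[OF a z, of "weak_grad Q v"]
  have "\<bar>tri a v z\<bar> \<le> (LINT x|lborel. \<bar>(?G x *v rep_L2 a x) \<bullet> rep_L2 z x\<bar>)"
    unfolding tri_def by (rule integral_abs_bound)
  also have "\<dots> \<le> (LINT x|lborel. k * (norm (?G x))\<^sup>2 + k * norm (rep_L2 z x) ^ 4 + 1 / k ^ 3 * norm (rep_L2 a x) ^ 4)"
    by (rule integral_mono[OF integrable_abs[OF ti]]) (use int tri_integrand_le(1)[OF k] in auto)
  also have "\<dots> = k * dirichlet v + k * L4_pow z + 1 / k ^ 3 * L4_pow a"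
    using int by (simp add: dirichlet_def norm_L2_sq L4_pow_def)
  finally show "\<bar>tri a v z\<bar> \<le> k * dirichlet v + k * L4_pow z + 1 / k ^ 3 * L4_pow a" .
  have "\<bar>tri a v z\<bar> \<le> (LINT x|lborel. \<bar>(?G x *v rep_L2 a x) \<bullet> rep_L2 z x\<bar>)"
    unfolding tri_def by (rule integral_abs_bound)
  also have "\<dots> \<le> (LINT x|lborel. k * (norm (?G x))\<^sup>2 + k * norm (rep_L2 a x) ^ 4 + 1 / k ^ 3 * norm (rep_L2 z x) ^ 4)"
    by (rule integral_mono[OF integrable_abs[OF ti]]) (use int tri_integrand_le(2)[OF k] in auto)
  also have "\<dots> = k * dirichlet v + k * L4_pow a + 1 / k ^ 3 * L4_pow z"
    using int by (simp add: dirichlet_def norm_L2_sq L4_pow_def)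
  finally show "\<bar>tri a v z\<bar> \<le> k * dirichlet v + k * L4_pow a + 1 / k ^ 3 * L4_pow z" .
qed

lemma tri_diff:
  assumes a: "Lp_integrable p a" and b: "Lp_integrable p b" and z: "Lp_integrable p z"
  shows "tri (a - b) v z = tri a v z - tri b v z"
    and "tri z v (a - b) = tri z v a - tri z v b"
    and "v \<in> H1 Q \<Longrightarrow> w \<in> H1 Q \<Longrightarrow> tri a (v - w) z = tri a v z - tri a w z"
proof -
  show "tri (a - b) v z = tri a v z - tri b v z"
    unfolding tri_def Bochner_Integration.integral_diff[OF tri_integrable[OF a z] tri_integrable[OF b z], symmetric]
  proof (rule integral_cong_AE)
    show "AE x in lborel. (rep_L2 (weak_grad Q v) x *v rep_L2 (a - b) x) \<bullet> rep_L2 z x = (rep_L2 (weak_grad Q v) x *v rep_L2 a x) \<bullet> rep_L2 z x - (rep_L2 (weak_grad Q v) x *v rep_L2 b x) \<bullet> rep_L2 z x"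
      using rep_L2_diff[of a b] by eventually_elim (simp add: matrix_vector_mult_diff_distrib inner_diff_left)
  qed simp_all
  show "tri z v (a - b) = tri z v a - tri z v b"
    unfolding tri_def Bochner_Integration.integral_diff[OF tri_integrable[OF z a] tri_integrable[OF z b], symmetric]
  proof (rule integral_cong_AE)
    show "AE x in lborel. (rep_L2 (weak_grad Q v) x *v rep_L2 z x) \<bullet> rep_L2 (a - b) x = (rep_L2 (weak_grad Q v) x *v rep_L2 z x) \<bullet> rep_L2 a x - (rep_L2 (weak_grad Q v) x *v rep_L2 z x) \<bullet> rep_L2 b x"
      using rep_L2_diff[of a b] by eventually_elim (simp add: inner_diff_right)
  qed simp_all
  assume vw: "v \<in> H1 Q" "w \<in> H1 Q"
  show "tri a (v - w) z = tri a v z - tri a w z"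
    unfolding tri_def weak_grad_diff[OF vw] Bochner_Integration.integral_diff[OF tri_integrable[OF a z] tri_integrable[OF a z], symmetric]
  proof (rule integral_cong_AE)
    show "AE x in lborel. (rep_L2 (weak_grad Q v - weak_grad Q w) x *v rep_L2 a x) \<bullet> rep_L2 z x = (rep_L2 (weak_grad Q v) x *v rep_L2 a x) \<bullet> rep_L2 z x - (rep_L2 (weak_grad Q w) x *v rep_L2 a x) \<bullet> rep_L2 z x"
      using rep_L2_diff[of "weak_grad Q v" "weak_grad Q w"] by eventually_elim (simp add: matrix_vector_mult_diff_rdistrib inner_diff_left)
  qed simp_all
qed

text \<open>The products \<open>f\<^sub>j g\<^sub>i\<close> are admissible in the definition of the weak gradient of \<open>v\<close>. The
  product rule produces the derivatives of \<open>g\<close>, and those of \<open>f\<close> sum up to its divergence.\<close>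

lemma tri_antisym_test:
  assumes f: "f \<in> test_functions Q" and div: "\<And>x. trace (jacobian f (at x)) = 0"
    and g: "g \<in> test_functions Q" and v: "v \<in> H1 Q"
  shows "tri (abs_L2 f) v (abs_L2 g) = - tri (abs_L2 f) (abs_L2 g) v"
proof -
  define G where "G = weak_grad Q v"
  have G: "is_weak_grad Q v G" unfolding G_def by (rule is_weak_grad_weak_grad[OF v])
  define \<psi> where "\<psi> i j x = f x $ j * g x $ i" for i j x
  have \<psi>: "\<psi> i j \<in> test_functions Q" for i j
    unfolding \<psi>_def by (rule test_function_mult[OF test_function_component[OF f] test_function_smooth[OF test_function_component[OF g]]])
  have D: "frechet_derivative (\<psi> i j) (at x) (axis j 1) =
      f x $ j * jacobian g (at x) $ i $ j + jacobian f (at x) $ j $ j * g x $ i" for i j x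
    unfolding \<psi>_def jacobian_nth
    using frechet_derivative_mult_real[OF test_function_has_derivative[OF test_function_component[OF f]]
        test_function_has_derivative[OF test_function_component[OF g]]]
    by (simp add: frechet_derivative_component[OF f] frechet_derivative_component[OF g])
  note f_ae = rep_abs_L2[OF test_function_square_integrable[OF f]]
    and g_ae = rep_abs_L2[OF test_function_square_integrable[OF g]]
    and J_ae = rep_abs_L2[OF test_function_square_integrable[OF test_function_jacobian[OF g]]]
  have [measurable]: "f \<in> borel_measurable borel" "g \<in> borel_measurable borel"
      "\<psi> i j \<in> borel_measurable borel"
      "(\<lambda>x. frechet_derivative (\<psi> i j) (at x) (axis j 1)) \<in> borel_measurable borel" for i j
    using f g \<psi> test_function_borel_measurable[OF test_function_deriv[OF \<psi>]]
    by (auto intro: test_function_borel_measurable)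
  have [measurable]: "(\<lambda>x. rep_L2 G x $ i $ j) \<in> borel_measurable borel" "(\<lambda>x. rep_L2 v x $ i) \<in> borel_measurable borel" for i j
  proof -
    have "(\<lambda>x. rep_L2 G x \<bullet> axis i (axis j 1)) \<in> borel_measurable borel" "(\<lambda>x. rep_L2 v x \<bullet> axis i 1) \<in> borel_measurable borel"
      by measurable
    then show "(\<lambda>x. rep_L2 G x $ i $ j) \<in> borel_measurable borel" "(\<lambda>x. rep_L2 v x $ i) \<in> borel_measurable borel"
      by (simp_all add: inner_axis)
  qed
  have int: "integrable lborel (\<lambda>x. rep_L2 G x $ i $ j * \<psi> i j x)"
    "integrable lborel (\<lambda>x. rep_L2 v x $ i * frechet_derivative (\<psi> i j) (at x) (axis j 1))" for i j
    using integrable_inner_square_integrable[OF square_integrable_rep[of G] square_integrable_test_scaleR[OF \<psi>, of i j "axis i (axis j 1)"]]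
      integrable_inner_square_integrable[OF square_integrable_rep[of v] square_integrable_test_scaleR[OF test_function_deriv[OF \<psi>], of i j "axis j 1" "axis i 1"]]
    by (simp_all add: inner_axis mult.commute)
  have ibp: "(LINT x|lborel. rep_L2 G x $ i $ j * \<psi> i j x) = - (LINT x|lborel. rep_L2 v x $ i * frechet_derivative (\<psi> i j) (at x) (axis j 1))" for i j
  proof -
    have "v \<bullet> abs_L2 (\<lambda>x. frechet_derivative (\<psi> i j) (at x) (axis j 1) *\<^sub>R axis i 1) =
        - (G \<bullet> abs_L2 (\<lambda>x. \<psi> i j x *\<^sub>R axis i (axis j 1)))"
      using G \<psi>[of i j] unfolding is_weak_grad_iff by blast
    then show ?thesis
      by (simp add: inner_abs_L2_right[OF square_integrable_test_scaleR[OF \<psi>]]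
          inner_abs_L2_right[OF square_integrable_test_scaleR[OF test_function_deriv[OF \<psi>]]] inner_axis mult.commute)
  qed
  have "tri (abs_L2 f) v (abs_L2 g) = (LINT x|lborel. (\<Sum>i\<in>UNIV. \<Sum>j\<in>UNIV. rep_L2 G x $ i $ j * \<psi> i j x))"
    unfolding tri_def G_def[symmetric]
  proof (rule integral_cong_AE)
    show "AE x in lborel. (rep_L2 G x *v rep_L2 (abs_L2 f) x) \<bullet> rep_L2 (abs_L2 g) x =
        (\<Sum>i\<in>UNIV. \<Sum>j\<in>UNIV. rep_L2 G x $ i $ j * \<psi> i j x)"
      using f_ae g_ae
      by eventually_elim (simp add: \<psi>_def inner_matrix_vector_mult)
  qed simp_all
  also have "\<dots> = - (LINT x|lborel. (\<Sum>i\<in>UNIV. \<Sum>j\<in>UNIV. rep_L2 v x $ i * frechet_derivative (\<psi> i j) (at x) (axis j 1)))"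
    using int by (simp add: ibp sum_negf)
  also have "(LINT x|lborel. (\<Sum>i\<in>UNIV. \<Sum>j\<in>UNIV. rep_L2 v x $ i * frechet_derivative (\<psi> i j) (at x) (axis j 1)))
      = tri (abs_L2 f) (abs_L2 g) v"
    unfolding tri_def weak_grad_test(1)[OF g]
  proof (rule integral_cong_AE)
    show "AE x in lborel. (\<Sum>i\<in>UNIV. \<Sum>j\<in>UNIV. rep_L2 v x $ i * frechet_derivative (\<psi> i j) (at x) (axis j 1)) =
        (rep_L2 (abs_L2 (\<lambda>x. jacobian g (at x))) x *v rep_L2 (abs_L2 f) x) \<bullet> rep_L2 v x"
      using f_ae J_ae
    proof eventually_elim
      case (elim x)
      have "(\<Sum>i\<in>UNIV. \<Sum>j\<in>UNIV. rep_L2 v x $ i * frechet_derivative (\<psi> i j) (at x) (axis j 1)) =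
          (\<Sum>i\<in>UNIV. \<Sum>j\<in>UNIV. rep_L2 v x $ i * (f x $ j * jacobian g (at x) $ i $ j)) +
          (\<Sum>i\<in>UNIV. rep_L2 v x $ i * g x $ i * (\<Sum>j\<in>UNIV. jacobian f (at x) $ j $ j))"
        unfolding D by (simp add: distrib_left sum.distrib sum_distrib_left mult.assoc mult.commute mult.left_commute)
      also have "(\<Sum>j\<in>UNIV. jacobian f (at x) $ j $ j) = 0"
        using div[of x] by (simp add: trace_def)
      finally show ?case
        unfolding elim
        by (simp add: inner_matrix_vector_mult mult.commute mult.left_commute)
    qed
  qed simp_all
  finally show ?thesis .
qed

lemma lipschitz_superposition_matrix_vector:
  fixes f :: "real^'d \<Rightarrow> real^'d"
  assumes "f \<in> test_functions Q" "\<And>x. norm (f x) \<le> B"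
  shows "lipschitz_superposition (\<lambda>x (A :: real^'d^'d). A *v f x) B"
proof
  fix h :: "real^'d \<Rightarrow> real^'d^'d" assume [measurable]: "h \<in> borel_measurable borel"
  have [measurable]: "f \<in> borel_measurable borel" by (rule test_function_borel_measurable[OF assms(1)])
  show "(\<lambda>x. h x *v f x) \<in> borel_measurable borel" by measurable
next
  fix x :: "real^'d" and A C :: "real^'d^'d"
  have "norm (A *v f x - C *v f x) \<le> norm (A - C) * norm (f x)"
    using norm_matrix_vector_mult_le[of "A - C" "f x"] by (simp add: matrix_vector_mult_diff_rdistrib)
  also have "\<dots> \<le> norm (A - C) * B"
    using assms(2) by (rule mult_left_mono) simp
  finally show "norm (A *v f x - C *v f x) \<le> B * norm (A - C)" by (simp add: mult.commute)
qed simp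

lemma tri_eq_inner:
  assumes f: "f \<in> test_functions Q"
  shows "tri (abs_L2 f) v z = superposition (\<lambda>x A. A *v f x) (weak_grad Q v) \<bullet> z"
proof -
  obtain B where B: "\<And>x. norm (f x) \<le> B" using test_function_bounded[OF f] by blast
  interpret lipschitz_superposition "\<lambda>x (A :: real^'d^'d). A *v f x" B
    by (rule lipschitz_superposition_matrix_vector[OF f B])
  show ?thesis
    unfolding tri_def inner_L2.rep_eq
  proof (rule integral_cong_AE)
    show "AE x in lborel. (rep_L2 (weak_grad Q v) x *v rep_L2 (abs_L2 f) x) \<bullet> rep_L2 z x =
        rep_L2 (superposition (\<lambda>x A. A *v f x) (weak_grad Q v)) x \<bullet> rep_L2 z x"
      using rep[of "weak_grad Q v"] rep_abs_L2[OF test_function_square_integrable[OF f]]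
      by eventually_elim simp
  qed simp_all
qed

text \<open>For a bounded field in the first argument both sides are continuous in \<open>z\<close> and its gradient, so test fields
  suffice.\<close>

lemma tri_antisym_test_V:
  assumes f: "f \<in> test_functions Q" and div: "\<And>x. trace (jacobian f (at x)) = 0"
    and z: "z \<in> V_space Q" and v: "v \<in> H1 Q"
  shows "tri (abs_L2 f) v z = - tri (abs_L2 f) z v"
proof -
  obtain B where B: "\<And>x. norm (f x) \<le> B" using test_function_bounded[OF f] by blast
  let ?R = "superposition (\<lambda>x (A :: real^'d^'d). A *v f x)"
  interpret lipschitz_superposition "\<lambda>x (A :: real^'d^'d). A *v f x" B
    by (rule lipschitz_superposition_matrix_vector[OF f B])
  obtain \<phi> where \<phi>: "\<And>n. \<phi> n \<in> S" "\<phi> \<longlonglongrightarrow> z" "(\<lambda>n. weak_grad Q (\<phi> n)) \<longlonglongrightarrow> weak_grad Q z"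
    using V_approx[OF z] by blast
  have "(\<lambda>n. ?R (weak_grad Q v) \<bullet> \<phi> n) \<longlonglongrightarrow> ?R (weak_grad Q v) \<bullet> z"
    by (intro tendsto_inner tendsto_const \<phi>)
  moreover have "?R (weak_grad Q v) \<bullet> \<phi> n = - (?R (weak_grad Q (\<phi> n)) \<bullet> v)" for n
  proof -
    obtain g where g: "\<phi> n = abs_L2 g" "g \<in> test_functions Q"
      using S_cases[OF \<phi>(1)] by metis
    show ?thesis
      using tri_antisym_test[OF f div g(2) v] unfolding tri_eq_inner[OF f] g(1) .
  qed
  moreover have "(\<lambda>n. - (?R (weak_grad Q (\<phi> n)) \<bullet> v)) \<longlonglongrightarrow> - (?R (weak_grad Q z) \<bullet> v)"
    by (intro tendsto_minus tendsto_inner tendsto_const continuous_on_tendsto_compose[OF continuous \<phi>(3)]) auto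
  ultimately show ?thesis
    unfolding tri_eq_inner[OF f] using LIMSEQ_unique by fastforce
qed

text \<open>For fixed \<open>k\<close> the bound on the form consists of \<open>k\<close> times a constant and a null sequence.\<close>

lemma tri_tendsto:
  assumes a: "a \<in> X" and z: "z \<in> X" and \<phi>: "\<And>n. \<phi> n \<in> S" "(\<lambda>n. L4_pow (a - \<phi> n)) \<longlonglongrightarrow> 0"
  shows "(\<lambda>n. tri (\<phi> n) v z) \<longlonglongrightarrow> tri a v z" "(\<lambda>n. tri z v (\<phi> n)) \<longlonglongrightarrow> tri z v a"
proof -
  have *: "t \<longlonglongrightarrow> 0" if le: "\<And>n k. 0 < k \<Longrightarrow> \<bar>t n\<bar> \<le> k * C + 1 / k ^ 3 * L4_pow (a - \<phi> n)" and C: "0 \<le> C" for t C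
  proof (rule tendstoI)
    fix e :: real assume "0 < e"
    define k where "k = e / (2 * (C + 1))"
    have k: "0 < k" "k * C \<le> e / 2" using \<open>0 < e\<close> C by (auto simp: k_def field_simps)
    have "(\<lambda>n. 1 / k ^ 3 * L4_pow (a - \<phi> n)) \<longlonglongrightarrow> 0"
      using tendsto_mult_right_zero[OF \<phi>(2)] .
    then have "eventually (\<lambda>n. 1 / k ^ 3 * L4_pow (a - \<phi> n) < e / 2) sequentially"
      using \<open>0 < e\<close> by (intro order_tendstoD(2)) auto
    then show "eventually (\<lambda>n. dist (t n) 0 < e) sequentially"
    proof eventually_elim
      case (elim n)
      then have "\<bar>t n\<bar> < e" using le[OF k(1), of n] k(2) by linarith
      then show ?case by simp
    qed
  qed
  note ints = X_integrable[OF a] S_Lp_integrable[OF \<phi>(1)] X_integrable[OF z]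
  have d: "Lp_integrable p (a - \<phi> n)" for n
    by (rule Lp_integrable_diff[OF ints(1,2)])
  have "(\<lambda>n. tri a v z - tri (\<phi> n) v z) \<longlonglongrightarrow> 0"
    using tri_bound(1)[OF d X_integrable[OF z], of _ _ v] dirichlet_nonneg[of v] L4_pow_nonneg[of z]
    by (intro *[of _ "dirichlet v + L4_pow z"]) (simp_all add: tri_diff(1)[OF ints] distrib_left)
  then show "(\<lambda>n. tri (\<phi> n) v z) \<longlonglongrightarrow> tri a v z"
    using tendsto_diff[OF tendsto_const[of "tri a v z"]] by fastforce
  have "(\<lambda>n. tri z v a - tri z v (\<phi> n)) \<longlonglongrightarrow> 0"
    using tri_bound(2)[OF X_integrable[OF z] d, of _ v] dirichlet_nonneg[of v] L4_pow_nonneg[of z]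
    by (intro *[of _ "dirichlet v + L4_pow z"]) (simp_all add: tri_diff(2)[OF ints] distrib_left)
  then show "(\<lambda>n. tri z v (\<phi> n)) \<longlonglongrightarrow> tri z v a"
    using tendsto_diff[OF tendsto_const[of "tri z v a"]] by fastforce
qed

text \<open>The first argument is approximated by test fields in \<open>L\<^sup>4\<close>. For a test field in this place the
  identity has been obtained by approximating the last argument in the norm of \<open>V\<close>.\<close>

lemma tri_antisym:
  assumes a: "a \<in> X" and v: "v \<in> X" and z: "z \<in> X"
  shows "tri a v z = - tri a z v"
proof -
  obtain \<phi> where \<phi>: "\<And>n. \<phi> n \<in> S" "(\<lambda>n. L4_pow (a - \<phi> n)) \<longlonglongrightarrow> 0"
    using L4_approx[OF a] by blast
  have eq: "tri (\<phi> n) v z = - tri (\<phi> n) z v" for n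
  proof -
    obtain f where f: "\<phi> n = abs_L2 f" "f \<in> test_functions Q" "\<And>x. trace (jacobian f (at x)) = 0"
      using S_cases[OF \<phi>(1)] by blast
    show ?thesis unfolding f(1) by (rule tri_antisym_test_V[OF f(2,3) X_V[OF z] X_H1[OF v]])
  qed
  have "(\<lambda>n. - tri (\<phi> n) z v) \<longlonglongrightarrow> tri a v z"
    using tri_tendsto(1)[OF a z \<phi>, of v] by (simp add: eq)
  moreover have "(\<lambda>n. - tri (\<phi> n) z v) \<longlonglongrightarrow> - tri a z v"
    by (intro tendsto_minus tri_tendsto(1)[OF a v \<phi>])
  ultimately show ?thesis by (rule LIMSEQ_unique)
qed

lemma tri_self_zero: "a \<in> X \<Longrightarrow> v \<in> X \<Longrightarrow> tri a v v = 0"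
  using tri_antisym[of a v v] by simp

lemma convection_form_eq_tri:
  assumes "u \<in> H1 Q" shows "convection_form Q u v = tri u u v"
  unfolding convection_form_def tri_def set_lebesgue_integral_def
proof (rule integral_cong_AE)
  show "AE x in lborel. indicator Q x *\<^sub>R ((rep_L2 (weak_grad Q u) x *v rep_L2 u x) \<bullet> rep_L2 v x) =
      (rep_L2 (weak_grad Q u) x *v rep_L2 u x) \<bullet> rep_L2 v x"
    using L2_on_rep[OF weak_grad_L2_on[OF assms]] by eventually_elim (auto simp: indicator_def)
qed simp_all

end

section \<open>The damping term\<close>

text \<open>Each summand satisfies \<open>x\<^sup>r \<le> x (s + t)\<^bsup>r - 1\<^esup>\<close>.\<close>

lemma powr_add_superadditive:
  fixes s t r :: real
  assumes "0 \<le> s" "0 \<le> t" "1 \<le> r"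
  shows "s powr r + t powr r \<le> (s + t) powr r"
proof -
  have le: "x powr r \<le> x * (s + t) powr (r - 1)" if "0 \<le> x" "x \<le> s + t" for x
  proof (cases "x = 0")
    case False
    then have "x powr r = x * x powr (r - 1)"
      using powr_mult_base[of x "r - 1"] that by simp
    also have "\<dots> \<le> x * (s + t) powr (r - 1)"
      using that assms by (intro mult_left_mono powr_mono2) auto
    finally show ?thesis .
  qed simp
  have "s powr r + t powr r \<le> (s + t) * (s + t) powr (r - 1)"
    using le[of s] le[of t] assms by (simp add: distrib_right)
  also have "\<dots> = (s + t) powr r"
    using powr_mult_base[of "s + t" "r - 1"] assms by simp
  finally show ?thesis .
qed

lemma powr_midpoint_le:
  fixes A B r :: real
  assumes "0 \<le> A" "0 \<le> B" "1 \<le> r"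
  shows "((A + B) / 2) powr r \<le> (A powr r + B powr r) / 2"
proof (cases "A = 0 \<or> B = 0")
  case True
  have "(x / 2) powr r \<le> x powr r / 2" if "0 \<le> x" for x
  proof -
    have "(x / 2) powr r = x powr r * (1 / 2) powr r"
      using that powr_mult[of x "1/2" r] by simp
    also have "(1 / 2) powr r \<le> (1 / 2 :: real) powr 1"
      using assms by (intro powr_mono') auto
    finally show ?thesis by (simp add: mult_left_mono)
  qed
  then show ?thesis using True assms by auto
next
  case False
  then show ?thesis
    using convex_onD[OF powr_convex[OF assms(3)], of "1/2" A B] assms by (simp add: add_divide_distrib)
qed

text \<open>With \<open>r = q/2\<close>, superadditivity of \<open>x\<^sup>r\<close>, the parallelogram law and convexity of \<open>x\<^sup>r\<close> are used in turn.\<close>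

lemma Clarkson_inequality:
  fixes a b :: "'a::real_inner"
  assumes "2 \<le> q"
  shows "norm ((1/2) *\<^sub>R (a - b)) powr q + norm ((1/2) *\<^sub>R (a + b)) powr q \<le> (norm a powr q + norm b powr q) / 2"
proof -
  have eq: "norm y powr q = (norm y)\<^sup>2 powr (q / 2)" for y :: 'a
    by (simp add: powr_half_sqrt_powr powr_powr flip: powr_numeral) 
  have "norm ((1/2) *\<^sub>R (a - b)) powr q + norm ((1/2) *\<^sub>R (a + b)) powr q
      \<le> ((norm ((1/2) *\<^sub>R (a - b)))\<^sup>2 + (norm ((1/2) *\<^sub>R (a + b)))\<^sup>2) powr (q / 2)"
    unfolding eq using assms by (intro powr_add_superadditive) auto
  also have "(norm ((1/2) *\<^sub>R (a - b)))\<^sup>2 + (norm ((1/2) *\<^sub>R (a + b)))\<^sup>2 = ((norm a)\<^sup>2 + (norm b)\<^sup>2) / 2"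
    by (simp add: power2_norm_eq_inner inner_simps inner_commute algebra_simps)
  also have "\<dots> powr (q / 2) \<le> ((norm a)\<^sup>2 powr (q / 2) + (norm b)\<^sup>2 powr (q / 2)) / 2"
    using assms by (intro powr_midpoint_le) auto
  finally show ?thesis by (simp add: eq)
qed

lemma powr_diff_mult_le:
  fixes a b q :: real
  assumes "0 \<le> b" "b \<le> a" "1 \<le> q"
  shows "(a powr q - b powr q) * b \<le> q * a powr q * (a - b)"
proof (cases "b = 0 \<or> b = a")
  case True
  then show ?thesis using assms by auto
next
  case False
  then have b: "0 < b" "b < a" using assms by auto
  obtain z where z: "b < z" "z < a" "a powr q - b powr q = (a - b) * (q * z powr (q - 1))"
  proof -
    have "((\<lambda>x. x powr q) has_real_derivative q * x powr (q - 1)) (at x)" if "b \<le> x" for x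
      using b that by (intro has_real_derivative_powr) simp
    then have "\<exists>z. b < z \<and> z < a \<and> a powr q - b powr q = (a - b) * (q * z powr (q - 1))"
      by (intro MVT2[OF b(2)]) auto
    then show thesis using that by blast
  qed
  have "z powr (q - 1) * b \<le> a powr (q - 1) * a"
    using z b assms by (intro mult_mono powr_mono2) auto
  also have "\<dots> = a powr q"
    using powr_mult_base[of a "q - 1"] b by (simp add: mult.commute)
  finally have "(a - b) * q * (z powr (q - 1) * b) \<le> (a - b) * q * a powr q"
    using b assms by (intro mult_left_mono) auto
  then show ?thesis by (simp add: z(3) mult.commute mult.left_commute)
qed

text \<open>A globally Lipschitz substitute for \<open>y \<mapsto> \<bar>y\<bar>\<^sup>q y\<close>. Only the scalar factor is truncated, so
  \<open>truncated_power q n y \<bullet> y\<close> increases to \<open>\<bar>y\<bar>\<^bsup>q + 2\<^esup>\<close> with \<open>n\<close>.\<close>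

definition truncated_power :: "real \<Rightarrow> real \<Rightarrow> 'a::real_normed_vector \<Rightarrow> 'a" where
  "truncated_power q n y = min (norm y) n powr q *\<^sub>R y"

text \<open>If \<open>\<bar>z\<bar> \<le> \<bar>y\<bar>\<close>, the difference is a truncated scalar times \<open>y - z\<close> plus a difference of scalars times \<open>z\<close>. The
  latter vanishes if both scalars are truncated, and otherwise the mean value theorem applies.\<close>

lemma truncated_power_lipschitz:
  assumes "1 \<le> q" "0 \<le> n"
  shows "norm (truncated_power q n y - truncated_power q n z) \<le> ((q + 1) * n powr q) * norm (y - z)"
proof -
  have *: "norm (truncated_power q n y - truncated_power q n z) \<le> ((q + 1) * n powr q) * norm (y - z)"
    if yz: "norm z \<le> norm y" for y z :: 'a
  proof -
    define a b where "a = min (norm y) n" and "b = min (norm z) n"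
    have ab: "0 \<le> b" "b \<le> a" "a \<le> n" using yz assms by (auto simp: a_def b_def)
    have "truncated_power q n y - truncated_power q n z = a powr q *\<^sub>R (y - z) + (a powr q - b powr q) *\<^sub>R z"
      by (simp add: truncated_power_def a_def b_def algebra_simps)
    then have "norm (truncated_power q n y - truncated_power q n z)
        \<le> a powr q * norm (y - z) + \<bar>a powr q - b powr q\<bar> * norm z"
      using norm_triangle_ineq[of "a powr q *\<^sub>R (y - z)" "(a powr q - b powr q) *\<^sub>R z"] by simp
    also have "\<bar>a powr q - b powr q\<bar> = a powr q - b powr q"
      using powr_mono2[of q b a] ab assms by simp
    also have "(a powr q - b powr q) * norm z \<le> q * n powr q * norm (y - z)"
    proof (cases "n \<le> norm z")
      case True
      then have "a = b" using yz by (simp add: a_def b_def)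
      then show ?thesis using assms by simp
    next
      case False
      then have b: "b = norm z" by (simp add: b_def)
      have "a - b \<le> norm (y - z)"
        using norm_triangle_ineq2[of y z] by (simp add: a_def b)
      have "(a powr q - b powr q) * b \<le> q * a powr q * (a - b)"
        by (rule powr_diff_mult_le[OF ab(1,2) assms(1)])
      also have "\<dots> \<le> q * n powr q * norm (y - z)"
        using ab assms \<open>a - b \<le> norm (y - z)\<close> by (intro mult_mono powr_mono2) auto
      finally show ?thesis by (simp add: b)
    qed
    also have "a powr q * norm (y - z) \<le> n powr q * norm (y - z)"
      using ab assms by (intro mult_right_mono powr_mono2) auto
    finally show ?thesis by (simp add: algebra_simps)
  qed
  show ?thesis
    using *[of y z] *[of z y] by (cases "norm z \<le> norm y") (auto simp: norm_minus_commute)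
qed

lemma borel_measurable_truncated_power [measurable]:
  "truncated_power q n \<in> borel_measurable (borel :: 'a::euclidean_space measure)"
  unfolding truncated_power_def by measurable

lemma lipschitz_superposition_truncated_power:
  assumes "1 \<le> q" "0 \<le> n"
  shows "lipschitz_superposition (\<lambda>x::'a::euclidean_space. truncated_power q n :: 'b::euclidean_space \<Rightarrow> 'b) ((q + 1) * n powr q)"
  by unfold_locales (use truncated_power_lipschitz[OF assms] in \<open>auto simp: truncated_power_def[of _ _ 0]\<close>)

context brinkman_forchheimer
begin

abbreviation "q \<equiv> varpi - 1"

text \<open>The damping term tested with \<open>v\<close>. Fields on \<open>Q\<close> vanish elsewhere, so the integral extends over the whole space.\<close>

definition forch :: "'d vfield \<Rightarrow> 'd vfield \<Rightarrow> real" where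
  "forch u v = (LINT x|lborel. norm (rep_L2 u x) powr q * (rep_L2 u x \<bullet> rep_L2 v x))"

lemma forchheimer_form_eq_forch:
  assumes "u \<in> L2_on Q" shows "forchheimer_form Q varpi u v = forch u v"
  unfolding forchheimer_form_def forch_def set_lebesgue_integral_def
proof (rule integral_cong_AE)
  show "AE x in lborel. indicator Q x *\<^sub>R (norm (rep_L2 u x) powr q * (rep_L2 u x \<bullet> rep_L2 v x)) =
      norm (rep_L2 u x) powr q * (rep_L2 u x \<bullet> rep_L2 v x)"
    using L2_on_rep[OF assms] by eventually_elim (auto simp: indicator_def)
qed simp_all

lemma powr_q_mult:
  fixes r :: real
  assumes "0 \<le> r" shows "r powr q * r = r powr varpi" "r powr varpi * r = r powr p" "r powr q * r\<^sup>2 = r powr p"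
proof -
  show 1: "r powr q * r = r powr varpi"
    using powr_mult_base[OF assms, of q] by (simp add: mult.commute)
  show 2: "r powr varpi * r = r powr p"
    using powr_mult_base[OF assms, of varpi] by (simp add: mult.commute add.commute)
  show "r powr q * r\<^sup>2 = r powr p"
    by (simp add: power2_eq_square 1 2 flip: mult.assoc)
qed

text \<open>If \<open>\<bar>z\<bar> \<le> k \<bar>y\<bar>\<close>, replace \<open>\<bar>z\<bar>\<close> by \<open>k \<bar>y\<bar>\<close>; otherwise replace \<open>\<bar>y\<bar>\<close> by \<open>\<bar>z\<bar> / k\<close>.\<close>

lemma forch_integrand_le:
  fixes y z :: "'b::real_inner"
  assumes "0 < k"
  shows "\<bar>norm y powr q * (y \<bullet> z)\<bar> \<le> k * norm y powr p + (1 / k) powr varpi * norm z powr p"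
proof -
  have "\<bar>norm y powr q * (y \<bullet> z)\<bar> \<le> norm y powr q * (norm y * norm z)"
    by (simp add: abs_mult mult_left_mono Cauchy_Schwarz_ineq2)
  also have "\<dots> = norm y powr varpi * norm z"
    by (simp add: powr_q_mult flip: mult.assoc)
  also have "\<dots> \<le> k * norm y powr p + (1 / k) powr varpi * norm z powr p"
  proof (cases "norm z \<le> k * norm y")
    case True
    then have "norm y powr varpi * norm z \<le> norm y powr varpi * (k * norm y)"
      by (rule mult_left_mono) simp
    also have "\<dots> = k * norm y powr p"
      using powr_q_mult(2)[of "norm y"] by (simp add: mult.commute mult.left_commute)
    finally show ?thesis by (simp add: add_increasing2)
  next
    case False
    then have "norm y \<le> 1 / k * norm z" using assms by (simp add: field_simps)
    then have "norm y powr varpi * norm z \<le> (1 / k * norm z) powr varpi * norm z"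
      using varpi_ge by (intro mult_right_mono powr_mono2) auto
    also have "\<dots> = (1 / k) powr varpi * norm z powr p"
      by (simp only: powr_mult mult.assoc powr_q_mult(2)[OF norm_ge_zero])
    finally show ?thesis using assms by (simp add: add_increasing)
  qed
  finally show ?thesis .
qed

lemma forch_integrable:
  assumes "Lp_integrable p u" "Lp_integrable p v"
  shows "integrable lborel (\<lambda>x. norm (rep_L2 u x) powr q * (rep_L2 u x \<bullet> rep_L2 v x))"
proof (rule integrable_dominated)
  show "integrable lborel (\<lambda>x. 1 * norm (rep_L2 u x) powr p + (1 / 1) powr varpi * norm (rep_L2 v x) powr p)"
    using assms by (simp add: Lp_integrable_def)
  show "\<bar>norm (rep_L2 u x) powr q * (rep_L2 u x \<bullet> rep_L2 v x)\<bar>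
      \<le> 1 * norm (rep_L2 u x) powr p + (1 / 1) powr varpi * norm (rep_L2 v x) powr p" for x
    by (rule forch_integrand_le) simp
qed simp

lemma forch_bound:
  assumes u: "Lp_integrable p u" and v: "Lp_integrable p v" and k: "0 < k"
  shows "\<bar>forch u v\<bar> \<le> k * Lp_pow u + (1 / k) powr varpi * Lp_pow v"
proof -
  have int: "integrable lborel (\<lambda>x. k * norm (rep_L2 u x) powr p + (1 / k) powr varpi * norm (rep_L2 v x) powr p)"
    using u v by (simp add: Lp_integrable_def)
  have "\<bar>forch u v\<bar> \<le> (LINT x|lborel. \<bar>norm (rep_L2 u x) powr q * (rep_L2 u x \<bullet> rep_L2 v x)\<bar>)"
    unfolding forch_def by (rule integral_abs_bound)
  also have "\<dots> \<le> (LINT x|lborel. k * norm (rep_L2 u x) powr p + (1 / k) powr varpi * norm (rep_L2 v x) powr p)"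
    by (rule integral_mono[OF integrable_abs[OF forch_integrable[OF u v]] int]) (rule forch_integrand_le[OF k])
  also have "\<dots> = k * Lp_pow u + (1 / k) powr varpi * Lp_pow v"
    using u v by (simp add: Lp_pow_def Lp_integrable_def)
  finally show ?thesis .
qed

lemma forch_diff:
  assumes u: "Lp_integrable p u" and v: "Lp_integrable p v" and w: "Lp_integrable p w"
  shows "forch u (v - w) = forch u v - forch u w"
  unfolding forch_def Bochner_Integration.integral_diff[OF forch_integrable[OF u v] forch_integrable[OF u w], symmetric]
proof (rule integral_cong_AE)
  show "AE x in lborel. norm (rep_L2 u x) powr q * (rep_L2 u x \<bullet> rep_L2 (v - w) x) =
      norm (rep_L2 u x) powr q * (rep_L2 u x \<bullet> rep_L2 v x) - norm (rep_L2 u x) powr q * (rep_L2 u x \<bullet> rep_L2 w x)"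
    using rep_L2_diff[of v w] by eventually_elim (simp add: inner_diff_right right_diff_distrib)
qed simp_all

definition trunc :: "nat \<Rightarrow> 'd vfield \<Rightarrow> 'd vfield" where
  "trunc n = superposition (\<lambda>x. truncated_power q (real n))"

lemma lipschitz_superposition_trunc:
  "lipschitz_superposition (\<lambda>x::real^'d. truncated_power q (real n) :: real^'d \<Rightarrow> real^'d) ((q + 1) * real n powr q)"
  using varpi_ge by (intro lipschitz_superposition_truncated_power) auto

lemma trunc_continuous: "continuous_on UNIV (trunc n)"
  unfolding trunc_def by (rule lipschitz_superposition.continuous[OF lipschitz_superposition_trunc])

lemma trunc_inner_eq: "trunc n u \<bullet> v = (LINT x|lborel. truncated_power q (real n) (rep_L2 u x) \<bullet> rep_L2 v x)"
  unfolding trunc_def inner_L2.rep_eq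
proof (rule integral_cong_AE)
  show "AE x in lborel. rep_L2 (superposition (\<lambda>x. truncated_power q (real n)) u) x \<bullet> rep_L2 v x =
      truncated_power q (real n) (rep_L2 u x) \<bullet> rep_L2 v x"
    using lipschitz_superposition.rep[OF lipschitz_superposition_trunc, of n u] by eventually_elim simp
qed simp_all

lemma trunc_integrand_le:
  fixes y z :: "real^'d"
  shows "\<bar>truncated_power q (real n) y \<bullet> z\<bar> \<le> \<bar>norm y powr q * (y \<bullet> z)\<bar>"
  unfolding truncated_power_def using varpi_ge by (auto simp: abs_mult intro!: mult_right_mono powr_mono2)

lemma trunc_inner_tendsto:
  assumes u: "Lp_integrable p u" and v: "Lp_integrable p v"
  shows "(\<lambda>n. trunc n u \<bullet> v) \<longlonglongrightarrow> forch u v"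
  unfolding trunc_inner_eq forch_def
proof (rule integral_dominated_convergence)
  show "integrable lborel (\<lambda>x. \<bar>norm (rep_L2 u x) powr q * (rep_L2 u x \<bullet> rep_L2 v x)\<bar>)"
    by (rule integrable_abs[OF forch_integrable[OF u v]])
  show "AE x in lborel. norm (truncated_power q (real n) (rep_L2 u x) \<bullet> rep_L2 v x)
      \<le> \<bar>norm (rep_L2 u x) powr q * (rep_L2 u x \<bullet> rep_L2 v x)\<bar>" for n
    unfolding real_norm_def by (rule AE_I2) (rule trunc_integrand_le)
  show "AE x in lborel. (\<lambda>n. truncated_power q (real n) (rep_L2 u x) \<bullet> rep_L2 v x)
      \<longlonglongrightarrow> norm (rep_L2 u x) powr q * (rep_L2 u x \<bullet> rep_L2 v x)"
  proof (rule AE_I2)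
    fix x
    obtain N :: nat where N: "norm (rep_L2 u x) \<le> real N" using real_arch_simple by blast
    have "eventually (\<lambda>n. norm (rep_L2 u x) powr q * (rep_L2 u x \<bullet> rep_L2 v x) =
        truncated_power q (real n) (rep_L2 u x) \<bullet> rep_L2 v x) sequentially"
      using eventually_ge_at_top[of N]
    proof eventually_elim
      case (elim n)
      then have "min (norm (rep_L2 u x)) (real n) = norm (rep_L2 u x)" using N by simp
      then show ?case by (simp add: truncated_power_def)
    qed
    then show "(\<lambda>n. truncated_power q (real n) (rep_L2 u x) \<bullet> rep_L2 v x)
      \<longlonglongrightarrow> norm (rep_L2 u x) powr q * (rep_L2 u x \<bullet> rep_L2 v x)"
      by (rule Lim_transform_eventually[OF tendsto_const])
  qed
qed simp_all

lemma forch_self: "forch u u = Lp_pow u"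
  unfolding forch_def Lp_pow_def
  by (simp add: powr_q_mult flip: power2_norm_eq_inner)

lemma trunc_self_le:
  assumes u: "Lp_integrable p u" shows "trunc n u \<bullet> u \<le> Lp_pow u"
  unfolding trunc_inner_eq forch_self[symmetric] forch_def
proof (rule integral_mono)
  show "integrable lborel (\<lambda>x. truncated_power q (real n) (rep_L2 u x) \<bullet> rep_L2 u x)"
    by (rule integrable_dominated[OF integrable_abs[OF forch_integrable[OF u u]]])
       (simp, rule trunc_integrand_le)
  show "integrable lborel (\<lambda>x. norm (rep_L2 u x) powr q * (rep_L2 u x \<bullet> rep_L2 u x))"
    by (rule forch_integrable[OF u u])
  fix x
  have "0 \<le> norm (rep_L2 u x) powr q * (rep_L2 u x \<bullet> rep_L2 u x)" by simp
  then show "truncated_power q (real n) (rep_L2 u x) \<bullet> rep_L2 u x \<le> norm (rep_L2 u x) powr q * (rep_L2 u x \<bullet> rep_L2 u x)"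
    using trunc_integrand_le[of n "rep_L2 u x" "rep_L2 u x"] by linarith
qed

section \<open>The energy functional\<close>

text \<open>The energy bounds all forms in the equation, in the test function as well as in the solution.\<close>

definition energy :: "'d vfield \<Rightarrow> real" where
  "energy u = (norm u)\<^sup>2 + dirichlet u + Lp_pow u"

lemma energy_nonneg: "0 \<le> energy u"
  by (simp add: energy_def dirichlet_nonneg Lp_pow_nonneg)

lemma energy_ge: "(norm u)\<^sup>2 \<le> energy u" "dirichlet u \<le> energy u" "Lp_pow u \<le> energy u"
  by (simp_all add: energy_def dirichlet_nonneg Lp_pow_nonneg)

text \<open>The weak form of \<open>- \<Delta>\<phi>\<close> for a test field \<open>\<phi>\<close>.\<close>

definition minus_lap :: "'d vfield \<Rightarrow> 'd vfield" where
  "minus_lap \<phi> = (SOME l. \<forall>u\<in>H1 Q. weak_grad Q u \<bullet> weak_grad Q \<phi> = u \<bullet> l)"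

lemma weak_grad_inner_minus_lap: "\<phi> \<in> S \<Longrightarrow> u \<in> H1 Q \<Longrightarrow> weak_grad Q u \<bullet> weak_grad Q \<phi> = u \<bullet> minus_lap \<phi>"
  unfolding minus_lap_def using someI_ex[OF weak_grad_inner_S] by blast

text \<open>The Dirichlet part comes from \<open>\<parallel>\<nabla>u - \<nabla>\<phi>\<parallel>\<^sup>2 \<ge> 0\<close>, that is
  \<open>\<parallel>\<nabla>u\<parallel>\<^sup>2 \<ge> 2 (\<nabla>u, \<nabla>\<phi>) - \<parallel>\<nabla>\<phi>\<parallel>\<^sup>2\<close>, where \<open>(\<nabla>u, \<nabla>\<phi>)\<close> has been
  integrated by parts; equality is approached as \<open>\<phi>\<close> tends to \<open>u\<close> in \<open>V\<close>. The last summand is a truncated integral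
  of \<open>\<bar>u\<bar>\<^sup>p\<close>.\<close>

definition energy_minorant :: "'d vfield \<Rightarrow> nat \<Rightarrow> 'd vfield \<Rightarrow> real" where
  "energy_minorant \<phi> n u = (norm u)\<^sup>2 + (2 * (u \<bullet> minus_lap \<phi>) - dirichlet \<phi>) + trunc n u \<bullet> u"

text \<open>The energy extended to the whole of \<open>L\<^sup>2\<close>, with infinity as a possible value. As a supremum
  of continuous functions it is lower semicontinuous, and hence Borel measurable.\<close>

definition lsc_energy :: "'d vfield \<Rightarrow> ennreal" where
  "lsc_energy u = (SUP k\<in>S \<times> UNIV. ennreal (energy_minorant (fst k) (snd k) u))"

lemma continuous_energy_minorant: "continuous_on UNIV (energy_minorant \<phi> n)"
  unfolding energy_minorant_def
  by (intro continuous_intros trunc_continuous)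

lemma open_lsc_energy_greater: "open {u. c < lsc_energy u}"
proof -
  have "{u. c < lsc_energy u} = (\<Union>k\<in>S \<times> UNIV. {u. c < ennreal (energy_minorant (fst k) (snd k) u)})"
    unfolding lsc_energy_def less_SUP_iff by blast
  also have "open \<dots>"
    by (intro open_UN ballI open_Collect_less continuous_on_const continuous_on_ennreal continuous_energy_minorant)
  finally show ?thesis .
qed

lemma lsc_energy_borel_measurable [measurable]: "lsc_energy \<in> borel_measurable borel"
  by (rule borel_measurableI_greater) (use open_lsc_energy_greater in auto)

text \<open>The Dirichlet part is reached along test fields that approximate \<open>u\<close> in \<open>V\<close>, the damping part as the truncation is
  removed; both limits are taken along the same index.\<close>

lemma lsc_energy_eq_energy:
  assumes u: "u \<in> X" shows "lsc_energy u = ennreal (energy u)"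
proof (rule antisym)
  show "lsc_energy u \<le> ennreal (energy u)"
    unfolding lsc_energy_def
  proof (rule SUP_least)
    fix k :: "'d vfield \<times> nat" assume "k \<in> S \<times> UNIV"
    then have S: "fst k \<in> S" by auto
    have "0 \<le> (norm (weak_grad Q u - weak_grad Q (fst k)))\<^sup>2" by simp
    then have "2 * (u \<bullet> minus_lap (fst k)) - dirichlet (fst k) \<le> dirichlet u"
      unfolding weak_grad_inner_minus_lap[OF S X_H1[OF u], symmetric] dirichlet_def
      by (simp add: power2_norm_eq_inner inner_simps inner_commute)
    then show "ennreal (energy_minorant (fst k) (snd k) u) \<le> ennreal (energy u)"
      using trunc_self_le[OF X_integrable[OF u], of "snd k"] unfolding energy_minorant_def energy_def
      by (intro ennreal_leI) simp
  qed
  obtain \<phi> where \<phi>: "\<And>n. \<phi> n \<in> S" "\<phi> \<longlonglongrightarrow> u" "(\<lambda>n. weak_grad Q (\<phi> n)) \<longlonglongrightarrow> weak_grad Q u"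
    using V_approx[OF X_V[OF u]] by blast
  have "(\<lambda>n. (norm u)\<^sup>2 + (2 * (weak_grad Q u \<bullet> weak_grad Q (\<phi> n)) - (norm (weak_grad Q (\<phi> n)))\<^sup>2) + trunc n u \<bullet> u)
      \<longlonglongrightarrow> (norm u)\<^sup>2 + (2 * (weak_grad Q u \<bullet> weak_grad Q u) - (norm (weak_grad Q u))\<^sup>2) + forch u u"
    by (intro tendsto_intros \<phi>(3) trunc_inner_tendsto X_integrable u)
  then have "(\<lambda>n. energy_minorant (\<phi> n) n u) \<longlonglongrightarrow> energy u"
    unfolding energy_minorant_def weak_grad_inner_minus_lap[OF \<phi>(1) X_H1[OF u], symmetric] energy_def dirichlet_def forch_self
    by (simp add: power2_norm_eq_inner)
  then have "(\<lambda>n. ennreal (energy_minorant (\<phi> n) n u)) \<longlonglongrightarrow> ennreal (energy u)"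
    by (rule tendsto_ennrealI)
  then show "ennreal (energy u) \<le> lsc_energy u"
    by (rule LIMSEQ_le_const2) (use \<phi>(1) in \<open>auto simp: lsc_energy_def intro!: exI[of _ 0] SUP_upper2[of "(\<phi> _, _)"]\<close>)
qed

lemma Lp_pow_Clarkson:
  assumes a: "Lp_integrable p a" and b: "Lp_integrable p b"
  shows "Lp_pow ((1/2) *\<^sub>R (a - b)) + Lp_pow ((1/2) *\<^sub>R (a + b)) \<le> (Lp_pow a + Lp_pow b) / 2"
proof -
  note int = Lp_integrable_scaleR[OF Lp_integrable_diff[OF a b], of "1/2", unfolded Lp_integrable_def]
    Lp_integrable_scaleR[OF Lp_integrable_add[OF a b], of "1/2", unfolded Lp_integrable_def]
    a[unfolded Lp_integrable_def] b[unfolded Lp_integrable_def]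
  have "Lp_pow ((1/2) *\<^sub>R (a - b)) + Lp_pow ((1/2) *\<^sub>R (a + b)) =
      (LINT x|lborel. norm (rep_L2 ((1/2) *\<^sub>R (a - b)) x) powr p + norm (rep_L2 ((1/2) *\<^sub>R (a + b)) x) powr p)"
    using int by (simp add: Lp_pow_def)
  also have "\<dots> \<le> (LINT x|lborel. (norm (rep_L2 a x) powr p + norm (rep_L2 b x) powr p) / 2)"
  proof (rule integral_mono_AE)
    show "AE x in lborel. norm (rep_L2 ((1/2) *\<^sub>R (a - b)) x) powr p + norm (rep_L2 ((1/2) *\<^sub>R (a + b)) x) powr p
        \<le> (norm (rep_L2 a x) powr p + norm (rep_L2 b x) powr p) / 2"
      using rep_L2_diff[of a b] rep_L2_add[of a b] rep_L2_scaleR[of "1/2" "a - b"] rep_L2_scaleR[of "1/2" "a + b"]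
    proof eventually_elim
      case (elim x)
      then show ?case
        using Clarkson_inequality[of p "rep_L2 a x" "rep_L2 b x"] p_ge by (simp only: elim)
    qed
  qed (use int in auto)
  also have "\<dots> = (Lp_pow a + Lp_pow b) / 2"
    using int by (simp add: Lp_pow_def)
  finally show ?thesis .
qed

lemma energy_Clarkson:
  assumes a: "a \<in> X" and b: "b \<in> X"
  shows "energy ((1/2) *\<^sub>R (a - b)) + energy ((1/2) *\<^sub>R (a + b)) \<le> (energy a + energy b) / 2"
proof -
  have par: "(norm ((1/2) *\<^sub>R (x - y)))\<^sup>2 + (norm ((1/2) *\<^sub>R (x + y)))\<^sup>2 = ((norm x)\<^sup>2 + (norm y)\<^sup>2) / 2"
    for x y :: "'x::real_inner"
    by (simp add: power2_norm_eq_inner inner_simps inner_commute algebra_simps)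
  have "dirichlet ((1/2) *\<^sub>R (a - b)) + dirichlet ((1/2) *\<^sub>R (a + b)) = (dirichlet a + dirichlet b) / 2"
    unfolding dirichlet_def weak_grad_scaleR[OF H1_diff[OF X_H1[OF a] X_H1[OF b]]]
      weak_grad_scaleR[OF H1_add[OF X_H1[OF a] X_H1[OF b]]]
      weak_grad_diff[OF X_H1[OF a] X_H1[OF b]] weak_grad_add[OF X_H1[OF a] X_H1[OF b]]
    by (rule par)
  then show ?thesis
    using Lp_pow_Clarkson[OF X_integrable[OF a] X_integrable[OF b]] par[of a b]
    by (simp add: energy_def)
qed

text \<open>Clarkson's inequality speaks about half differences; this returns to the differences themselves.\<close>

lemma energy_le_half:
  assumes u: "u \<in> X" shows "energy u \<le> 2 powr p * energy ((1/2) *\<^sub>R u)"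
proof -
  have "(2::real) powr 2 \<le> 2 powr p" using p_ge by (intro powr_mono) auto
  then have 4: "(4::real) \<le> 2 powr p" by simp
  have "4 * ((norm ((1/2) *\<^sub>R u))\<^sup>2 + dirichlet ((1/2) *\<^sub>R u)) = (norm u)\<^sup>2 + dirichlet u"
    by (simp add: dirichlet_def weak_grad_scaleR[OF X_H1[OF u]] power2_eq_square)
  moreover have "4 * ((norm ((1/2) *\<^sub>R u))\<^sup>2 + dirichlet ((1/2) *\<^sub>R u)) \<le> 2 powr p * ((norm ((1/2) *\<^sub>R u))\<^sup>2 + dirichlet ((1/2) *\<^sub>R u))"
    using 4 dirichlet_nonneg by (intro mult_right_mono) auto
  moreover have "2 powr p * Lp_pow ((1/2) *\<^sub>R u) = Lp_pow u"
    using p_ge by (simp add: Lp_pow_scaleR[OF X_integrable[OF u]] powr_divide)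
  ultimately show ?thesis
    by (simp add: energy_def distrib_left)
qed

end

section \<open>Riesz representation and the Helmholtz projection\<close>

text \<open>A minimizing sequence of the quadratic functional \<open>\<parallel>T x\<parallel>\<^sup>2 - 2 l(x)\<close>. Variations in direction \<open>x\<close> show that
  \<open>\<bar>T(z\<^sub>n) \<bullet> T(x) - l(x)\<bar>\<close> is at most \<open>\<surd>e\<^sub>n \<parallel>T(x)\<parallel>\<close>, where \<open>e\<^sub>n\<close> is the distance to the infimum.
  Applied to \<open>x = z\<^sub>n - z\<^sub>k\<close> this yields the Cauchy property, so in a complete space the limit of
  \<open>T(z\<^sub>n)\<close> represents \<open>l\<close>.\<close>

lemma approximate_Riesz_representation:
  fixes T :: "'a::real_vector \<Rightarrow> 'b::real_inner" and l :: "'a \<Rightarrow> real"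
  assumes S: "V \<noteq> {}" "\<And>x y. x \<in> V \<Longrightarrow> y \<in> V \<Longrightarrow> x + y \<in> V" "\<And>c x. x \<in> V \<Longrightarrow> c *\<^sub>R x \<in> V"
    and T: "\<And>x y. x \<in> V \<Longrightarrow> y \<in> V \<Longrightarrow> T (x + y) = T x + T y" "\<And>c x. x \<in> V \<Longrightarrow> T (c *\<^sub>R x) = c *\<^sub>R T x"
    and l: "\<And>x y. x \<in> V \<Longrightarrow> y \<in> V \<Longrightarrow> l (x + y) = l x + l y" "\<And>c x. x \<in> V \<Longrightarrow> l (c *\<^sub>R x) = c * l x"
    and bound: "\<And>x. x \<in> V \<Longrightarrow> \<bar>l x\<bar> \<le> K * norm (T x)"
  obtains z where "\<And>n::nat. z n \<in> V" "Cauchy (\<lambda>n. T (z n))" "\<And>x. x \<in> V \<Longrightarrow> (\<lambda>n. T (z n) \<bullet> T x) \<longlonglongrightarrow> l x"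
proof -
  define E where "E x = (norm (T x))\<^sup>2 - 2 * l x" for x
  have E_ge: "- K\<^sup>2 \<le> E x" if "x \<in> V" for x
  proof -
    have "0 \<le> (norm (T x) - K)\<^sup>2" by simp
    then have "2 * (K * norm (T x)) \<le> (norm (T x))\<^sup>2 + K\<^sup>2" by (simp add: power2_diff mult.commute)
    moreover have "l x \<le> K * norm (T x)" using bound[OF that] by simp
    ultimately show ?thesis by (simp add: E_def)
  qed
  define m where "m = Inf (E ` V)"
  have bdd: "bdd_below (E ` V)" using E_ge by (auto intro!: bdd_belowI2)
  have m_le: "m \<le> E x" if "x \<in> V" for x unfolding m_def by (rule cINF_lower[OF bdd that])
  have "\<exists>x\<in>V. E x < m + 1 / real (Suc n)" for n
    using cINF_less_iff[OF S(1) bdd, of "m + 1 / real (Suc n)"] by (simp add: m_def)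
  then obtain z where z: "\<And>n. z n \<in> V" "\<And>n. E (z n) < m + 1 / real (Suc n)"
    by metis
  define e where "e n = E (z n) - m" for n
  have e: "0 \<le> e n" "e n \<le> 1 / real (Suc n)" for n
    using m_le[OF z(1)[of n]] z(2)[of n] by (auto simp: e_def)
  have e_lim: "(\<lambda>n. sqrt (e n)) \<longlonglongrightarrow> 0"
  proof -
    have "e \<longlonglongrightarrow> 0"
      by (rule Lim_null_comparison[OF always_eventually LIMSEQ_Suc[OF lim_1_over_n]]) (use e in simp)
    then show ?thesis using tendsto_real_sqrt by fastforce
  qed
  have key: "\<bar>T (z n) \<bullet> T x - l x\<bar> \<le> sqrt (e n) * norm (T x)" if x: "x \<in> V" for n x
  proof (cases "T x = 0")
    case True
    then show ?thesis using bound[OF x] by simp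
  next
    case False
    define D where "D = T (z n) \<bullet> T x - l x"
    define N where "N = (norm (T x))\<^sup>2"
    have N: "0 < N" using False by (simp add: N_def)
    have zx: "z n + t *\<^sub>R x \<in> V" for t using z x S by blast
    have expand: "(norm (a + t *\<^sub>R b))\<^sup>2 = (norm a)\<^sup>2 + 2 * t * (a \<bullet> b) + t\<^sup>2 * (norm b)\<^sup>2" for t and a b :: 'b
      unfolding power2_norm_eq_inner inner_add_left inner_add_right inner_scaleR_left inner_scaleR_right
      by (simp add: inner_commute power2_eq_square algebra_simps)
    have E_t: "E (z n + t *\<^sub>R x) = E (z n) + 2 * t * D + t\<^sup>2 * N" for t
      unfolding E_def D_def N_def T(1)[OF z(1) S(3)[OF x]] T(2)[OF x] l(1)[OF z(1) S(3)[OF x]] l(2)[OF x] expand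
      by (simp add: algebra_simps)
    \<comment> \<open>The step \<open>- D / N\<close> minimizes the quadratic polynomial in \<open>t\<close>.\<close>
    have "m \<le> E (z n + (- D / N) *\<^sub>R x)" by (rule m_le[OF zx])
    also have "\<dots> = E (z n) + 2 * (- D / N) * D + (- D / N)\<^sup>2 * N"
      by (rule E_t)
    also have "\<dots> = E (z n) - D\<^sup>2 / N"
      using N by (simp add: power2_eq_square field_simps)
    finally have "D\<^sup>2 \<le> e n * N"
      using N by (simp add: e_def field_simps)
    then have "sqrt (D\<^sup>2) \<le> sqrt (e n * N)" by (rule real_sqrt_le_mono)
    then show ?thesis by (simp add: real_sqrt_mult N_def D_def)
  qed
  show thesis
  proof (rule that[OF z(1)])
    show "(\<lambda>n. T (z n) \<bullet> T x) \<longlonglongrightarrow> l x" if x: "x \<in> V" for x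
    proof -
      have lim0: "(\<lambda>n. sqrt (e n) * norm (T x)) \<longlonglongrightarrow> 0"
        using tendsto_mult_left_zero[OF e_lim] .
      have "(\<lambda>n. T (z n) \<bullet> T x - l x) \<longlonglongrightarrow> 0"
        by (rule Lim_null_comparison[OF always_eventually lim0]) (use key[OF x] in simp)
      then show ?thesis by (simp add: LIM_zero_iff)
    qed
    have diff: "norm (T (z n) - T (z k)) \<le> sqrt (e n) + sqrt (e k)" for n k
    proof -
      define x where "x = z n + (-1) *\<^sub>R z k"
      have x: "x \<in> V" unfolding x_def using z S by blast
      have Tx: "T x = T (z n) - T (z k)"
        unfolding x_def T(1)[OF z(1) S(3)[OF z(1)]] T(2)[OF z(1)] by simp
      have "norm (T x) * norm (T x) = (T (z n) \<bullet> T x - l x) - (T (z k) \<bullet> T x - l x)"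
        by (simp add: Tx inner_diff_left power2_norm_eq_inner flip: power2_eq_square)
      also have "\<dots> \<le> (sqrt (e n) + sqrt (e k)) * norm (T x)"
        using key[OF x, of n] key[OF x, of k] by (simp add: distrib_right)
      finally have "norm (T x) \<le> sqrt (e n) + sqrt (e k)"
      proof (cases "T x = 0")
        case True
        then show ?thesis using e[of n] e[of k] by simp
      qed (simp add: mult_right_le_imp_le)
      then show ?thesis by (simp add: Tx)
    qed
    show "Cauchy (\<lambda>n. T (z n))"
    proof (rule metric_CauchyI)
      fix r :: real assume "0 < r"
      then have "eventually (\<lambda>n. sqrt (e n) < r / 2) sequentially"
        by (intro order_tendstoD(2)[OF e_lim]) simp
      then obtain M where M: "\<And>n. n \<ge> M \<Longrightarrow> sqrt (e n) < r / 2" by (auto simp: eventually_sequentially)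
      show "\<exists>M. \<forall>m\<ge>M. \<forall>n\<ge>M. dist (T (z m)) (T (z n)) < r"
      proof (intro exI[of _ M] allI impI)
        fix i j assume "M \<le> i" "M \<le> j"
        then show "dist (T (z i)) (T (z j)) < r"
          using M[of i] M[of j] diff[of i j] by (simp add: dist_norm)
      qed
    qed
  qed
qed

context bounded_open_set
begin

lemma norm_integral_le:
  assumes u: "u \<in> L2_on Q" and k: "0 < k"
  shows "integrable lborel (rep_L2 u)"
    and "(LINT x|lborel. norm (rep_L2 u x)) \<le> k * measure lborel Q + 1 / k * (norm u)\<^sup>2"
proof -
  have fin: "emeasure lborel Q < \<infinity>" by (rule emeasure_bounded_finite[OF bounded_Q])
  have int: "integrable lborel (\<lambda>x. k * indicator Q x + 1 / k * (norm (rep_L2 u x))\<^sup>2)"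
    using fin integrable_norm_sq_L2[of u] by auto
  have le: "AE x in lborel. norm (rep_L2 u x) \<le> k * indicator Q x + 1 / k * (norm (rep_L2 u x))\<^sup>2"
    using L2_on_rep[OF u]
  proof eventually_elim
    case (elim x)
    define r where "r = norm (rep_L2 u x)"
    have "0 \<le> (k - r)\<^sup>2" "0 \<le> k * r" using k by (auto simp: r_def)
    moreover have "(k - r)\<^sup>2 = k * k + r * r - 2 * (k * r)" by (simp add: power2_eq_square algebra_simps)
    ultimately have "k * r \<le> k * k + r * r" by linarith
    then have "norm (rep_L2 u x) \<le> k + 1 / k * (norm (rep_L2 u x))\<^sup>2"
      using k unfolding r_def[symmetric] by (simp add: power2_eq_square field_simps)
    then show ?case using elim by (cases "x \<in> Q") auto
  qed
  have "AE x in lborel. norm (rep_L2 u x) \<le> norm (k * indicator Q x + 1 / k * (norm (rep_L2 u x))\<^sup>2)"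
    using le by eventually_elim (simp add: order_trans[OF _ abs_ge_self])
  then show *: "integrable lborel (rep_L2 u)"
    by (rule Bochner_Integration.integrable_bound[OF int, rotated]) measurable
  have "(LINT x|lborel. norm (rep_L2 u x)) \<le> (LINT x|lborel. k * indicator Q x + 1 / k * (norm (rep_L2 u x))\<^sup>2)"
    by (rule integral_mono_AE[OF integrable_norm[OF *] int le])
  also have "\<dots> = k * measure lborel Q + 1 / k * (norm u)\<^sup>2"
    using fin integrable_norm_sq_L2[of u] by (simp add: norm_L2_sq)
  finally show "(LINT x|lborel. norm (rep_L2 u x)) \<le> k * measure lborel Q + 1 / k * (norm u)\<^sup>2" .
qed

text \<open>On the bounded set \<open>Q\<close> a Cauchy sequence in \<open>L\<^sup>2\<close> is one in \<open>L\<^sup>1\<close>, so a subsequence converges almost everywhere.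
  Fatou's lemma identifies the pointwise limit as the limit in \<open>L\<^sup>2\<close>.\<close>

lemma L2_on_complete:
  fixes u :: "nat \<Rightarrow> (real^'d, 'b::euclidean_space) L2"
  assumes u: "\<And>n. u n \<in> L2_on Q" and C: "Cauchy u"
  shows "convergent u"
proof -
  have "\<exists>N. \<forall>i\<ge>N. \<forall>j\<ge>N. (LINT x|lborel. norm (rep_L2 (u i) x - rep_L2 (u j) x)) < e" if e: "0 < e" for e
  proof -
    define m where "m = measure lborel Q"
    define k where "k = e / (2 * (m + 1))"
    have m: "0 \<le> m" by (simp add: m_def)
    have k: "0 < k" "k * m \<le> e / 2" using e m by (auto simp: k_def field_simps)
    \<comment> \<open>With \<open>\<parallel>u\<^sub>i - u\<^sub>j\<parallel> < r\<close> the bound \<open>k m + r\<^sup>2 / k\<close> on the \<open>L\<^sup>1\<close> distance is at most \<open>e\<close>.\<close>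
    define r where "r = sqrt (k * e / 2)"
    have r: "0 < r" "r\<^sup>2 = k * e / 2" using e k by (auto simp: r_def)
    obtain N where N: "\<And>i j. i \<ge> N \<Longrightarrow> j \<ge> N \<Longrightarrow> norm (u i - u j) < r"
      using C r(1) unfolding Cauchy_def dist_norm by blast
    show ?thesis
    proof (intro exI[of _ N] allI impI)
      fix i j assume "N \<le> i" "N \<le> j"
      then have "(norm (u i - u j))\<^sup>2 < k * e / 2"
        using N[of i j] r power_strict_mono[of "norm (u i - u j)" r 2] by simp
      then have "1 / k * (norm (u i - u j))\<^sup>2 < e / 2" using k by (simp add: field_simps)
      moreover have "(LINT x|lborel. norm (rep_L2 (u i) x - rep_L2 (u j) x)) = (LINT x|lborel. norm (rep_L2 (u i - u j) x))"
        by (rule integral_cong_AE) (use rep_L2_diff[of "u i" "u j"] in \<open>auto elim!: eventually_mono\<close>)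
      ultimately show "(LINT x|lborel. norm (rep_L2 (u i) x - rep_L2 (u j) x)) < e"
        using norm_integral_le(2)[OF L2_on_diff[OF u[of i] u[of j]] k(1)] k(2) unfolding m_def by linarith
    qed
  qed
  then obtain r where r: "strict_mono r" "AE x in lborel. Cauchy (\<lambda>i. rep_L2 (u (r i)) x)"
    by (rule cauchy_L1_AE_cauchy_subseq[of lborel "\<lambda>n. rep_L2 (u n)", OF norm_integral_le(1)[OF u zero_less_one]])
  define f where "f x = lim (\<lambda>i. rep_L2 (u (r i)) x)" for x
  have [measurable]: "f \<in> borel_measurable borel"
    unfolding f_def by (rule borel_measurable_lim_metric) measurable
  have lim: "AE x in lborel. (\<lambda>i. rep_L2 (u (r i)) x) \<longlonglongrightarrow> f x"
    using r(2) by eventually_elim (simp add: f_def Cauchy_convergent_iff convergent_LIMSEQ_iff)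
  have Fatou: "(\<integral>\<^sup>+x. ennreal ((norm (f x - rep_L2 (u n) x))\<^sup>2) \<partial>lborel) \<le> ennreal (e\<^sup>2)"
    if N: "\<And>i j. i \<ge> N \<Longrightarrow> j \<ge> N \<Longrightarrow> norm (u i - u j) < e" and n: "N \<le> n" for N n e
  proof -
    have "(\<integral>\<^sup>+x. ennreal ((norm (f x - rep_L2 (u n) x))\<^sup>2) \<partial>lborel)
        \<le> (\<integral>\<^sup>+x. liminf (\<lambda>i. ennreal ((norm (rep_L2 (u (r i)) x - rep_L2 (u n) x))\<^sup>2)) \<partial>lborel)"
    proof (rule nn_integral_mono_AE)
      show "AE x in lborel. ennreal ((norm (f x - rep_L2 (u n) x))\<^sup>2)
          \<le> liminf (\<lambda>i. ennreal ((norm (rep_L2 (u (r i)) x - rep_L2 (u n) x))\<^sup>2))"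
        using lim
      proof eventually_elim
        case (elim x)
        have "(\<lambda>i. ennreal ((norm (rep_L2 (u (r i)) x - rep_L2 (u n) x))\<^sup>2)) \<longlonglongrightarrow> ennreal ((norm (f x - rep_L2 (u n) x))\<^sup>2)"
          by (intro tendsto_ennrealI tendsto_intros elim)
        then show ?case by (subst lim_imp_Liminf) auto
      qed
    qed
    also have "\<dots> \<le> liminf (\<lambda>i. \<integral>\<^sup>+x. ennreal ((norm (rep_L2 (u (r i)) x - rep_L2 (u n) x))\<^sup>2) \<partial>lborel)"
      by (rule nn_integral_liminf) measurable
    also have "\<dots> \<le> liminf (\<lambda>i::nat. ennreal (e\<^sup>2))"
    proof (rule Liminf_mono)
      show "eventually (\<lambda>i. (\<integral>\<^sup>+x. ennreal ((norm (rep_L2 (u (r i)) x - rep_L2 (u n) x))\<^sup>2) \<partial>lborel) \<le> ennreal (e\<^sup>2)) sequentially"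
        using eventually_ge_at_top[of N]
      proof eventually_elim
        case (elim i)
        then have "norm (u (r i) - u n) < e"
          using seq_suble[OF r(1), of i] n by (intro N) auto
        then have "(norm (u (r i) - u n))\<^sup>2 \<le> e\<^sup>2" by (intro power_mono) auto
        moreover have "(\<integral>\<^sup>+x. ennreal ((norm (rep_L2 (u (r i)) x - rep_L2 (u n) x))\<^sup>2) \<partial>lborel) =
            (\<integral>\<^sup>+x. ennreal ((norm (rep_L2 (u (r i) - u n) x))\<^sup>2) \<partial>lborel)"
          by (rule nn_integral_cong_AE) (use rep_L2_diff[of "u (r i)" "u n"] in \<open>auto elim!: eventually_mono\<close>)
        moreover have "\<dots> = ennreal ((norm (u (r i) - u n))\<^sup>2)"
          unfolding norm_L2_sq by (rule nn_integral_eq_integral[OF integrable_norm_sq_L2]) simp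
        ultimately show ?case by (simp add: ennreal_leI)
      qed
    qed
    finally show ?thesis by (simp add: Liminf_const)
  qed
  have sq: "square_integrable f"
  proof -
    obtain N where N: "\<And>i j. i \<ge> N \<Longrightarrow> j \<ge> N \<Longrightarrow> norm (u i - u j) < 1"
      using C unfolding Cauchy_def dist_norm by (metis zero_less_one)
    have "square_integrable (\<lambda>x. f x - rep_L2 (u N) x)"
      unfolding square_integrable_def
    proof
      show "integrable lborel (\<lambda>x. (norm (f x - rep_L2 (u N) x))\<^sup>2)"
      proof (rule integrableI_bounded)
        have "(\<integral>\<^sup>+x. ennreal ((norm (f x - rep_L2 (u N) x))\<^sup>2) \<partial>lborel) < \<infinity>"
          using le_less_trans[OF Fatou[OF N order_refl] ennreal_less_top] by simp
        then show "(\<integral>\<^sup>+x. ennreal (norm ((norm (f x - rep_L2 (u N) x))\<^sup>2)) \<partial>lborel) < \<infinity>"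
          by simp
      qed measurable
    qed simp
    then show ?thesis
      using square_integrable_add[OF _ square_integrable_rep[of "u N"], of "\<lambda>x. f x - rep_L2 (u N) x"] by simp
  qed
  have "u \<longlonglongrightarrow> abs_L2 f"
  proof (rule LIMSEQ_I)
    fix e :: real assume e: "0 < e"
    then obtain N where N: "\<And>i j. i \<ge> N \<Longrightarrow> j \<ge> N \<Longrightarrow> norm (u i - u j) < e / 2"
      using C unfolding Cauchy_def dist_norm by (metis half_gt_zero)
    show "\<exists>no. \<forall>n\<ge>no. norm (u n - abs_L2 f) < e"
    proof (intro exI[of _ N] allI impI)
      fix n assume n: "N \<le> n"
      have "ennreal ((norm (abs_L2 f - u n))\<^sup>2) = (\<integral>\<^sup>+x. ennreal ((norm (rep_L2 (abs_L2 f - u n) x))\<^sup>2) \<partial>lborel)"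
        unfolding norm_L2_sq by (rule nn_integral_eq_integral[OF integrable_norm_sq_L2, symmetric]) simp
      also have "\<dots> = (\<integral>\<^sup>+x. ennreal ((norm (f x - rep_L2 (u n) x))\<^sup>2) \<partial>lborel)"
      proof (rule nn_integral_cong_AE)
        show "AE x in lborel. ennreal ((norm (rep_L2 (abs_L2 f - u n) x))\<^sup>2) = ennreal ((norm (f x - rep_L2 (u n) x))\<^sup>2)"
          using rep_L2_diff[of "abs_L2 f" "u n"] rep_abs_L2[OF sq] by eventually_elim simp
      qed
      also have "\<dots> \<le> ennreal ((e / 2)\<^sup>2)" by (rule Fatou[OF N n])
      finally have "(norm (abs_L2 f - u n))\<^sup>2 \<le> (e / 2)\<^sup>2"
        by (subst (asm) ennreal_le_iff) auto
      then have "norm (abs_L2 f - u n) \<le> e / 2"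
        by (rule power2_le_imp_le) (use e in simp)
      then show "norm (u n - abs_L2 f) < e"
        using e by (simp add: norm_minus_commute)
    qed
  qed
  then show ?thesis by (rule convergentI)
qed

lemma inner_H_space_eqI:
  assumes "\<And>\<phi>. \<phi> \<in> S \<Longrightarrow> a \<bullet> \<phi> = 0" "w \<in> H_space Q"
  shows "a \<bullet> w = 0"
proof -
  have "closed {w. a \<bullet> w = 0}"
    by (intro closed_Collect_eq continuous_intros)
  then have "closure S \<subseteq> {w. a \<bullet> w = 0}"
    using assms(1) by (intro closure_minimal) auto
  then show ?thesis using assms(2) by (auto simp: H_space_def)
qed

lemma S_L2_on: "\<phi> \<in> S \<Longrightarrow> \<phi> \<in> L2_on Q"
  by (intro H1_L2_on S_H1)

text \<open>The projection exists by Riesz representation of \<open>x \<mapsto> g \<bullet> x\<close> and completeness. It is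
  self-adjoint and fixes \<open>w\<close>, so it can be dropped when testing with \<open>w\<close>.\<close>

lemma helmholtz_inner:
  assumes w: "w \<in> H_space Q" shows "helmholtz Q g \<bullet> w = g \<bullet> w"
proof -
  obtain z where z: "\<And>n::nat. z n \<in> S" "Cauchy (\<lambda>n. z n)" "\<And>x. x \<in> S \<Longrightarrow> (\<lambda>n. z n \<bullet> x) \<longlonglongrightarrow> g \<bullet> x"
    using approximate_Riesz_representation[of S "\<lambda>x. x" "\<lambda>x. g \<bullet> x" "norm g"]
      S_zero S_add S_scaleR Cauchy_Schwarz_ineq2[of g]
    by (auto simp: inner_add_right)
  obtain h where h: "z \<longlonglongrightarrow> h"
    using L2_on_complete[of z, OF S_L2_on[OF z(1)] z(2)] unfolding convergent_def by blast
  have hH: "h \<in> H_space Q"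
    unfolding H_space_def closure_sequential using z(1) h by blast
  have hw: "(g - h) \<bullet> w = 0" if "w \<in> H_space Q" for w
  proof (rule inner_H_space_eqI[OF _ that])
    fix \<phi> assume "\<phi> \<in> S"
    have "(\<lambda>n. z n \<bullet> \<phi>) \<longlonglongrightarrow> h \<bullet> \<phi>" by (intro tendsto_intros h)
    then have "g \<bullet> \<phi> = h \<bullet> \<phi>" using LIMSEQ_unique[OF z(3)[OF \<open>\<phi> \<in> S\<close>]] by blast
    then show "(g - h) \<bullet> \<phi> = 0" by (simp add: inner_diff_left)
  qed
  have "helmholtz Q g = h"
    unfolding helmholtz_def
  proof (rule the_equality)
    fix h' assume h': "h' \<in> H_space Q \<and> (\<forall>w\<in>H_space Q. (g - h') \<bullet> w = 0)"
    have "(h' - h) \<bullet> h' = 0" "(h' - h) \<bullet> h = 0"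
      using hw[of h'] hw[OF hH] h' hH by (auto simp: inner_diff_left)
    then have "(h' - h) \<bullet> (h' - h) = 0" by (simp add: inner_diff_right)
    then show "h' = h" by simp
  qed (use hH hw in blast)
  then show ?thesis using hw[OF w] by (simp add: inner_diff_left)
qed

end

context brinkman_forchheimer
begin

text \<open>Measurability is only claimed on \<open>X\<close>, where the solutions live for almost every time. The Borel sets are
  those of the \<open>L\<^sup>2\<close> topology, because the paths are continuous in \<open>L\<^sup>2\<close> only.\<close>

abbreviation "BX \<equiv> restrict_space borel X"

section \<open>Measurability of the forms\<close>

lemma continuous_measurable_X:
  fixes F :: "'d vfield \<Rightarrow> real"
  assumes "continuous_on UNIV F" shows "F \<in> borel_measurable BX"
  by (intro measurable_restrict_space1 borel_measurable_continuous_onI assms)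

lemma inner_measurable_X: "(\<lambda>u. u \<bullet> v) \<in> borel_measurable BX"
  by (intro continuous_measurable_X continuous_intros)

lemma stokes_measurable:
  assumes v: "v \<in> V_space Q"
  shows "(\<lambda>u. weak_grad Q u \<bullet> weak_grad Q v) \<in> borel_measurable BX"
proof -
  obtain \<phi> where \<phi>: "\<And>n. \<phi> n \<in> S" "\<phi> \<longlonglongrightarrow> v" "(\<lambda>n. weak_grad Q (\<phi> n)) \<longlonglongrightarrow> weak_grad Q v"
    using V_approx[OF v] by blast
  show ?thesis
  proof (rule borel_measurable_LIMSEQ_real)
    show "(\<lambda>u. u \<bullet> minus_lap (\<phi> n)) \<in> borel_measurable BX" for n
      by (rule inner_measurable_X)
    fix u assume "u \<in> space BX"
    then have "u \<in> X" by (simp add: space_restrict_space)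
    show "(\<lambda>n. u \<bullet> minus_lap (\<phi> n)) \<longlonglongrightarrow> weak_grad Q u \<bullet> weak_grad Q v"
      unfolding weak_grad_inner_minus_lap[OF \<phi>(1) X_H1[OF \<open>u \<in> X\<close>], symmetric]
      by (intro tendsto_intros \<phi>)
  qed
qed

lemma forch_measurable:
  assumes v: "v \<in> X"
  shows "(\<lambda>u. forch u v) \<in> borel_measurable BX"
proof (rule borel_measurable_LIMSEQ_real)
  show "(\<lambda>u. trunc n u \<bullet> v) \<in> borel_measurable BX" for n
    by (intro continuous_measurable_X continuous_intros trunc_continuous)
qed (auto simp: space_restrict_space intro!: trunc_inner_tendsto X_integrable v)

lemma tri_test_measurable:
  assumes \<phi>: "\<phi> \<in> S" shows "(\<lambda>u. tri u \<phi> u) \<in> borel_measurable BX"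
proof -
  obtain f where f: "\<phi> = abs_L2 f" "f \<in> test_functions Q"
    using S_cases[OF \<phi>] by metis
  note J = test_function_jacobian[OF f(2)]
  obtain B where B: "\<And>x. norm (jacobian f (at x)) \<le> B" using test_function_bounded[OF J] by blast
  have [measurable]: "(\<lambda>x. jacobian f (at x)) \<in> borel_measurable borel"
    by (rule test_function_borel_measurable[OF J])
  interpret lipschitz_superposition "\<lambda>x (y :: real^'d). jacobian f (at x) *v y" B
  proof
    fix x :: "real^'d" and y z :: "real^'d"
    have "norm (jacobian f (at x) *v y - jacobian f (at x) *v z) \<le> norm (jacobian f (at x)) * norm (y - z)"
      using norm_matrix_vector_mult_le[of "jacobian f (at x)" "y - z"] by (simp add: matrix_vector_mult_diff_distrib)
    also have "\<dots> \<le> B * norm (y - z)"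
      by (intro mult_right_mono B) simp
    finally show "norm (jacobian f (at x) *v y - jacobian f (at x) *v z) \<le> B * norm (y - z)" .
  qed simp_all
  have "tri u \<phi> u = superposition (\<lambda>x y. jacobian f (at x) *v y) u \<bullet> u" for u
    unfolding tri_def f(1) weak_grad_test(1)[OF f(2)] inner_L2.rep_eq
  proof (rule integral_cong_AE)
    show "AE x in lborel. (rep_L2 (abs_L2 (\<lambda>x. jacobian f (at x))) x *v rep_L2 u x) \<bullet> rep_L2 u x =
        rep_L2 (superposition (\<lambda>x y. jacobian f (at x) *v y) u) x \<bullet> rep_L2 u x"
      using rep[of u] rep_abs_L2[OF test_function_square_integrable[OF J]]
      by eventually_elim simp
  qed simp_all
  then show ?thesis
    using continuous_measurable_X[OF continuous_on_inner[OF continuous continuous_on_id]] by simp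
qed

text \<open>Approximate \<open>v\<close> by test fields and move the derivative onto them by antisymmetry; the result is
  continuous in \<open>u\<close> with respect to the \<open>L\<^sup>2\<close> norm.\<close>

lemma tri_measurable_X:
  assumes v: "v \<in> X"
  shows "(\<lambda>u. tri u u v) \<in> borel_measurable BX"
proof -
  obtain \<phi> where \<phi>: "\<And>n. \<phi> n \<in> S" "(\<lambda>n. L4_pow (v - \<phi> n)) \<longlonglongrightarrow> 0"
    using L4_approx[OF v] by blast
  show ?thesis
  proof (rule borel_measurable_LIMSEQ_real)
    show "(\<lambda>u. - tri u (\<phi> n) u) \<in> borel_measurable BX" for n
      by (intro borel_measurable_uminus tri_test_measurable \<phi>)
    fix u assume "u \<in> space BX"
    then have u: "u \<in> X" by (simp add: space_restrict_space)
    show "(\<lambda>n. - tri u (\<phi> n) u) \<longlonglongrightarrow> tri u u v"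
      using tri_tendsto(2)[OF v u \<phi>, of u] unfolding tri_antisym[OF u u S_X[OF \<phi>(1)]] .
  qed
qed

lemma interpolant_bound:
  assumes J: "interpolant Q c \<theta> J" and u: "u \<in> X"
  shows "norm (u - J u) \<le> sqrt (c * \<theta>\<^sup>2) * norm (weak_grad Q u)"
proof -
  have "(norm (u - J u))\<^sup>2 \<le> c * \<theta>\<^sup>2 * (norm (weak_grad Q u))\<^sup>2"
    using J X_V[OF u] by (auto simp: interpolant_def V_norm_def)
  from real_sqrt_le_mono[OF this] show ?thesis
    by (simp add: real_sqrt_mult)
qed

lemma interpolant_add:
  "interpolant Q c \<theta> J \<Longrightarrow> u \<in> H1 Q \<Longrightarrow> v \<in> H1 Q \<Longrightarrow> J (u + v) = J u + J v"
  and interpolant_scaleR: "interpolant Q c \<theta> J \<Longrightarrow> u \<in> H1 Q \<Longrightarrow> J (r *\<^sub>R u) = r *\<^sub>R J u"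
  by (auto simp: interpolant_def linear_map_on_def)

text \<open>The interpolant is bounded with respect to the gradient norm but not on \<open>L\<^sup>2\<close>. Riesz
  representation in the gradient norm writes \<open>(u - J u) \<bullet> v\<close> as a limit of stokes forms, whose
  measurability is known.\<close>

lemma interpolant_measurable:
  assumes J: "interpolant Q c \<theta> J"
  shows "(\<lambda>u. J u \<bullet> v) \<in> borel_measurable BX"
proof -
  obtain z where z: "\<And>n::nat. z n \<in> X" "Cauchy (\<lambda>n. weak_grad Q (z n))"
    "\<And>u. u \<in> X \<Longrightarrow> (\<lambda>n. weak_grad Q (z n) \<bullet> weak_grad Q u) \<longlonglongrightarrow> (u - J u) \<bullet> v"
  proof (rule approximate_Riesz_representation[of X "weak_grad Q" "\<lambda>u. (u - J u) \<bullet> v" "sqrt (c * \<theta>\<^sup>2) * norm v"])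
    show "X \<noteq> {}" using S_X[OF S_zero] by blast
    show "\<bar>(u - J u) \<bullet> v\<bar> \<le> sqrt (c * \<theta>\<^sup>2) * norm v * norm (weak_grad Q u)" if "u \<in> X" for u
      using order_trans[OF Cauchy_Schwarz_ineq2 mult_right_mono[OF interpolant_bound[OF J that] norm_ge_zero[of v]]]
      by (simp add: mult.assoc mult.commute mult.left_commute)
  qed (auto simp: X_add X_scaleR X_H1 weak_grad_add weak_grad_scaleR interpolant_add[OF J] interpolant_scaleR[OF J] inner_simps algebra_simps)
  have "(\<lambda>u. u \<bullet> v - (u - J u) \<bullet> v) \<in> borel_measurable BX"
  proof (intro borel_measurable_diff inner_measurable_X)
    show "(\<lambda>u. (u - J u) \<bullet> v) \<in> borel_measurable BX"
    proof (rule borel_measurable_LIMSEQ_real)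
      show "(\<lambda>u. weak_grad Q u \<bullet> weak_grad Q (z n)) \<in> borel_measurable BX" for n
        by (rule stokes_measurable[OF X_V[OF z(1)]])
      show "(\<lambda>n. weak_grad Q u \<bullet> weak_grad Q (z n)) \<longlonglongrightarrow> (u - J u) \<bullet> v" if "u \<in> space BX" for u
        using z(3)[of u] that by (simp add: space_restrict_space inner_commute)
    qed
  qed
  then show ?thesis by (simp add: inner_diff_left)
qed

end

section \<open>Translations along a continuous path and decay from averages\<close>

lemma nn_integral_shift:
  fixes f :: "real \<Rightarrow> ennreal"
  assumes [measurable]: "f \<in> borel_measurable borel"
  shows "(\<integral>\<^sup>+t. f (t + h) \<partial>lborel) = (\<integral>\<^sup>+t. f t \<partial>lborel)"
proof -
  have "(\<integral>\<^sup>+t. f t \<partial>lborel) = (\<integral>\<^sup>+t. f t \<partial>distr lborel borel ((+) h))"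
    by (simp add: lborel_distr_plus)
  also have "\<dots> = (\<integral>\<^sup>+t. f (h + t) \<partial>lborel)"
    by (rule nn_integral_distr) auto
  finally show ?thesis by (simp add: add.commute)
qed

lemma AE_shift:
  fixes h :: real
  assumes "AE t in lborel. 0 \<le> t \<longrightarrow> P t" "0 \<le> h"
  shows "AE t in lborel. 0 \<le> t \<longrightarrow> P (t + h)"
proof -
  have "AE t in distr lborel borel ((+) h). 0 \<le> t \<longrightarrow> P t"
    unfolding lborel_distr_plus by (rule assms(1))
  then have "AE t in lborel. 0 \<le> h + t \<longrightarrow> P (h + t)"
    by (rule AE_distrD[rotated]) simp
  then show ?thesis
    by eventually_elim (use assms(2) in \<open>auto simp: add.commute\<close>)
qed

lemma lower_semicontinuous_measurable:
  fixes \<Phi> :: "'a::topological_space \<Rightarrow> ennreal"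
  assumes "\<And>c. open {x. c < \<Phi> x}"
  shows "\<Phi> \<in> borel_measurable borel"
  by (rule borel_measurableI_greater) (use assms in auto)

lemma lower_semicontinuous_liminf:
  fixes \<Phi> :: "'a::topological_space \<Rightarrow> ennreal"
  assumes lsc: "\<And>c. open {x. c < \<Phi> x}" and x: "x \<longlonglongrightarrow> l"
  shows "\<Phi> l \<le> liminf (\<lambda>n. \<Phi> (x n))"
  unfolding le_Liminf_iff
proof (intro allI impI)
  fix c assume "c < \<Phi> l"
  then show "eventually (\<lambda>n. c < \<Phi> (x n)) sequentially"
    using topological_tendstoD[OF x lsc[of c]] by simp
qed

text \<open>Suppose that the integral exceeds \<open>e\<close> along some \<open>h\<^sub>n \<rightarrow> 0\<close>. By Clarkson's inequality the integrals of
  \<open>\<Phi>((w(t + h\<^sub>n) + w(t))/2)\<close> then remain below \<open>\<integral>\<Phi>(w(t)) dt\<close> by a fixed amount.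
  Since the averages converge to \<open>w(t)\<close> for every \<open>t\<close>, this contradicts lower semicontinuity and Fatou's
  lemma.\<close>

lemma translation_continuity:
  fixes \<Phi> :: "'a::real_normed_vector \<Rightarrow> ennreal" and w :: "real \<Rightarrow> 'a"
  assumes lsc: "\<And>c. open {x. c < \<Phi> x}"
    and w: "continuous_on UNIV w"
    and wX: "AE t in lborel. 0 \<le> t \<longrightarrow> w t \<in> X"
    and Clarkson: "\<And>a b. a \<in> X \<Longrightarrow> b \<in> X \<Longrightarrow>
      2 * \<Phi> ((1/2) *\<^sub>R (a - b)) + 2 * \<Phi> ((1/2) *\<^sub>R (a + b)) \<le> \<Phi> a + \<Phi> b"
    and fin: "\<And>T. (\<integral>\<^sup>+t. \<Phi> (w t) * indicator {0..T} t \<partial>lborel) < \<infinity>"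
    and T: "0 \<le> T" and e: "(0::real) < e"
  shows "\<exists>h0>0. \<forall>h. 0 \<le> h \<and> h < h0 \<longrightarrow>
    (\<integral>\<^sup>+t. \<Phi> ((1/2) *\<^sub>R (w (t + h) - w t)) * indicator {0..T} t \<partial>lborel) \<le> ennreal e"
proof (rule ccontr)
  assume contra: "\<not> ?thesis"
  have "\<exists>h. 0 \<le> h \<and> h < 1 / real (Suc n) \<and>
      ennreal e < (\<integral>\<^sup>+t. \<Phi> ((1/2) *\<^sub>R (w (t + h) - w t)) * indicator {0..T} t \<partial>lborel)" for n
  proof (rule ccontr)
    assume "\<not> ?thesis"
    then have "\<forall>h. 0 \<le> h \<and> h < 1 / real (Suc n) \<longrightarrow>
        (\<integral>\<^sup>+t. \<Phi> ((1/2) *\<^sub>R (w (t + h) - w t)) * indicator {0..T} t \<partial>lborel) \<le> ennreal e"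
      by (meson not_le)
    moreover have "0 < 1 / real (Suc n)" by simp
    ultimately show False using contra by blast
  qed
  then have "\<forall>n. \<exists>h. 0 \<le> h \<and> h < 1 / real (Suc n) \<and>
      ennreal e < (\<integral>\<^sup>+t. \<Phi> ((1/2) *\<^sub>R (w (t + h) - w t)) * indicator {0..T} t \<partial>lborel)" by blast
  from choice[OF this] obtain h where h: "\<And>n. 0 \<le> h n" "\<And>n. h n < 1 / real (Suc n)"
    "\<And>n. ennreal e < (\<integral>\<^sup>+t. \<Phi> ((1/2) *\<^sub>R (w (t + h n) - w t)) * indicator {0..T} t \<partial>lborel)"
    by blast
  have h_lim: "h \<longlonglongrightarrow> 0"
    by (rule Lim_null_comparison[OF always_eventually LIMSEQ_Suc[OF lim_1_over_n]])
       (use h(1,2) in \<open>simp add: less_imp_le\<close>)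
  have h1: "h n \<le> 1" for n
    using h(2)[of n] by (rule order_trans[OF less_imp_le]) simp
  note [measurable] = lower_semicontinuous_measurable[OF lsc]
  have [measurable]: "w \<in> borel_measurable borel"
    by (rule borel_measurable_continuous_onI[OF w])
  have path [measurable]: "(\<lambda>t. \<Phi> ((1/2) *\<^sub>R (w (t + s) - w t))) \<in> borel_measurable borel"
    "(\<lambda>t. \<Phi> ((1/2) *\<^sub>R (w (t + s) + w t))) \<in> borel_measurable borel" for s
  proof -
    have "continuous_on UNIV (\<lambda>t. (1/2) *\<^sub>R (w (t + s) - w t))" "continuous_on UNIV (\<lambda>t. (1/2) *\<^sub>R (w (t + s) + w t))"
      by (intro continuous_intros continuous_on_compose2[OF w]; simp)+
    from this[THEN borel_measurable_continuous_onI]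
    show "(\<lambda>t. \<Phi> ((1/2) *\<^sub>R (w (t + s) - w t))) \<in> borel_measurable borel"
      "(\<lambda>t. \<Phi> ((1/2) *\<^sub>R (w (t + s) + w t))) \<in> borel_measurable borel"
      by measurable
  qed
  define P where "P = (\<integral>\<^sup>+t. \<Phi> (w t) * indicator {0..T} t \<partial>lborel)"
  define B where "B n = (\<integral>\<^sup>+t. \<Phi> ((1/2) *\<^sub>R (w (t + h n) + w t)) * indicator {0..T} t \<partial>lborel)" for n
  define R where "R n = (\<integral>\<^sup>+t. \<Phi> (w t) * indicator {0..T + h n} t \<partial>lborel)" for n
  have P_le_B: "P \<le> liminf B"
  proof -
    have "P \<le> (\<integral>\<^sup>+t. liminf (\<lambda>n. \<Phi> ((1/2) *\<^sub>R (w (t + h n) + w t)) * indicator {0..T} t) \<partial>lborel)"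
      unfolding P_def
    proof (rule nn_integral_mono)
      fix t
      have "(\<lambda>n. t + h n) \<longlonglongrightarrow> t + 0"
        by (intro tendsto_intros h_lim)
      then have "(\<lambda>n. w (t + h n)) \<longlonglongrightarrow> w (t + 0)"
        by (rule continuous_on_tendsto_compose[OF w]) auto
      then have "(\<lambda>n. (1/2) *\<^sub>R (w (t + h n) + w t)) \<longlonglongrightarrow> (1/2) *\<^sub>R (w (t + 0) + w t)"
        by (intro tendsto_intros)
      also have "(1/2) *\<^sub>R (w (t + 0) + w t) = w t"
        by (simp add: scaleR_half_double)
      finally have "\<Phi> (w t) \<le> liminf (\<lambda>n. \<Phi> ((1/2) *\<^sub>R (w (t + h n) + w t)))"
        by (rule lower_semicontinuous_liminf[OF lsc])
      then show "\<Phi> (w t) * indicator {0..T} t \<le> liminf (\<lambda>n. \<Phi> ((1/2) *\<^sub>R (w (t + h n) + w t)) * indicator {0..T} t)"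
        by (simp add: indicator_def Liminf_const)
    qed
    also have "\<dots> \<le> liminf B"
      unfolding B_def by (rule nn_integral_liminf) measurable
    finally show ?thesis .
  qed
  have R_lim: "R \<longlonglongrightarrow> P"
    unfolding R_def P_def
  proof (rule nn_integral_dominated_convergence[where w = "\<lambda>t. \<Phi> (w t) * indicator {0..T + 1} t"])
    show "(\<integral>\<^sup>+t. \<Phi> (w t) * indicator {0..T + 1} t \<partial>lborel) < \<infinity>" by (rule fin)
    show "AE t in lborel. \<Phi> (w t) * indicator {0..T + h n} t \<le> \<Phi> (w t) * indicator {0..T + 1} t" for n
      using h1[of n] by (intro AE_I2 mult_left_mono) (auto simp: indicator_def)
    show "AE t in lborel. (\<lambda>n. \<Phi> (w t) * indicator {0..T + h n} t) \<longlonglongrightarrow> \<Phi> (w t) * indicator {0..T} t"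
    proof (rule AE_I2)
      fix t
      have "eventually (\<lambda>n. indicator {0..T + h n} t = (indicator {0..T} t :: ennreal)) sequentially"
      proof (cases "T < t")
        case True
        then have "eventually (\<lambda>n. h n < t - T) sequentially"
          by (intro order_tendstoD(2)[OF h_lim]) simp
        then show ?thesis by eventually_elim (use True in \<open>auto simp: indicator_def\<close>)
      next
        case False
        then show ?thesis using h(1) by (auto intro!: always_eventually simp: indicator_def add_increasing2)
      qed
      then have "eventually (\<lambda>n. \<Phi> (w t) * indicator {0..T} t = \<Phi> (w t) * indicator {0..T + h n} t) sequentially"
        by eventually_elim simp
      then show "(\<lambda>n. \<Phi> (w t) * indicator {0..T + h n} t) \<longlonglongrightarrow> \<Phi> (w t) * indicator {0..T} t"
        by (rule Lim_transform_eventually[OF tendsto_const])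
    qed
  qed measurable
  have key: "2 * ennreal e + 2 * B n \<le> P + R n" for n
  proof -
    let ?D = "\<lambda>t. \<Phi> ((1/2) *\<^sub>R (w (t + h n) - w t)) * indicator {0..T} t"
    let ?B = "\<lambda>t. \<Phi> ((1/2) *\<^sub>R (w (t + h n) + w t)) * indicator {0..T} t"
    have "2 * ennreal e + 2 * B n \<le> 2 * (\<integral>\<^sup>+t. ?D t \<partial>lborel) + 2 * B n"
      using h(3)[of n] by (intro add_right_mono mult_left_mono) auto
    also have "\<dots> = (\<integral>\<^sup>+t. 2 * ?D t + 2 * ?B t \<partial>lborel)"
      unfolding B_def by (subst nn_integral_add) (auto simp: nn_integral_cmult)
    also have "\<dots> \<le> (\<integral>\<^sup>+t. \<Phi> (w t) * indicator {0..T} t + \<Phi> (w (t + h n)) * indicator {0..T + h n} (t + h n) \<partial>lborel)"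
    proof (rule nn_integral_mono_AE)
      show "AE t in lborel. 2 * ?D t + 2 * ?B t \<le> \<Phi> (w t) * indicator {0..T} t + \<Phi> (w (t + h n)) * indicator {0..T + h n} (t + h n)"
        using wX AE_shift[OF wX h(1)[of n]]
      proof eventually_elim
        case (elim t)
        show ?case
        proof (cases "t \<in> {0..T}")
          case True
          then show ?thesis
            using Clarkson[of "w (t + h n)" "w t"] elim h(1)[of n] by (simp add: add.commute)
        qed simp
      qed
    qed
    also have "\<dots> = P + R n"
      unfolding P_def R_def
      using nn_integral_shift[of "\<lambda>t. \<Phi> (w t) * indicator {0..T + h n} t" "h n"]
      by (subst nn_integral_add) auto
    finally show ?thesis .
  qed
  have "P < \<infinity>" unfolding P_def by (rule fin)
  then obtain r where r: "P = ennreal r" "0 \<le> r" by (cases P) auto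
  have ev_R: "eventually (\<lambda>n. R n < ennreal (r + e)) sequentially"
    by (rule order_tendstoD(2)[OF R_lim]) (use r e in \<open>simp add: ennreal_lessI\<close>)
  have ev_B: "eventually (\<lambda>n. ennreal (r - e / 2) < B n) sequentially" if "0 < r"
    using P_le_B that e unfolding le_Liminf_iff r(1) by (simp add: ennreal_lessI)
  \<comment> \<open>From here on the argument is arithmetic with finite numbers, where subtraction is available.\<close>
  have bound: "0 < r \<and> B n < ennreal (r - e / 2)" if R: "R n < ennreal (r + e)" for n
  proof -
    obtain R' where R': "R n = ennreal R'" "0 \<le> R'" using R by (cases "R n") auto
    have "R' < r + e" using R R' by (simp add: ennreal_less_iff)
    have k: "2 * ennreal e + 2 * B n \<le> ennreal (r + R')"
      using key[of n] r R' by simp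
    then have "B n \<noteq> \<infinity>"
      using neq_top_trans[OF ennreal_neq_top k] by (auto simp: ennreal_mult_top)
    then obtain b where b: "B n = ennreal b" "0 \<le> b" by (cases "B n") auto
    have eq: "2 * ennreal e + 2 * B n = ennreal (2 * e + 2 * b)"
      using e b by (simp add: ennreal_mult)
    have "2 * e + 2 * b \<le> r + R'"
      using k r R' unfolding eq by (subst (asm) ennreal_le_iff) auto
    then show ?thesis
      using \<open>R' < r + e\<close> b e by (auto simp: ennreal_less_iff)
  qed
  then have "0 < r"
    using ev_R by (auto simp: eventually_sequentially)
  from eventually_conj[OF ev_R ev_B[OF this]] obtain n where "R n < ennreal (r + e)" "ennreal (r - e / 2) < B n"
    by (auto simp: eventually_sequentially)
  then show False using bound[of n] by auto
qed

text \<open>The integral of \<open>z(t + h) - z(t)\<close> over \<open>[a, b]\<close> telescopes to the difference of the integrals over \<open>[b, b + h]\<close>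
  and \<open>[a, a + h]\<close>, which is \<open>h (z(b) - z(a))\<close> up to \<open>o(h)\<close>.\<close>

lemma mono_from_averages:
  fixes z :: "real \<Rightarrow> real"
  assumes z: "continuous_on {a..b + 1} z" and ab: "a \<le> b"
    and avg: "\<And>e. 0 < e \<Longrightarrow> \<exists>h0>0. \<forall>h. 0 < h \<and> h < h0 \<longrightarrow> integral {a..b} (\<lambda>t. z (t + h) - z t) \<le> h * e"
  shows "z b \<le> z a"
proof (rule field_le_epsilon)
  fix e :: real assume e: "0 < e"
  have zi: "z integrable_on {s..t}" if "a \<le> s" "t \<le> b + 1" for s t
    by (intro integrable_continuous_interval continuous_on_subset[OF z]) (use that in auto)
  obtain h0 where h0: "0 < h0" "\<And>h. 0 < h \<Longrightarrow> h < h0 \<Longrightarrow> integral {a..b} (\<lambda>t. z (t + h) - z t) \<le> h * (e / 3)"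
    using avg[of "e / 3"] e by auto
  have near: "\<exists>d>0. \<forall>t\<in>{a..b + 1}. \<bar>t - s\<bar> < d \<longrightarrow> \<bar>z t - z s\<bar> < e / 3" if "s \<in> {a..b + 1}" for s
  proof -
    have "0 < e / 3" using e by simp
    then show ?thesis using z that unfolding continuous_on_iff dist_real_def by blast
  qed
  obtain d1 where d1: "d1 > 0" "\<And>t. t \<in> {a..b + 1} \<Longrightarrow> \<bar>t - a\<bar> < d1 \<Longrightarrow> \<bar>z t - z a\<bar> < e / 3" using near[of a] ab by auto
  obtain d2 where d2: "d2 > 0" "\<And>t. t \<in> {a..b + 1} \<Longrightarrow> \<bar>t - b\<bar> < d2 \<Longrightarrow> \<bar>z t - z b\<bar> < e / 3" using near[of b] ab by auto
  define h where "h = min (min 1 (h0 / 2)) (min (d1 / 2) (d2 / 2))"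
  have h: "0 < h" "h < h0" "h < d1" "h < d2" "h \<le> 1" using h0 d1 d2 by (auto simp: h_def)
  have "integral {a..b} (\<lambda>t. z (t + h) - z t) = integral {a..b} (\<lambda>t. z (t + h)) - integral {a..b} z"
    by (intro Henstock_Kurzweil_Integration.integral_diff zi integrable_continuous_interval continuous_intros continuous_on_compose2[OF z]) (use h in auto)
  also have "integral {a..b} (\<lambda>t. z (t + h)) = integral {a + h..b + h} z"
    using integral_shift[of a h b z] continuous_on_subset[OF z, of "{a + h..b + h}"] h by (simp add: o_def)
  also have "integral {a + h..b + h} z - integral {a..b} z = integral {b..b + h} z - integral {a..a + h} z"
  proof -
    have "integral {a..b} z + integral {b..b + h} z = integral {a..b + h} z"
      by (rule Henstock_Kurzweil_Integration.integral_combine) (use ab h zi in auto)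
    moreover have "integral {a..a + h} z + integral {a + h..b + h} z = integral {a..b + h} z"
      by (rule Henstock_Kurzweil_Integration.integral_combine) (use ab h zi in auto)
    ultimately show ?thesis by linarith
  qed
  finally have le: "integral {b..b + h} z - integral {a..a + h} z \<le> h * (e / 3)"
    using h0(2)[of h] h by simp
  have "integral {b..b + h} (\<lambda>t. z b - e / 3) \<le> integral {b..b + h} z"
  proof (rule integral_le)
    fix t assume "t \<in> {b..b + h}"
    then have "\<bar>z t - z b\<bar> < e / 3" using h ab by (intro d2(2)) auto
    then show "z b - e / 3 \<le> z t" by linarith
  qed (use zi ab h in auto)
  moreover have "integral {a..a + h} z \<le> integral {a..a + h} (\<lambda>t. z a + e / 3)"
  proof (rule integral_le)
    fix t assume "t \<in> {a..a + h}"
    then have "\<bar>z t - z a\<bar> < e / 3" using h ab by (intro d1(2)) auto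
    then show "z t \<le> z a + e / 3" by linarith
  qed (use zi ab h in auto)
  ultimately have "h * (z b - e / 3) - h * (z a + e / 3) \<le> h * (e / 3)"
    using le h by simp
  then have "h * (z b) \<le> h * (z a + e)" by (simp add: algebra_simps)
  then show "z b \<le> z a + e" using h(1) by simp
qed

text \<open>The inequality first implies that \<open>y\<close> is nonincreasing, and then that it shrinks by the factor \<open>1 + \<kappa> h\<close> over every
  interval of length \<open>h\<close>. With \<open>n\<close> steps of length \<open>t / n\<close> and \<open>n \<rightarrow> \<infinity>\<close> the exponential appears.\<close>

lemma exponential_decay_from_integral_inequality:
  fixes y :: "real \<Rightarrow> real"
  assumes y: "continuous_on UNIV y" "\<And>t. 0 \<le> y t" and \<kappa>: "0 < \<kappa>"
    and le: "\<And>s t. 0 \<le> s \<Longrightarrow> s \<le> t \<Longrightarrow> y t + \<kappa> * integral {s..t} y \<le> y s"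
    and t: "0 \<le> t"
  shows "y t \<le> y 0 * exp (- \<kappa> * t)"
proof -
  have yi: "y integrable_on {s..t}" for s t
    by (intro integrable_continuous_interval continuous_on_subset[OF y(1)]) simp
  have anti: "y t \<le> y s" if "0 \<le> s" "s \<le> t" for s t
  proof -
    have "0 \<le> \<kappa> * integral {s..t} y"
      using \<kappa> y(2) by (intro mult_nonneg_nonneg Henstock_Kurzweil_Integration.integral_nonneg yi) auto
    then show ?thesis using le[OF that] by linarith
  qed
  have step: "(1 + \<kappa> * (t - s)) * y t \<le> y s" if st: "0 \<le> s" "s \<le> t" for s t
  proof -
    have "(t - s) * y t = integral {s..t} (\<lambda>_. y t)" using st by simp
    also have "\<dots> \<le> integral {s..t} y"
      by (rule integral_le) (use yi anti st in auto)
    finally have "\<kappa> * ((t - s) * y t) \<le> \<kappa> * integral {s..t} y" using \<kappa> by (intro mult_left_mono) auto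
    then show ?thesis using le[OF st] by (simp add: algebra_simps)
  qed
  have iter: "(1 + \<kappa> * h) ^ n * y (real n * h) \<le> y 0" if h: "0 \<le> h" for h n
  proof (induction n)
    case (Suc n)
    have "(1 + \<kappa> * h) * y (real (Suc n) * h) \<le> y (real n * h)"
      using step[of "real n * h" "real (Suc n) * h"] h by (simp add: algebra_simps)
    then have "(1 + \<kappa> * h) ^ n * ((1 + \<kappa> * h) * y (real (Suc n) * h)) \<le> (1 + \<kappa> * h) ^ n * y (real n * h)"
      using \<kappa> h by (intro mult_left_mono) auto
    then show ?case using Suc by (simp add: mult.assoc mult.left_commute mult.commute)
  qed simp
  have pw: "(1 + (\<kappa> * t) / real n) ^ n * y t \<le> y 0" if "0 < n" for n
    using iter[of "t / real n" n] that t by simp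
  have ev: "eventually (\<lambda>n. (1 + (\<kappa> * t) / real n) ^ n * y t \<le> y 0) sequentially"
    by (rule eventually_mono[OF eventually_gt_at_top[of 0]]) (rule pw)
  have "(\<lambda>n. (1 + (\<kappa> * t) / real n) ^ n * y t) \<longlonglongrightarrow> exp (\<kappa> * t) * y t"
    by (intro tendsto_intros tendsto_exp_limit_sequentially)
  then have "exp (\<kappa> * t) * y t \<le> y 0"
    by (rule tendsto_upperbound[OF _ ev]) simp
  then show ?thesis
    by (simp add: exp_minus field_simps)
qed

section \<open>The energy inequality for a weak equation\<close>

lemma ennreal_integral_le_nn_integral:
  fixes f :: "'a \<Rightarrow> real"
  assumes "integrable M f"
  shows "ennreal (integral\<^sup>L M f) \<le> (\<integral>\<^sup>+x. ennreal (f x) \<partial>M)"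
proof -
  have "integral\<^sup>L M f \<le> (LINT x|M. max 0 (f x))"
    by (rule integral_mono[OF assms]) (use assms in auto)
  then have "ennreal (integral\<^sup>L M f) \<le> ennreal (LINT x|M. max 0 (f x))"
    by (rule ennreal_leI)
  also have "\<dots> = (\<integral>\<^sup>+x. ennreal (max 0 (f x)) \<partial>M)"
    by (rule nn_integral_eq_integral[symmetric]) (use assms in auto)
  also have "\<dots> = (\<integral>\<^sup>+x. ennreal (f x) \<partial>M)"
    by (simp add: max_def ennreal_neg cong: if_cong)
       (intro nn_integral_cong, auto simp: ennreal_neg)
  finally show ?thesis .
qed

text \<open>The function \<open>g r\<close> is the operator of the equation at time \<open>r\<close>, and \<open>w\<close> solves \<open>w' = - g(w)\<close> in the weak sense.
  Testing over \<open>[t, t + h]\<close> with \<open>w(t)\<close> and \<open>w(t + h)\<close> produces \<open>g r (w t) + g r (w (t + h))\<close>, which differs from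
  \<open>2 g r (w r)\<close> by \<open>g r\<close> applied to differences of values of \<open>w\<close>. The bound on \<open>g\<close> splits these errors into a small multiple of
  the integrable \<open>m\<close> and a large multiple of \<open>\<Phi>\<close> at differences, which is small on average by continuity
  of translations. Thus the averages of \<open>z(t + h) - z(t)\<close>, where \<open>z\<close> is the left-hand side as a function of the upper limit, are at most \<open>h e\<close>.
  The errors are replaced by their nonnegative Borel bounds before the two time integrals are interchanged, since \<open>g\<close> is
  measurable in time only for a fixed test function.\<close>

lemma energy_inequality:
  fixes w :: "real \<Rightarrow> 'a::real_inner" and \<Phi> :: "'a \<Rightarrow> ennreal" and m :: "real \<Rightarrow> ennreal"
    and g :: "real \<Rightarrow> 'a \<Rightarrow> real"
  assumes w: "continuous_on UNIV w"
    and wX: "AE t in lborel. 0 \<le> t \<longrightarrow> w t \<in> X"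
    and Xdiff: "\<And>x y. x \<in> X \<Longrightarrow> y \<in> X \<Longrightarrow> x - y \<in> X"
    and \<Phi> [measurable]: "\<Phi> \<in> borel_measurable borel"
    and m [measurable]: "m \<in> borel_measurable borel"
    and m_fin: "\<And>T. (\<integral>\<^sup>+t. m t * indicator {0..T} t \<partial>lborel) < \<infinity>"
    and translation: "\<And>T e. 0 \<le> T \<Longrightarrow> (0::real) < e \<Longrightarrow> \<exists>h0>0. \<forall>h. 0 \<le> h \<and> h < h0 \<longrightarrow>
      (\<integral>\<^sup>+t. \<Phi> (w (t + h) - w t) * indicator {0..T} t \<partial>lborel) \<le> ennreal e"
    and weak_integrable: "\<And>v s t. v \<in> X \<Longrightarrow> 0 \<le> s \<Longrightarrow> s \<le> t \<Longrightarrow> set_integrable lebesgue {s..t} (\<lambda>r. g r v)"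
    and weak: "\<And>v s t. v \<in> X \<Longrightarrow> 0 \<le> s \<Longrightarrow> s \<le> t \<Longrightarrow> (w t - w s) \<bullet> v = - (LINT r:{s..t}|lebesgue. g r v)"
    and linear: "AE r in lborel. 0 \<le> r \<longrightarrow> (\<forall>x\<in>X. \<forall>y\<in>X. g r (x - y) = g r x - g r y)"
    and coercive: "AE r in lborel. 0 \<le> r \<longrightarrow> \<kappa> * (norm (w r))\<^sup>2 \<le> 2 * g r (w r)"
    and bound: "\<And>e. (0::real) < e \<Longrightarrow> \<exists>C\<ge>0. AE r in lborel. 0 \<le> r \<longrightarrow>
      (\<forall>d\<in>X. ennreal \<bar>g r d\<bar> \<le> ennreal e * m r + ennreal C * \<Phi> d)"
    and ab: "0 \<le> a" "a \<le> b"
  shows "(norm (w b))\<^sup>2 + \<kappa> * integral {a..b} (\<lambda>t. (norm (w t))\<^sup>2) \<le> (norm (w a))\<^sup>2"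
proof -
  define y where "y t = (norm (w t))\<^sup>2" for t
  define z where "z t = y t + \<kappa> * integral {a..t} y" for t
  have y: "continuous_on A y" for A
    unfolding y_def by (intro continuous_intros continuous_on_subset[OF w]) simp
  have yi: "y integrable_on {s..t}" for s t
    by (rule integrable_continuous_interval[OF y])
  have z: "continuous_on {a..b + 1} z"
    unfolding z_def by (intro continuous_intros y indefinite_integral_continuous_1 yi)
  have [measurable]: "w \<in> borel_measurable borel" "y \<in> borel_measurable borel"
    using borel_measurable_continuous_onI[OF w] borel_measurable_continuous_onI[OF y] by auto
  have "z b \<le> z a"
  proof (rule mono_from_averages[OF z ab(2)])
    fix e :: real assume e: "0 < e"
    obtain M where M: "(\<integral>\<^sup>+t. m t * indicator {0..b + 1} t \<partial>lborel) = ennreal M" "0 \<le> M"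
      using m_fin[of "b + 1"] by (cases "\<integral>\<^sup>+t. m t * indicator {0..b + 1} t \<partial>lborel") auto
    define e1 where "e1 = e / (4 * (M + 1))"
    have e1: "0 < e1" "2 * e1 * M \<le> e / 2" using e M by (auto simp: e1_def field_simps)
    obtain C where C: "0 \<le> C" "AE r in lborel. 0 \<le> r \<longrightarrow>
      (\<forall>d\<in>X. ennreal \<bar>g r d\<bar> \<le> ennreal e1 * m r + ennreal C * \<Phi> d)"
      using bound[OF e1(1)] by blast
    \<comment> \<open>\<open>e1\<close> and \<open>\<delta>\<close> each account for half of the error \<open>e\<close>; \<open>M\<close> and \<open>C\<close> may vanish, hence the added 1.\<close>
    define \<delta> where "\<delta> = e / (4 * (C + 1))"
    have \<delta>: "0 < \<delta>" "2 * C * \<delta> \<le> e / 2" using e C by (auto simp: \<delta>_def field_simps)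
    obtain h0 where h0: "0 < h0" "\<And>h. 0 \<le> h \<Longrightarrow> h < h0 \<Longrightarrow>
        (\<integral>\<^sup>+t. \<Phi> (w (t + h) - w t) * indicator {0..b + 1} t \<partial>lborel) \<le> ennreal \<delta>"
      using translation[of "b + 1" \<delta>] ab \<delta> by auto
    show "\<exists>h0>0. \<forall>h. 0 < h \<and> h < h0 \<longrightarrow> integral {a..b} (\<lambda>t. z (t + h) - z t) \<le> h * e"
    proof (intro exI[of _ "min h0 1"] conjI allI impI)
      show "0 < min h0 1" using h0 by simp
      fix h :: real assume "0 < h \<and> h < min h0 1"
      then have h: "0 < h" "h < h0" "h \<le> 1" by auto
      \<comment> \<open>The error density at time \<open>r\<close> when testing with \<open>w t\<close> and \<open>w (t + h)\<close>.\<close>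
      define R where "R t r = 2 * ennreal e1 * m r + ennreal C * \<Phi> (w r - w t) + ennreal C * \<Phi> (w (t + h) - w r)" for t r
      have cont_m: "(\<lambda>x. \<Phi> (f x)) \<in> borel_measurable borel" if "continuous_on UNIV f" for f :: "real \<times> real \<Rightarrow> 'a"
        using measurable_compose[OF borel_measurable_continuous_onI[OF that] \<Phi>] .
      have cont_m1: "(\<lambda>x. \<Phi> (f x)) \<in> borel_measurable borel" if "continuous_on UNIV f" for f :: "real \<Rightarrow> 'a"
        using measurable_compose[OF borel_measurable_continuous_onI[OF that] \<Phi>] .
      have R1 [measurable]: "R t \<in> borel_measurable borel" for t
        unfolding R_def
        by (intro borel_measurable_add borel_measurable_times_ennreal cont_m1 continuous_intros continuous_on_compose2[OF w]; simp)
      have R2 [measurable]: "(\<lambda>(t, s). R t (t + s)) \<in> borel_measurable (borel \<Otimes>\<^sub>M borel)"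
      proof -
        have "(\<lambda>x. \<Phi> (w (fst x + snd x) - w (fst x))) \<in> borel_measurable borel"
          "(\<lambda>x. \<Phi> (w (fst x + h) - w (fst x + snd x))) \<in> borel_measurable borel"
          by (intro cont_m continuous_intros continuous_on_compose2[OF w]; simp)+
        moreover have "continuous_on UNIV (\<lambda>x::real \<times> real. fst x + snd x)"
          by (intro continuous_intros)
        then have "(\<lambda>x::real \<times> real. m (fst x + snd x)) \<in> borel_measurable borel"
          using measurable_compose[OF borel_measurable_continuous_onI m] by blast
        ultimately show ?thesis
          unfolding R_def borel_prod split_beta by (intro borel_measurable_add borel_measurable_times_ennreal) simp_all
      qed
      have pointwise: "AE t in lborel. t \<in> {a..b} \<longrightarrow>
          ennreal (z (t + h) - z t) \<le> (\<integral>\<^sup>+s. R t (t + s) * indicator {0..h} s \<partial>lborel)"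
        using wX AE_shift[OF wX less_imp_le[OF h(1)]]
      proof eventually_elim
        case (elim t)
        show ?case
        proof
          assume "t \<in> {a..b}"
          then have t: "0 \<le> t" "a \<le> t" "w t \<in> X" "w (t + h) \<in> X" using elim ab h by auto
          have th: "t \<le> t + h" using h by simp
          define F where "F r = \<kappa> * y r - g r (w t) - g r (w (t + h))" for r
          have int_y: "set_integrable lebesgue {t..t + h} (\<lambda>r. \<kappa> * y r)"
            by (intro absolutely_integrable_continuous_real continuous_intros y)
          note int_g = weak_integrable[OF t(3) t(1) th] weak_integrable[OF t(4) t(1) th]
          have int_F: "set_integrable lebesgue {t..t + h} F"
            unfolding F_def by (intro set_integral_diff(1) int_y int_g)
          have "z (t + h) - z t = y (t + h) - y t + \<kappa> * integral {t..t + h} y"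
          proof -
            have eq: "integral {a..t} y + integral {t..t + h} y = integral {a..t + h} y"
              by (rule Henstock_Kurzweil_Integration.integral_combine) (use t h yi in auto)
            show ?thesis unfolding z_def eq[symmetric] by (simp add: algebra_simps)
          qed
          also have "\<kappa> * integral {t..t + h} y = (LINT r:{t..t + h}|lebesgue. \<kappa> * y r)"
            by (subst set_lebesgue_integral_eq_integral(2)[OF int_y]) simp
          also have "y (t + h) - y t = (w (t + h) - w t) \<bullet> w t + (w (t + h) - w t) \<bullet> w (t + h)"
            by (simp add: y_def power2_norm_eq_inner inner_simps inner_commute)
          also have "\<dots> = - (LINT r:{t..t + h}|lebesgue. g r (w t)) - (LINT r:{t..t + h}|lebesgue. g r (w (t + h)))"
            using weak[OF t(3) t(1) th] weak[OF t(4) t(1) th] by simp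
          also have "- (LINT r:{t..t + h}|lebesgue. g r (w t)) - (LINT r:{t..t + h}|lebesgue. g r (w (t + h)))
              + (LINT r:{t..t + h}|lebesgue. \<kappa> * y r) = (LINT r:{t..t + h}|lebesgue. F r)"
            unfolding F_def using int_y int_g by (simp add: set_integral_diff)
          finally have "ennreal (z (t + h) - z t) = ennreal (LINT r:{t..t + h}|lebesgue. F r)"
            by simp
          also have "\<dots> \<le> (\<integral>\<^sup>+r. ennreal (indicator {t..t + h} r *\<^sub>R F r) \<partial>lebesgue)"
            unfolding set_lebesgue_integral_def
            by (rule ennreal_integral_le_nn_integral) (use int_F in \<open>simp add: set_integrable_def\<close>)
          also have "\<dots> \<le> (\<integral>\<^sup>+r. R t r * indicator {t..t + h} r \<partial>lebesgue)"
          proof (rule nn_integral_mono_AE, rule AE_completion)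
            show "AE r in lborel. ennreal (indicator {t..t + h} r *\<^sub>R F r) \<le> R t r * indicator {t..t + h} r"
              using wX linear coercive C(2)
            proof eventually_elim
              case (elim r)
              show ?case
              proof (cases "r \<in> {t..t + h}")
                case True
                then have r: "0 \<le> r" using t by simp
                note wr = elim(1)[rule_format, OF r]
                note lin = elim(2)[rule_format, OF r] and co = elim(3)[rule_format, OF r]
                  and bd = elim(4)[rule_format, OF r]
                have "F r \<le> g r (w r - w t) - g r (w (t + h) - w r)"
                  using co by (simp add: F_def y_def lin t wr)
                then have "F r \<le> \<bar>g r (w r - w t)\<bar> + \<bar>g r (w (t + h) - w r)\<bar>" by linarith
                then have "ennreal (F r) \<le> ennreal \<bar>g r (w r - w t)\<bar> + ennreal \<bar>g r (w (t + h) - w r)\<bar>"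
                  using ennreal_leI[of "F r"] by fastforce
                also have "\<dots> \<le> (ennreal e1 * m r + ennreal C * \<Phi> (w r - w t)) + (ennreal e1 * m r + ennreal C * \<Phi> (w (t + h) - w r))"
                  by (intro add_mono bd Xdiff wr t)
                also have "\<dots> = R t r"
                proof -
                  have "2 * ennreal e1 * m r = ennreal e1 * m r + ennreal e1 * m r"
                    by (simp only: mult_2 distrib_right)
                  then show ?thesis unfolding R_def by (simp only: ac_simps)
                qed
                finally show ?thesis using True by simp
              qed simp
            qed
          qed
          also have "\<dots> = (\<integral>\<^sup>+r. R t r * indicator {t..t + h} r \<partial>lborel)"
            by (rule nn_integral_completion)
          also have "\<dots> = (\<integral>\<^sup>+s. R t (s + t) * indicator {t..t + h} (s + t) \<partial>lborel)"
            by (rule nn_integral_shift[symmetric]) measurable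
          also have "\<dots> = (\<integral>\<^sup>+s. R t (t + s) * indicator {0..h} s \<partial>lborel)"
            by (intro nn_integral_cong) (auto simp: indicator_def add.commute)
          finally show "ennreal (z (t + h) - z t) \<le> (\<integral>\<^sup>+s. R t (t + s) * indicator {0..h} s \<partial>lborel)" .
        qed
      qed
      have int_z: "set_integrable lebesgue {a..b} (\<lambda>t. z (t + h) - z t)"
        by (intro absolutely_integrable_continuous_real continuous_intros continuous_on_compose2[OF z] continuous_on_subset[OF z])
           (use h in auto)
      have "ennreal (integral {a..b} (\<lambda>t. z (t + h) - z t)) = ennreal (LINT t:{a..b}|lebesgue. z (t + h) - z t)"
        by (simp add: set_lebesgue_integral_eq_integral(2)[OF int_z])
      also have "\<dots> \<le> (\<integral>\<^sup>+t. ennreal (indicator {a..b} t *\<^sub>R (z (t + h) - z t)) \<partial>lebesgue)"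
        unfolding set_lebesgue_integral_def
        by (rule ennreal_integral_le_nn_integral) (use int_z in \<open>simp add: set_integrable_def\<close>)
      also have "\<dots> \<le> (\<integral>\<^sup>+t. (\<integral>\<^sup>+s. R t (t + s) * indicator {0..h} s * indicator {a..b} t \<partial>lborel) \<partial>lebesgue)"
      proof (rule nn_integral_mono_AE, rule AE_completion)
        show "AE t in lborel. ennreal (indicator {a..b} t *\<^sub>R (z (t + h) - z t))
            \<le> (\<integral>\<^sup>+s. R t (t + s) * indicator {0..h} s * indicator {a..b} t \<partial>lborel)"
          using pointwise by eventually_elim (auto simp: indicator_def)
      qed
      also have "\<dots> = (\<integral>\<^sup>+t. (\<integral>\<^sup>+s. R t (t + s) * indicator {0..h} s * indicator {a..b} t \<partial>lborel) \<partial>lborel)"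
        by (rule nn_integral_completion)
      also have "\<dots> = (\<integral>\<^sup>+s. (\<integral>\<^sup>+t. R t (t + s) * indicator {0..h} s * indicator {a..b} t \<partial>lborel) \<partial>lborel)"
        by (rule lborel_pair.Fubini') measurable
      also have "\<dots> \<le> (\<integral>\<^sup>+s. ennreal e * indicator {0..h} s \<partial>lborel)"
      proof (rule nn_integral_mono)
        fix s
        show "(\<integral>\<^sup>+t. R t (t + s) * indicator {0..h} s * indicator {a..b} t \<partial>lborel) \<le> ennreal e * indicator {0..h} s"
        proof (cases "s \<in> {0..h}")
          case True
          have 1: "(\<integral>\<^sup>+t. m (t + s) * indicator {a..b} t \<partial>lborel) \<le> ennreal M"
          proof -
            have "(\<integral>\<^sup>+t. m (t + s) * indicator {a..b} t \<partial>lborel) \<le> (\<integral>\<^sup>+t. m (t + s) * indicator {0..b + 1} (t + s) \<partial>lborel)"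
              using True ab h by (intro nn_integral_mono mult_left_mono) (auto simp: indicator_def)
            also have "\<dots> = ennreal M"
              using nn_integral_shift[of "\<lambda>t. m t * indicator {0..b + 1} t" s] M(1) by simp
            finally show ?thesis .
          qed
          have 2: "(\<integral>\<^sup>+t. \<Phi> (w (t + s) - w t) * indicator {a..b} t \<partial>lborel) \<le> ennreal \<delta>"
          proof -
            have "(\<integral>\<^sup>+t. \<Phi> (w (t + s) - w t) * indicator {a..b} t \<partial>lborel) \<le> (\<integral>\<^sup>+t. \<Phi> (w (t + s) - w t) * indicator {0..b + 1} t \<partial>lborel)"
              using True ab h by (intro nn_integral_mono mult_left_mono) (auto simp: indicator_def)
            also have "\<dots> \<le> ennreal \<delta>" using True h by (intro h0(2)) auto
            finally show ?thesis .
          qed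
          \<comment> \<open>Shifting time by \<open>s\<close> reduces this to an increment of length \<open>h - s \<le> h\<close>; the interval \<open>[0, b + 1]\<close> leaves
            room for the shift because \<open>h \<le> 1\<close>.\<close>
          have 3: "(\<integral>\<^sup>+t. \<Phi> (w (t + h) - w (t + s)) * indicator {a..b} t \<partial>lborel) \<le> ennreal \<delta>"
          proof -
            have cm: "(\<lambda>t. \<Phi> (w (t + (h - s)) - w t)) \<in> borel_measurable borel"
              by (intro cont_m1 continuous_intros continuous_on_compose2[OF w]; simp)
            have "(\<integral>\<^sup>+t. \<Phi> (w (t + h) - w (t + s)) * indicator {a..b} t \<partial>lborel)
                \<le> (\<integral>\<^sup>+t. \<Phi> (w (t + s + (h - s)) - w (t + s)) * indicator {0..b + 1} (t + s) \<partial>lborel)"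
              using True ab h by (intro nn_integral_mono) (auto simp: indicator_def)
            also have "\<dots> = (\<integral>\<^sup>+t. \<Phi> (w (t + (h - s)) - w t) * indicator {0..b + 1} t \<partial>lborel)"
              by (rule nn_integral_shift[of "\<lambda>t. \<Phi> (w (t + (h - s)) - w t) * indicator {0..b + 1} t" s])
                 (use cm in measurable)
            also have "\<dots> \<le> ennreal \<delta>" using True h by (intro h0(2)) auto
            finally show ?thesis .
          qed
          have meas: "(\<lambda>t. \<Phi> (w (t + s) - w t)) \<in> borel_measurable borel" "(\<lambda>t. \<Phi> (w (t + h) - w (t + s))) \<in> borel_measurable borel"
            by (intro cont_m1 continuous_intros continuous_on_compose2[OF w]; simp)+
          have "(\<integral>\<^sup>+t. R t (t + s) * indicator {0..h} s * indicator {a..b} t \<partial>lborel) =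
              (\<integral>\<^sup>+t. 2 * ennreal e1 * (m (t + s) * indicator {a..b} t) + ennreal C * (\<Phi> (w (t + s) - w t) * indicator {a..b} t)
                + ennreal C * (\<Phi> (w (t + h) - w (t + s)) * indicator {a..b} t) \<partial>lborel)"
            using True by (intro nn_integral_cong) (auto simp: R_def indicator_def)
          also have "\<dots> = 2 * ennreal e1 * (\<integral>\<^sup>+t. m (t + s) * indicator {a..b} t \<partial>lborel)
              + ennreal C * (\<integral>\<^sup>+t. \<Phi> (w (t + s) - w t) * indicator {a..b} t \<partial>lborel)
              + ennreal C * (\<integral>\<^sup>+t. \<Phi> (w (t + h) - w (t + s)) * indicator {a..b} t \<partial>lborel)"
            using meas by (simp add: nn_integral_add nn_integral_cmult)
          also have "\<dots> \<le> 2 * ennreal e1 * ennreal M + ennreal C * ennreal \<delta> + ennreal C * ennreal \<delta>"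
            by (intro add_mono mult_left_mono 1 2 3) auto
          also have "\<dots> = ennreal (2 * e1 * M + C * \<delta> + C * \<delta>)"
          proof -
            have "2 * ennreal e1 * ennreal M = ennreal (2 * e1 * M)" "ennreal C * ennreal \<delta> = ennreal (C * \<delta>)"
              using e1 M C \<delta> by (simp_all add: ennreal_mult)
            then show ?thesis
              using e1 M C \<delta> by (simp del: ennreal_plus add: ennreal_plus[symmetric])
          qed
          also have "\<dots> \<le> ennreal e"
            using e1 \<delta> by (intro ennreal_leI) simp
          finally show ?thesis using True by simp
        qed simp
      qed
      also have "\<dots> = ennreal e * ennreal h"
        using h by (simp add: nn_integral_cmult)
      also have "\<dots> = ennreal (h * e)"
        using e h by (simp add: ennreal_mult mult.commute)
      finally show "integral {a..b} (\<lambda>t. z (t + h) - z t) \<le> h * e"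
        using e h by (subst (asm) ennreal_le_iff) auto
    qed
  qed
  then show ?thesis by (simp add: z_def y_def[abs_def])
qed

section \<open>Coercivity of the nudged difference\<close>

text \<open>The graph of the convex function \<open>x\<^sup>s\<close> lies above its tangent at \<open>t\<close>; this is Young's inequality for the
  product \<open>x t\<^bsup>s - 1\<^esup>\<close>.\<close>

lemma powr_tangent_le:
  fixes x t s :: real
  assumes "0 \<le> x" "0 < t" "1 < s"
  shows "t powr s + s * t powr (s - 1) * (x - t) \<le> x powr s"
proof -
  define r where "r = s / (s - 1)"
  have r: "1 < r" "1 / s + 1 / r = 1" using assms by (auto simp: r_def field_simps)
  have "x * t powr (s - 1) \<le> x powr s / s + (t powr (s - 1)) powr r / r"
    using Youngs_inequality[OF assms(3) r(1) r(2), of x "t powr (s - 1)"] assms by simp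
  also have "(t powr (s - 1)) powr r = t powr s"
    using assms by (simp add: powr_powr r_def)
  finally have "s * (x * t powr (s - 1)) \<le> s * (x powr s / s + t powr s / r)"
    using assms by (intro mult_left_mono) auto
  also have "\<dots> = x powr s + (s - 1) * t powr s"
    using assms by (simp add: r_def field_simps)
  finally have *: "s * (x * t powr (s - 1)) \<le> x powr s + (s - 1) * t powr s" .
  have "t powr (s - 1) * t = t powr s"
    using powr_mult_base[of t "s - 1"] assms by (simp add: mult.commute)
  then have "s * t powr (s - 1) * (x - t) = s * (x * t powr (s - 1)) - s * t powr s"
    by (simp add: algebra_simps)
  moreover have "(s - 1) * t powr s = s * t powr s - t powr s" by (simp add: algebra_simps)
  ultimately show ?thesis using * by linarith
qed

text \<open>The tangent of \<open>x\<^sup>s\<close>, \<open>s = (varpi - 1)/2\<close>, at the point where \<open>\<beta>/2 x\<^sup>s\<close> has slope \<open>1/(2 \<mu>)\<close>, evaluated at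
  \<open>x = r\<^sup>2\<close>. The optimal constant has 2 in place of the 4 in \<open>varpi_hat\<close> and is therefore smaller.\<close>

lemma varpi_hat_bound:
  fixes \<mu> \<beta> varpi r :: real
  assumes "0 < \<mu>" "0 < \<beta>" "3 < varpi" "0 \<le> r"
  shows "1 / (2 * \<mu>) * r\<^sup>2 \<le> \<beta> / 2 * r powr (varpi - 1) + varpi_hat \<mu> \<beta> varpi"
proof -
  define s where "s = (varpi - 1) / 2"
  \<comment> \<open>\<open>K = t\<^bsup>s - 1\<^esup>\<close> for the point of tangency \<open>t\<close>.\<close>
  define K where "K = 1 / (\<mu> * \<beta> * s)"
  define t where "t = K powr (1 / (s - 1))"
  have s: "1 < s" using assms by (simp add: s_def)
  have K: "0 < K" using assms s by (simp add: K_def)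
  have t: "0 < t" using K by (simp add: t_def)
  have ts: "t powr (s - 1) = K"
    using s K by (simp add: t_def powr_powr)
  have tt: "t powr s = K * t"
    using powr_mult_base[of t "s - 1"] t ts by (simp add: mult.commute)
  have rs: "(r\<^sup>2) powr s = r powr (varpi - 1)"
  proof (cases "r = 0")
    case False
    then have "r\<^sup>2 = r powr 2" using assms by simp
    moreover have "2 * s = varpi - 1" by (simp add: s_def)
    ultimately show ?thesis by (simp only: powr_powr)
  qed (use s in simp)
  have "\<beta> / 2 * (K * t + s * K * (r\<^sup>2 - t)) \<le> \<beta> / 2 * r powr (varpi - 1)"
    using powr_tangent_le[of "r\<^sup>2" t s] t s assms unfolding ts tt rs by (intro mult_left_mono) auto
  moreover have "\<beta> / 2 * (K * t + s * K * (r\<^sup>2 - t)) = 1 / (2 * \<mu>) * r\<^sup>2 - (s - 1) / (2 * \<mu> * s) * t"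
    using assms s by (simp add: K_def field_simps)
  moreover have "(s - 1) / (2 * \<mu> * s) * t \<le> varpi_hat \<mu> \<beta> varpi"
  proof -
    have e1: "(s - 1) / (2 * \<mu> * s) = (varpi - 3) / (2 * \<mu> * (varpi - 1))"
      using assms by (simp add: s_def field_simps)
    have e2: "1 / (s - 1) = 2 / (varpi - 3)"
      using assms by (simp add: s_def field_simps)
    have "K \<le> 4 / (\<mu> * \<beta> * (varpi - 1))"
      using assms by (simp add: K_def s_def field_simps)
    then have "t \<le> (4 / (\<mu> * \<beta> * (varpi - 1))) powr (2 / (varpi - 3))"
      unfolding t_def e2 using K assms by (intro powr_mono2) auto
    then show ?thesis
      unfolding varpi_hat_def e1 using assms by (intro mult_left_mono) auto
  qed
  ultimately show ?thesis by linarith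
qed

text \<open>With \<open>A = \<bar>a\<bar>\<^sup>q\<close> and \<open>B = \<bar>b\<bar>\<^sup>q\<close>, the right-hand side equals
  \<open>(A + B)/2 \<bar>a - b\<bar>\<^sup>2 + (A - B)(\<bar>a\<bar>\<^sup>2 - \<bar>b\<bar>\<^sup>2)/2\<close>, and the last summand is nonnegative.\<close>

lemma power_nonlinearity_monotone:
  fixes a b :: "'a::real_inner"
  assumes "0 \<le> q"
  shows "1 / 2 * norm a powr q * (norm (a - b))\<^sup>2
    \<le> norm a powr q * (a \<bullet> (a - b)) - norm b powr q * (b \<bullet> (a - b))"
proof -
  define A B where "A = norm a powr q" and "B = norm b powr q"
  have AB: "0 \<le> (A - B) * ((norm a)\<^sup>2 - (norm b)\<^sup>2)"
  proof (cases "norm a \<le> norm b")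
    case True
    then have "A \<le> B" "(norm a)\<^sup>2 \<le> (norm b)\<^sup>2" using assms by (auto simp: A_def B_def intro: powr_mono2 power_mono)
    then show ?thesis by (simp add: mult_nonpos_nonpos)
  next
    case False
    then have "B \<le> A" "(norm b)\<^sup>2 \<le> (norm a)\<^sup>2" using assms by (auto simp: A_def B_def intro: powr_mono2 power_mono)
    then show ?thesis by simp
  qed
  have "A * (a \<bullet> (a - b)) - B * (b \<bullet> (a - b))
      = 1 / 2 * A * (norm (a - b))\<^sup>2 + 1 / 2 * B * (norm (a - b))\<^sup>2 + 1 / 2 * ((A - B) * ((norm a)\<^sup>2 - (norm b)\<^sup>2))"
    by (simp add: power2_norm_eq_inner inner_diff_left inner_diff_right inner_commute algebra_simps)
  moreover have "0 \<le> 1 / 2 * B * (norm (a - b))\<^sup>2" by (simp add: B_def)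
  ultimately show ?thesis using AB unfolding A_def[symmetric] B_def[symmetric] by linarith
qed

lemma abs_inner_le_weighted:
  fixes x y :: "'a::real_inner"
  assumes "0 < k"
  shows "\<bar>x \<bullet> y\<bar> \<le> k * (norm x)\<^sup>2 + 1 / k * (norm y)\<^sup>2"
proof -
  have "0 \<le> (k * norm x - norm y)\<^sup>2" "0 \<le> k * (norm x * norm y)" using assms by auto
  moreover have "(k * norm x - norm y)\<^sup>2 = k * (k * (norm x)\<^sup>2) + (norm y)\<^sup>2 - 2 * (k * (norm x * norm y))"
    by (simp add: power2_eq_square algebra_simps)
  moreover have "k * (k * (norm x)\<^sup>2 + 1 / k * (norm y)\<^sup>2) = k * (k * (norm x)\<^sup>2) + (norm y)\<^sup>2"
    using assms by (simp add: distrib_left)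
  ultimately have "k * (norm x * norm y) \<le> k * (k * (norm x)\<^sup>2 + 1 / k * (norm y)\<^sup>2)"
    by linarith
  then have "norm x * norm y \<le> k * (norm x)\<^sup>2 + 1 / k * (norm y)\<^sup>2"
    using assms by (rule mult_left_le_imp_le)
  then show ?thesis using Cauchy_Schwarz_ineq2[of x y] by linarith
qed

context brinkman_forchheimer
begin

text \<open>The weight \<open>\<bar>u\<bar>\<^sup>2\<close> that Young's inequality puts on \<open>\<bar>w\<bar>\<^sup>2\<close> is absorbed pointwise by the gain from the monotonicity
  of the damping.\<close>

lemma convection_absorbed:
  assumes u: "u \<in> X" and U: "U \<in> X" and \<beta>: "0 < \<beta>" and l: "0 < l"
    and absorb: "\<And>r. 0 \<le> r \<Longrightarrow> 1 / (2 * l) * r\<^sup>2 \<le> \<beta> / 2 * r powr q + c"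
  defines "w \<equiv> u - U"
  shows "\<bar>tri w w u\<bar> \<le> l / 2 * dirichlet w + \<beta> * (forch u w - forch U w) + c * (norm w)\<^sup>2"
proof -
  have wX: "w \<in> X" unfolding w_def by (rule X_diff[OF u U])
  let ?G = "rep_L2 (weak_grad Q w)" and ?w = "rep_L2 w" and ?u = "rep_L2 u" and ?U = "rep_L2 U"
  let ?N = "\<lambda>x. norm (?u x) powr q * (?u x \<bullet> ?w x) - norm (?U x) powr q * (?U x \<bullet> ?w x)"
  note fi = forch_integrable[OF X_integrable[OF u] X_integrable[OF wX]] forch_integrable[OF X_integrable[OF U] X_integrable[OF wX]]
  note ti = tri_integrable[OF X_integrable[OF wX] X_integrable[OF u], of "weak_grad Q w"]
  have int: "integrable lborel (\<lambda>x. l / 2 * (norm (?G x))\<^sup>2 + \<beta> * ?N x + c * (norm (?w x))\<^sup>2)"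
    using fi integrable_norm_sq_L2[of "weak_grad Q w"] integrable_norm_sq_L2[of w] by simp
  have "\<bar>tri w w u\<bar> \<le> (LINT x|lborel. \<bar>(?G x *v ?w x) \<bullet> ?u x\<bar>)"
    unfolding tri_def by (rule integral_abs_bound)
  also have "\<dots> \<le> (LINT x|lborel. l / 2 * (norm (?G x))\<^sup>2 + \<beta> * ?N x + c * (norm (?w x))\<^sup>2)"
  proof (rule integral_mono_AE[OF integrable_abs[OF ti] int])
    show "AE x in lborel. \<bar>(?G x *v ?w x) \<bullet> ?u x\<bar> \<le> l / 2 * (norm (?G x))\<^sup>2 + \<beta> * ?N x + c * (norm (?w x))\<^sup>2"
      using rep_L2_diff[of u U] unfolding w_def[symmetric]
    proof eventually_elim
      case (elim x)
      define g y r where "g = norm (?G x)" and "y = norm (?w x)" and "r = norm (?u x)"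
      have "\<bar>(?G x *v ?w x) \<bullet> ?u x\<bar> \<le> norm (?G x *v ?w x) * norm (?u x)" by (rule Cauchy_Schwarz_ineq2)
      also have "\<dots> \<le> g * y * r"
        unfolding g_def y_def r_def by (intro mult_right_mono norm_matrix_vector_mult_le) simp
      also have "\<dots> \<le> l / 2 * g\<^sup>2 + 1 / (2 * l) * (y * r)\<^sup>2"
      proof -
        have "0 \<le> (l * g - y * r)\<^sup>2" by simp
        then have "(2 * l) * (g * y * r) \<le> (2 * l) * (l / 2 * g\<^sup>2 + 1 / (2 * l) * (y * r)\<^sup>2)"
          using l by (simp add: power2_eq_square algebra_simps)
        then show ?thesis by (rule mult_left_le_imp_le) (use l in simp)
      qed
      also have "1 / (2 * l) * (y * r)\<^sup>2 = (1 / (2 * l) * r\<^sup>2) * y\<^sup>2"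
        by (simp add: power_mult_distrib)
      also have "(1 / (2 * l) * r\<^sup>2) * y\<^sup>2 \<le> (\<beta> / 2 * r powr q + c) * y\<^sup>2"
        by (intro mult_right_mono absorb) (auto simp: r_def)
      also have "(\<beta> / 2 * r powr q + c) * y\<^sup>2 = \<beta> * (1 / 2 * r powr q * y\<^sup>2) + c * y\<^sup>2"
        by (simp add: algebra_simps)
      also have "\<beta> * (1 / 2 * r powr q * y\<^sup>2) \<le> \<beta> * ?N x"
        using power_nonlinearity_monotone[of q "?u x" "?U x"] varpi_ge \<beta> unfolding elim r_def y_def
        by (intro mult_left_mono) auto
      finally show ?case by (simp add: g_def y_def)
    qed
  qed
  also have "\<dots> = l / 2 * dirichlet w + \<beta> * (forch u w - forch U w) + c * (norm w)\<^sup>2"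
    using fi integrable_norm_sq_L2[of "weak_grad Q w"] integrable_norm_sq_L2[of w]
    by (simp add: dirichlet_def norm_L2_sq forch_def)
  finally show ?thesis .
qed

text \<open>The form of the equation on \<open>X\<close>, with all integrals extended to the whole space.\<close>

definition cbf :: "real \<Rightarrow> real \<Rightarrow> real \<Rightarrow> 'd vfield \<Rightarrow> 'd vfield \<Rightarrow> real" where
  "cbf \<mu> \<alpha> \<beta> u v = \<mu> * (weak_grad Q u \<bullet> weak_grad Q v) + tri u u v + \<alpha> * (u \<bullet> v) + \<beta> * forch u v"

lemma cbf_form_eq_cbf:
  assumes "u \<in> X" shows "cbf_form Q \<mu> \<alpha> \<beta> varpi u v = cbf \<mu> \<alpha> \<beta> u v"
  by (simp add: cbf_form_def cbf_def stokes_form_def convection_form_eq_tri[OF X_H1[OF assms]]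
      forchheimer_form_eq_forch[OF X_L2_on[OF assms]])

lemma cbf_diff:
  assumes "u \<in> X" "x \<in> X" "y \<in> X"
  shows "cbf \<mu> \<alpha> \<beta> u (x - y) = cbf \<mu> \<alpha> \<beta> u x - cbf \<mu> \<alpha> \<beta> u y"
  unfolding cbf_def
  by (simp add: weak_grad_diff X_H1 assms inner_diff_right algebra_simps
      tri_diff(2)[OF X_integrable[OF assms(2)] X_integrable[OF assms(3)] X_integrable[OF assms(1)]]
      forch_diff[OF X_integrable[OF assms(1)] X_integrable[OF assms(2)] X_integrable[OF assms(3)]])

lemma cbf_measurable:
  assumes "v \<in> X" shows "(\<lambda>u. cbf \<mu> \<alpha> \<beta> u v) \<in> borel_measurable BX"
  unfolding cbf_def
  using stokes_measurable[OF X_V[OF assms]] tri_measurable_X[OF assms] inner_measurable_X[of v] forch_measurable[OF assms]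
  by simp

lemma L4_pow_le_energy: "u \<in> X \<Longrightarrow> L4_pow u \<le> energy u"
  using L4_bound(2)[OF X_integrable, of u 1] dirichlet_nonneg[of u] by (simp add: energy_def)

text \<open>The parameter \<open>k\<close> makes the contribution of the solution small, at the expense of a large multiple of the energy of the
  test function \<open>v\<close>. In the application \<open>v\<close> is a small increment of the path.\<close>

lemma cbf_bound:
  assumes u: "u \<in> X" and v: "v \<in> X" and k: "0 < k" and pos: "0 \<le> \<mu>" "0 \<le> \<alpha>" "0 \<le> \<beta>"
  shows "\<bar>cbf \<mu> \<alpha> \<beta> u v\<bar> \<le> k * (\<mu> + 2 + \<alpha> + \<beta>) * energy u
    + (\<mu> * (1 / k) + 1 / k ^ 3 + \<alpha> * (1 / k) + \<beta> * (1 / k) powr varpi) * energy v"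
proof -
  have "\<bar>weak_grad Q u \<bullet> weak_grad Q v\<bar> \<le> k * dirichlet u + 1 / k * dirichlet v"
    unfolding dirichlet_def by (rule abs_inner_le_weighted[OF k])
  also have "\<dots> \<le> k * energy u + 1 / k * energy v"
    using k energy_ge by (intro add_mono mult_left_mono) auto
  finally have 1: "\<mu> * \<bar>weak_grad Q u \<bullet> weak_grad Q v\<bar> \<le> \<mu> * (k * energy u + 1 / k * energy v)"
    using pos by (intro mult_left_mono)
  have "\<bar>tri u u v\<bar> \<le> k * dirichlet u + k * L4_pow u + 1 / k ^ 3 * L4_pow v"
    by (rule tri_bound(2)[OF X_integrable[OF u] X_integrable[OF v] k])
  also have "\<dots> \<le> k * energy u + k * energy u + 1 / k ^ 3 * energy v"
    using k energy_ge L4_pow_le_energy u v by (intro add_mono mult_left_mono) auto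
  finally have 2: "\<bar>tri u u v\<bar> \<le> k * energy u + k * energy u + 1 / k ^ 3 * energy v" .
  have "\<bar>u \<bullet> v\<bar> \<le> k * (norm u)\<^sup>2 + 1 / k * (norm v)\<^sup>2"
    by (rule abs_inner_le_weighted[OF k])
  also have "\<dots> \<le> k * energy u + 1 / k * energy v"
    using k energy_ge by (intro add_mono mult_left_mono) auto
  finally have 3: "\<alpha> * \<bar>u \<bullet> v\<bar> \<le> \<alpha> * (k * energy u + 1 / k * energy v)"
    using pos by (intro mult_left_mono)
  have "\<bar>forch u v\<bar> \<le> k * Lp_pow u + (1 / k) powr varpi * Lp_pow v"
    by (rule forch_bound[OF X_integrable[OF u] X_integrable[OF v] k])
  also have "\<dots> \<le> k * energy u + (1 / k) powr varpi * energy v"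
    using k energy_ge by (intro add_mono mult_left_mono) auto
  finally have 4: "\<beta> * \<bar>forch u v\<bar> \<le> \<beta> * (k * energy u + (1 / k) powr varpi * energy v)"
    using pos by (intro mult_left_mono)
  have "\<bar>cbf \<mu> \<alpha> \<beta> u v\<bar> \<le> \<mu> * \<bar>weak_grad Q u \<bullet> weak_grad Q v\<bar> + \<bar>tri u u v\<bar> + \<alpha> * \<bar>u \<bullet> v\<bar> + \<beta> * \<bar>forch u v\<bar>"
  proof -
    have "\<bar>a + b + c + d\<bar> \<le> \<bar>a\<bar> + \<bar>b\<bar> + \<bar>c\<bar> + \<bar>d\<bar>" for a b c d :: real by linarith
    from this[of "\<mu> * (weak_grad Q u \<bullet> weak_grad Q v)" "tri u u v" "\<alpha> * (u \<bullet> v)" "\<beta> * forch u v"]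
    show ?thesis using pos by (simp add: cbf_def abs_mult)
  qed
  also have "\<dots> \<le> \<mu> * (k * energy u + 1 / k * energy v) + (k * energy u + k * energy u + 1 / k ^ 3 * energy v)
      + \<alpha> * (k * energy u + 1 / k * energy v) + \<beta> * (k * energy u + (1 / k) powr varpi * energy v)"
    using 1 2 3 4 by linarith
  also have "\<dots> = k * (\<mu> + 2 + \<alpha> + \<beta>) * energy u
    + (\<mu> * (1 / k) + 1 / k ^ 3 + \<alpha> * (1 / k) + \<beta> * (1 / k) powr varpi) * energy v"
    by (simp add: algebra_simps)
  finally show ?thesis .
qed

lemma interpolant_energy_bound:
  assumes J: "interpolant Q c\<^sub>0 \<theta> J" and w: "w \<in> X" and c0: "0 \<le> c\<^sub>0" and k: "0 < k"
  shows "\<bar>J w \<bullet> d\<bar> \<le> k * (2 + 2 * (c\<^sub>0 * \<theta>\<^sup>2)) * energy w + 1 / k * energy d"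
proof -
  define s where "s = c\<^sub>0 * \<theta>\<^sup>2"
  have s: "0 \<le> s" using c0 by (simp add: s_def)
  have b: "(norm (w - J w))\<^sup>2 \<le> s * dirichlet w"
    using J X_V[OF w] by (auto simp: interpolant_def V_norm_def dirichlet_def s_def)
  have "(norm (w - (w - J w)))\<^sup>2 \<le> 2 * (norm w)\<^sup>2 + 2 * (norm (w - J w))\<^sup>2"
  proof -
    have "norm (w - (w - J w)) \<le> norm w + norm (w - J w)" by (rule norm_triangle_ineq4)
    then have "(norm (w - (w - J w)))\<^sup>2 \<le> (norm w + norm (w - J w))\<^sup>2" by (intro power_mono) auto
    also have "\<dots> \<le> 2 * (norm w)\<^sup>2 + 2 * (norm (w - J w))\<^sup>2"
      using sum_squares_bound[of "norm w" "norm (w - J w)"] by (simp add: power2_sum)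
    finally show ?thesis .
  qed
  also have "\<dots> \<le> 2 * energy w + 2 * (s * energy w)"
    using b energy_ge[of w] mult_left_mono[OF energy_ge(2)[of w] s] by (intro add_mono mult_left_mono) linarith+
  finally have Jb: "(norm (J w))\<^sup>2 \<le> (2 + 2 * s) * energy w" by (simp add: algebra_simps)
  have "\<bar>J w \<bullet> d\<bar> \<le> k * (norm (J w))\<^sup>2 + 1 / k * (norm d)\<^sup>2"
    by (rule abs_inner_le_weighted[OF k])
  also have "\<dots> \<le> k * ((2 + 2 * s) * energy w) + 1 / k * energy d"
    using Jb k energy_ge[of d] by (intro add_mono mult_left_mono) auto
  finally show ?thesis by (simp add: s_def mult.assoc)
qed

text \<open>Since \<open>tri U w w = 0\<close>, the difference of the convection terms is \<open>tri w u w = - tri w w u\<close>. Nudging contributes \<open>\<sigma> \<parallel>w\<parallel>\<^sup>2\<close>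
  up to the interpolation error, half of which is charged to the viscosity.\<close>

lemma nudged_difference_coercive:
  assumes u: "u \<in> X" and U: "U \<in> X" and J: "interpolant Q c\<^sub>0 \<theta> J"
    and pos: "0 < \<beta>" "0 < \<sigma>" and l: "0 < l"
    and absorb: "\<And>r. 0 \<le> r \<Longrightarrow> 1 / (2 * l) * r\<^sup>2 \<le> \<beta> / 2 * r powr q + c"
    and small: "\<sigma> * (c\<^sub>0 * \<theta>\<^sup>2) \<le> 2 * \<mu> - l"
  defines "w \<equiv> u - U"
  shows "(2 * \<alpha> + \<sigma> - 2 * c) * (norm w)\<^sup>2
    \<le> 2 * (cbf \<mu> \<alpha> \<beta> u w - cbf \<mu> \<alpha> \<beta> U w + \<sigma> * (J w \<bullet> w))"
proof -
  have wX: "w \<in> X" unfolding w_def by (rule X_diff[OF u U])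
  note i = X_integrable[OF u] X_integrable[OF U] X_integrable[OF wX]
  have "tri u u w - tri U u w = tri w u w"
    unfolding w_def by (rule tri_diff(1)[OF i(1,2) i(3)[unfolded w_def], symmetric])
  moreover have "tri U u w - tri U U w = tri U w w"
    unfolding w_def by (rule tri_diff(3)[OF i(2,2) i(3)[unfolded w_def] X_H1[OF u] X_H1[OF U], symmetric])
  moreover have "tri U w w = 0" by (rule tri_self_zero[OF U wX])
  moreover have "tri w u w = - tri w w u" by (rule tri_antisym[OF wX u wX])
  ultimately have "tri u u w - tri U U w = - tri w w u" by linarith
  then have B: "- (l / 2 * dirichlet w + \<beta> * (forch u w - forch U w) + c * (norm w)\<^sup>2) \<le> tri u u w - tri U U w"
    using convection_absorbed[OF u U pos(1) l absorb] unfolding w_def[symmetric] by linarith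
  have D: "weak_grad Q u \<bullet> weak_grad Q w - weak_grad Q U \<bullet> weak_grad Q w = dirichlet w"
    unfolding dirichlet_def w_def weak_grad_diff[OF X_H1[OF u] X_H1[OF U]] power2_norm_eq_inner
    by (simp add: inner_diff_left)
  have A: "u \<bullet> w - U \<bullet> w = (norm w)\<^sup>2"
    unfolding w_def power2_norm_eq_inner by (simp add: inner_diff_left)
  have "\<bar>(w - J w) \<bullet> w\<bar> \<le> 1 / 2 * (norm (w - J w))\<^sup>2 + 1 / 2 * (norm w)\<^sup>2"
    using Cauchy_Schwarz_ineq2[of "w - J w" w] sum_squares_bound[of "norm (w - J w)" "norm w"] by simp
  moreover have "(norm (w - J w))\<^sup>2 \<le> c\<^sub>0 * \<theta>\<^sup>2 * dirichlet w"
    using J X_V[OF wX] by (auto simp: interpolant_def V_norm_def dirichlet_def)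
  moreover have "(w - J w) \<bullet> w = (norm w)\<^sup>2 - J w \<bullet> w"
    by (simp add: inner_diff_left power2_norm_eq_inner)
  ultimately have "(norm w)\<^sup>2 - J w \<bullet> w \<le> 1 / 2 * (c\<^sub>0 * \<theta>\<^sup>2 * dirichlet w) + 1 / 2 * (norm w)\<^sup>2"
    by linarith
  then have "\<sigma> * ((norm w)\<^sup>2 - J w \<bullet> w) \<le> \<sigma> * (1 / 2 * (c\<^sub>0 * \<theta>\<^sup>2 * dirichlet w) + 1 / 2 * (norm w)\<^sup>2)"
    using pos by (intro mult_left_mono) auto
  moreover have "\<sigma> * (c\<^sub>0 * \<theta>\<^sup>2) * dirichlet w \<le> (2 * \<mu> - l) * dirichlet w"
    by (rule mult_right_mono[OF small dirichlet_nonneg])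
  ultimately have C: "\<sigma> * (norm w)\<^sup>2 - (2 * \<mu> - l) * dirichlet w \<le> 2 * (\<sigma> * (J w \<bullet> w))"
    by (simp add: algebra_simps)
  have "cbf \<mu> \<alpha> \<beta> u w - cbf \<mu> \<alpha> \<beta> U w = \<mu> * dirichlet w + (tri u u w - tri U U w) + \<alpha> * (norm w)\<^sup>2 + \<beta> * (forch u w - forch U w)"
    unfolding cbf_def D[symmetric] A[symmetric] by (simp add: algebra_simps)
  then show ?thesis using B C by (simp add: algebra_simps)
qed

end

section \<open>Exponential synchronization of the paths\<close>

text \<open>The integrands in the weak formulation are known only at almost every time. Completeness of
  Lebesgue measure transfers measurability to them, and with it the values of the integrals.\<close>

lemma borel_measurable_completion_cong_AE:
  fixes f g :: "'a \<Rightarrow> real"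
  assumes g: "g \<in> borel_measurable (completion M)" and eq: "AE x in M. f x = g x"
  shows "f \<in> borel_measurable (completion M)"
proof (rule measurableI)
  fix A :: "real set" assume "A \<in> sets borel"
  then have "g -` A \<inter> space (completion M) \<in> sets (completion M)" by (rule measurable_sets[OF g])
  then show "f -` A \<inter> space (completion M) \<in> sets (completion M)"
  proof (rule completion.in_sets_AE[rotated])
    show "AE x in completion M. x \<in> g -` A \<inter> space (completion M) \<longleftrightarrow> x \<in> f -` A \<inter> space (completion M)"
      using AE_completion[OF eq] by eventually_elim auto
  qed simp
qed simp

lemma set_integral_lebesgue_cong_AE:
  fixes f g :: "real \<Rightarrow> real"
  assumes g: "set_integrable lebesgue A g" and eq: "AE t in lborel. t \<in> A \<longrightarrow> f t = g t"
  shows "(LINT t:A|lebesgue. f t) = (LINT t:A|lebesgue. g t)"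
proof -
  have eq': "AE t in lborel. indicator A t *\<^sub>R f t = indicator A t *\<^sub>R g t"
    using eq by eventually_elim (auto simp: indicator_def)
  have gm: "(\<lambda>t. indicator A t *\<^sub>R g t) \<in> borel_measurable lebesgue"
    using g unfolding set_integrable_def by (rule borel_measurable_integrable)
  show ?thesis
    unfolding set_lebesgue_integral_def
    by (rule integral_cong_AE[OF borel_measurable_completion_cong_AE[OF gm eq'] gm AE_completion[OF eq']])
qed

context brinkman_forchheimer
begin

lemma energy_measurable: "energy \<in> borel_measurable BX"
proof -
  have "(\<lambda>u. enn2real (lsc_energy u)) \<in> borel_measurable BX"
    by (intro measurable_restrict_space1) measurable
  moreover have "energy u = enn2real (lsc_energy u)" if "u \<in> space BX" for u
    using that lsc_energy_eq_energy[of u] energy_nonneg[of u] by (simp add: space_restrict_space)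
  ultimately show ?thesis
    using measurable_cong[of BX energy "\<lambda>u. enn2real (lsc_energy u)" borel] by blast
qed

lemma energy_diff_le:
  assumes "u \<in> X" "v \<in> X"
  shows "energy (u - v) \<le> 2 powr p * ((energy u + energy v) / 2)"
proof -
  have "energy (u - v) \<le> 2 powr p * energy ((1/2) *\<^sub>R (u - v))"
    by (rule energy_le_half[OF X_diff[OF assms]])
  also have "\<dots> \<le> 2 powr p * ((energy u + energy v) / 2)"
    using energy_Clarkson[OF assms] energy_nonneg[of "(1/2) *\<^sub>R (u + v)"] by (intro mult_left_mono) auto
  finally show ?thesis .
qed

text \<open>A path defined for \<open>t \<ge> 0\<close> is extended by its initial value, so that continuity and Borel
  measurability can be stated on the whole line.\<close>

definition energy_path :: "(real \<Rightarrow> 'd vfield) \<Rightarrow> bool" where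
  "energy_path w \<longleftrightarrow> continuous_on UNIV w \<and> (AE t in lborel. 0 \<le> t \<longrightarrow> w t \<in> X) \<and>
     (\<forall>T. set_integrable lebesgue {0..T} (\<lambda>t. energy (w t)))"

text \<open>Outside a Borel null set the path takes values in \<open>X\<close>, and there the composition is Borel measurable.\<close>

lemma path_measurable:
  fixes w :: "real \<Rightarrow> 'd vfield"
  assumes w: "continuous_on UNIV w" "AE t in lborel. 0 \<le> t \<longrightarrow> w t \<in> X" and F: "F \<in> borel_measurable BX"
  shows "(\<lambda>t. indicator {0..T} t *\<^sub>R (F (w t) :: real)) \<in> borel_measurable lebesgue"
proof -
  obtain N where N: "{t \<in> space lborel. \<not> (0 \<le> t \<longrightarrow> w t \<in> X)} \<subseteq> N" "N \<in> null_sets lborel"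
    using w(2) by (auto elim!: AE_E simp: null_sets_def)
  define A where "A = {0..T} - N"
  have A: "A \<in> sets borel" unfolding A_def by (rule sets.Diff) (use null_setsD2[OF N(2)] in simp_all)
  have "w \<in> measurable (restrict_space borel A) BX"
    by (rule measurable_restrict_space3[OF borel_measurable_continuous_onI[OF w(1)]]) (use N(1) in \<open>auto simp: A_def\<close>)
  then have "(\<lambda>t. F (w t)) \<in> borel_measurable (restrict_space borel A)"
    by (rule measurable_compose[OF _ F])
  then have "(\<lambda>t. indicator A t *\<^sub>R F (w t)) \<in> borel_measurable borel"
    using A by (subst (asm) borel_measurable_restrict_space_iff) auto
  then have "(\<lambda>t. indicator A t *\<^sub>R F (w t)) \<in> borel_measurable lebesgue"
    by (intro measurable_completion) simp
  moreover have "AE t in lborel. indicator {0..T} t *\<^sub>R F (w t) = indicator A t *\<^sub>R F (w t)"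
    using AE_not_in[OF N(2)] by eventually_elim (auto simp: A_def indicator_def)
  ultimately show ?thesis by (rule borel_measurable_completion_cong_AE)
qed

lemma path_set_integrable:
  assumes w: "energy_path w" and F: "F \<in> borel_measurable BX"
    and bound: "\<And>u. u \<in> X \<Longrightarrow> \<bar>F u\<bar> \<le> a * energy u + b" and s: "0 \<le> s"
  shows "set_integrable lebesgue {s..t} (\<lambda>r. F (w r) :: real)"
proof -
  have wc: "continuous_on UNIV w" and wX: "AE t in lborel. 0 \<le> t \<longrightarrow> w t \<in> X"
    and wi: "set_integrable lebesgue {0..t} (\<lambda>r. energy (w r))"
    using w by (auto simp: energy_path_def)
  have "set_integrable lebesgue {0..t} (\<lambda>r. a * energy (w r) + b)"
    by (intro set_integral_add(1) set_integrable_mult_right wi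
        absolutely_integrable_continuous_real continuous_on_const)
  moreover have "set_borel_measurable lebesgue {0..t} (\<lambda>r. F (w r))"
    unfolding set_borel_measurable_def by (rule path_measurable[OF wc wX F])
  moreover have "AE r in lebesgue. r \<in> {0..t} \<longrightarrow> norm (F (w r)) \<le> norm (a * energy (w r) + b)"
    using AE_completion[OF wX]
  proof eventually_elim
    case (elim r)
    then show ?case using bound[of "w r"] by auto
  qed
  ultimately have "set_integrable lebesgue {0..t} (\<lambda>r. F (w r))"
    by (rule set_integrable_bound)
  then show ?thesis
    by (rule set_integrable_subset) (use s in auto)
qed

lemma energy_path_diff:
  assumes u: "energy_path u" and v: "energy_path v"
  shows "energy_path (\<lambda>t. u t - v t)"
proof -
  let ?w = "\<lambda>t. u t - v t"
  have c: "continuous_on UNIV ?w"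
    using u v by (auto simp: energy_path_def intro: continuous_on_diff)
  have X: "AE t in lborel. 0 \<le> t \<longrightarrow> u t \<in> X" "AE t in lborel. 0 \<le> t \<longrightarrow> v t \<in> X"
    using u v by (auto simp: energy_path_def)
  have wX: "AE t in lborel. 0 \<le> t \<longrightarrow> ?w t \<in> X"
    using X by eventually_elim (auto intro: X_diff)
  have "set_integrable lebesgue {0..T} (\<lambda>t. energy (?w t))" for T
  proof (rule set_integrable_bound)
    show "set_integrable lebesgue {0..T} (\<lambda>t. 2 powr p / 2 * energy (u t) + 2 powr p / 2 * energy (v t))"
      using u v by (intro set_integral_add(1) set_integrable_mult_right) (auto simp: energy_path_def)
    show "set_borel_measurable lebesgue {0..T} (\<lambda>t. energy (?w t))"
      unfolding set_borel_measurable_def by (rule path_measurable[OF c wX energy_measurable])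
    show "AE t in lebesgue. t \<in> {0..T} \<longrightarrow> norm (energy (?w t)) \<le> norm (2 powr p / 2 * energy (u t) + 2 powr p / 2 * energy (v t))"
      using AE_completion[OF X(1)] AE_completion[OF X(2)]
    proof eventually_elim
      case (elim t)
      show ?case
      proof
        assume "t \<in> {0..T}"
        then have "u t \<in> X" "v t \<in> X" using elim by auto
        from energy_diff_le[OF this] have le: "energy (?w t) \<le> 2 powr p / 2 * energy (u t) + 2 powr p / 2 * energy (v t)"
          by (simp add: distrib_left add_divide_distrib)
        then show "norm (energy (?w t)) \<le> norm (2 powr p / 2 * energy (u t) + 2 powr p / 2 * energy (v t))"
          using energy_nonneg[of "?w t"] by simp
      qed
    qed
  qed
  with c wX show ?thesis by (simp add: energy_path_def)
qed

lemma energy_path_lsc_energy_finite: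
  assumes "energy_path w" shows "(\<integral>\<^sup>+t. lsc_energy (w t) * indicator {0..T} t \<partial>lborel) < \<infinity>"
proof -
  have X: "AE t in lborel. 0 \<le> t \<longrightarrow> w t \<in> X"
    and i: "integrable lebesgue (\<lambda>t. indicator {0..T} t *\<^sub>R energy (w t))"
    using assms by (auto simp: energy_path_def set_integrable_def)
  have "(\<integral>\<^sup>+t. lsc_energy (w t) * indicator {0..T} t \<partial>lborel) = (\<integral>\<^sup>+t. lsc_energy (w t) * indicator {0..T} t \<partial>lebesgue)"
    by (rule nn_integral_completion[symmetric])
  also have "\<dots> = (\<integral>\<^sup>+t. ennreal (norm (indicator {0..T} t *\<^sub>R energy (w t))) \<partial>lebesgue)"
  proof (rule nn_integral_cong_AE)
    show "AE t in lebesgue. lsc_energy (w t) * indicator {0..T} t = ennreal (norm (indicator {0..T} t *\<^sub>R energy (w t)))"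
      using AE_completion[OF X]
    proof eventually_elim
      case (elim t)
      then show ?case
        using lsc_energy_eq_energy[of "w t"] energy_nonneg[of "w t"] by (cases "t \<in> {0..T}") auto
    qed
  qed
  also have "\<dots> < \<infinity>"
    using i by (simp add: integrable_iff_bounded)
  finally show ?thesis .
qed

lemma solution_path_energy_path:
  assumes "solution_path Q varpi u"
  shows "energy_path (\<lambda>t. u (max 0 t))"
proof -
  have c: "continuous_on {0..} u" and V: "AE t in lebesgue. 0 \<le> t \<longrightarrow> u t \<in> V_space Q \<inter> Lp_space Q p"
    and i1: "\<And>T. 0 < T \<Longrightarrow> set_integrable lebesgue {0..T} (\<lambda>t. (V_norm Q (u t))\<^sup>2)"
    and i2: "\<And>T. 0 < T \<Longrightarrow> set_integrable lebesgue {0..T} (\<lambda>t. Lp_norm p (u t) powr p)"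
    using assms by (auto simp: solution_path_def)
  have c': "continuous_on UNIV (\<lambda>t. u (max 0 t))"
    by (rule continuous_on_compose2[OF c]) (auto intro!: continuous_intros)
  have "AE t in lborel. 0 \<le> t \<longrightarrow> u t \<in> V_space Q \<inter> Lp_space Q p"
    using V by (simp only: AE_completion_iff)
  then have "AE t in lborel. 0 \<le> t \<longrightarrow> u (max 0 t) \<in> X"
    by eventually_elim (auto simp: X_def)
  moreover have "set_integrable lebesgue {0..T} (\<lambda>t. energy (u (max 0 t)))" for T
  proof -
    define T' where "T' = max 1 T"
    have T': "0 < T'" "T \<le> T'" by (auto simp: T'_def)
    have "continuous_on {0..T'} (\<lambda>t. (norm (u t))\<^sup>2)"
      by (intro continuous_intros continuous_on_subset[OF c]) auto
    then have "set_integrable lebesgue {0..T'} (\<lambda>t. (norm (u t))\<^sup>2)"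
      by (rule absolutely_integrable_continuous_real)
    then have "set_integrable lebesgue {0..T'} (\<lambda>t. (norm (u t))\<^sup>2 + (V_norm Q (u t))\<^sup>2 + Lp_norm p (u t) powr p)"
      by (intro set_integral_add(1) i1 i2 T')
    then have "set_integrable lebesgue {0..T} (\<lambda>t. (norm (u t))\<^sup>2 + (V_norm Q (u t))\<^sup>2 + Lp_norm p (u t) powr p)"
      by (rule set_integrable_subset) (use T' in auto)
    also have "?this \<longleftrightarrow> ?thesis"
      unfolding set_integrable_def
      by (rule Bochner_Integration.integrable_cong)
         (auto simp: indicator_def energy_def dirichlet_def V_norm_def Lp_norm_powr)
    finally show ?thesis .
  qed
  ultimately show ?thesis using c' by (simp add: energy_path_def)
qed

lemma lsc_energy_translation_continuity:
  assumes w: "energy_path w" and T: "0 \<le> T" and e: "(0::real) < e"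
  shows "\<exists>h0>0. \<forall>h. 0 \<le> h \<and> h < h0 \<longrightarrow> (\<integral>\<^sup>+t. lsc_energy (w (t + h) - w t) * indicator {0..T} t \<partial>lborel) \<le> ennreal e"
proof -
  define K where "K = (2::real) powr p"
  have K: "0 < K" by (simp add: K_def)
  have c: "continuous_on UNIV w" and X: "AE t in lborel. 0 \<le> t \<longrightarrow> w t \<in> X"
    using w by (auto simp: energy_path_def)
  have "\<exists>h0>0. \<forall>h. 0 \<le> h \<and> h < h0 \<longrightarrow>
      (\<integral>\<^sup>+t. lsc_energy ((1/2) *\<^sub>R (w (t + h) - w t)) * indicator {0..T} t \<partial>lborel) \<le> ennreal (e / K)"
  proof (rule translation_continuity[OF open_lsc_energy_greater c X _ energy_path_lsc_energy_finite[OF w] T])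
    show "0 < e / K" using e K by simp
    fix a b assume ab: "a \<in> X" "b \<in> X"
    have "2 * energy ((1/2) *\<^sub>R (a - b)) + 2 * energy ((1/2) *\<^sub>R (a + b)) \<le> energy a + energy b"
      using energy_Clarkson[OF ab] by simp
    then have "ennreal (2 * energy ((1/2) *\<^sub>R (a - b)) + 2 * energy ((1/2) *\<^sub>R (a + b))) \<le> ennreal (energy a + energy b)"
      by (rule ennreal_leI)
    then show "2 * lsc_energy ((1/2) *\<^sub>R (a - b)) + 2 * lsc_energy ((1/2) *\<^sub>R (a + b)) \<le> lsc_energy a + lsc_energy b"
      by (simp add: lsc_energy_eq_energy X_diff X_add X_scaleR ab energy_nonneg ennreal_mult)
  qed
  then obtain h0 where h0: "0 < h0" "\<And>h. 0 \<le> h \<Longrightarrow> h < h0 \<Longrightarrow>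
      (\<integral>\<^sup>+t. lsc_energy ((1/2) *\<^sub>R (w (t + h) - w t)) * indicator {0..T} t \<partial>lborel) \<le> ennreal (e / K)"
    by blast
  show ?thesis
  proof (intro exI[of _ h0] conjI allI impI h0(1))
    fix h assume h: "0 \<le> h \<and> h < h0"
    have "continuous_on UNIV (\<lambda>t. (1/2) *\<^sub>R (w (t + h) - w t))"
      by (intro continuous_intros continuous_on_compose2[OF c]; simp)
    then have m: "(\<lambda>t. lsc_energy ((1/2) *\<^sub>R (w (t + h) - w t))) \<in> borel_measurable borel"
      using measurable_compose[OF borel_measurable_continuous_onI lsc_energy_borel_measurable] by blast
    have "(\<integral>\<^sup>+t. lsc_energy (w (t + h) - w t) * indicator {0..T} t \<partial>lborel)
        \<le> (\<integral>\<^sup>+t. ennreal K * (lsc_energy ((1/2) *\<^sub>R (w (t + h) - w t)) * indicator {0..T} t) \<partial>lborel)"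
    proof (rule nn_integral_mono_AE)
      show "AE t in lborel. lsc_energy (w (t + h) - w t) * indicator {0..T} t
          \<le> ennreal K * (lsc_energy ((1/2) *\<^sub>R (w (t + h) - w t)) * indicator {0..T} t)"
        using X AE_shift[OF X conjunct1[OF h]]
      proof eventually_elim
        case (elim t)
        show ?case
        proof (cases "t \<in> {0..T}")
          case True
          then have d: "w (t + h) - w t \<in> X" using elim by (auto intro: X_diff)
          have "ennreal (energy (w (t + h) - w t)) \<le> ennreal (K * energy ((1/2) *\<^sub>R (w (t + h) - w t)))"
            unfolding K_def by (intro ennreal_leI energy_le_half d)
          then show ?thesis
            using True K by (simp add: lsc_energy_eq_energy[OF d] lsc_energy_eq_energy[OF X_scaleR[OF d]] ennreal_mult energy_nonneg)
        qed simp
      qed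
    qed
    also have "\<dots> = ennreal K * (\<integral>\<^sup>+t. lsc_energy ((1/2) *\<^sub>R (w (t + h) - w t)) * indicator {0..T} t \<partial>lborel)"
      using m by (intro nn_integral_cmult) simp
    also have "\<dots> \<le> ennreal K * ennreal (e / K)"
      using h by (intro mult_left_mono h0(2)) auto
    also have "\<dots> = ennreal e"
      using K e by (simp add: ennreal_mult[symmetric])
    finally show "(\<integral>\<^sup>+t. lsc_energy (w (t + h) - w t) * indicator {0..T} t \<partial>lborel) \<le> ennreal e" .
  qed
qed

text \<open>The deterministic statement for a single realization. The common forcing \<open>N\<close> contains the external force and the noise; it
  cancels in the difference.\<close>

lemma nudged_path_synchronizes:
  assumes pos: "0 < \<mu>" "0 < \<alpha>" "0 < \<beta>" "0 < \<sigma>" "0 \<le> c\<^sub>0"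
    and J: "interpolant Q c\<^sub>0 \<theta> J"
    and l: "0 < l" and absorb: "\<And>r. 0 \<le> r \<Longrightarrow> 1 / (2 * l) * r\<^sup>2 \<le> \<beta> / 2 * r powr q + c"
    and small: "\<sigma> * (c\<^sub>0 * \<theta>\<^sup>2) \<le> 2 * \<mu> - l" and rate: "0 < 2 * \<alpha> + \<sigma> - 2 * c"
    and u: "solution_path Q varpi u" and U: "solution_path Q varpi U"
    and eq_u: "\<And>v t. v \<in> X \<Longrightarrow> 0 \<le> t \<Longrightarrow>
      u t \<bullet> v + (LINT s:{0..t}|lebesgue. cbf_form Q \<mu> \<alpha> \<beta> varpi (u s) v) = u\<^sub>0 \<bullet> v + N t v"
    and eq_U: "\<And>v t. v \<in> X \<Longrightarrow> 0 \<le> t \<Longrightarrow>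
      U t \<bullet> v + (LINT s:{0..t}|lebesgue. cbf_form Q \<mu> \<alpha> \<beta> varpi (U s) v) = U\<^sub>0 \<bullet> v + N t v
        - \<sigma> * (LINT s:{0..t}|lebesgue. helmholtz Q (J (U s - u s)) \<bullet> v)"
  shows "exponentially_fast (\<lambda>t. norm (u t - U t))"
proof -
  define ue where "ue t = u (max 0 t)" for t
  define Ue where "Ue t = U (max 0 t)" for t
  define w where "w t = ue t - Ue t" for t
  have ue: "energy_path ue" and Ue: "energy_path Ue"
    using solution_path_energy_path[OF u] solution_path_energy_path[OF U] by (simp_all add: ue_def[abs_def] Ue_def[abs_def])
  have w: "energy_path w"
    using energy_path_diff[OF ue Ue] by (simp add: w_def[abs_def])
  have wc: "continuous_on UNIV w" and wX: "AE t in lborel. 0 \<le> t \<longrightarrow> w t \<in> X"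
    and ueX: "AE t in lborel. 0 \<le> t \<longrightarrow> ue t \<in> X" and UeX: "AE t in lborel. 0 \<le> t \<longrightarrow> Ue t \<in> X"
    and uec: "continuous_on UNIV ue" and Uec: "continuous_on UNIV Ue"
    using w ue Ue by (auto simp: energy_path_def)
  define g where "g r v = cbf \<mu> \<alpha> \<beta> (ue r) v - cbf \<mu> \<alpha> \<beta> (Ue r) v + \<sigma> * (J (w r) \<bullet> v)" for r v
  define K where "K = \<mu> + 2 + \<alpha> + \<beta> + \<sigma> * (2 + 2 * (c\<^sub>0 * \<theta>\<^sup>2))"
  have K: "0 < K" "\<mu> + 2 + \<alpha> + \<beta> \<le> K" "\<sigma> * (2 + 2 * (c\<^sub>0 * \<theta>\<^sup>2)) \<le> K"
    using pos by (auto simp: K_def intro!: add_pos_nonneg)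
  have pos': "0 \<le> \<mu>" "0 \<le> \<alpha>" "0 \<le> \<beta>" using pos by auto
  have cbf_int: "set_integrable lebesgue {s..t} (\<lambda>r. cbf \<mu> \<alpha> \<beta> (x r) v)"
    if "energy_path x" "v \<in> X" "0 \<le> s" for x v s t
    by (rule path_set_integrable[OF that(1) cbf_measurable[OF that(2)] cbf_bound[OF _ that(2) zero_less_one pos'] that(3)])
  have J_int: "set_integrable lebesgue {s..t} (\<lambda>r. J (w r) \<bullet> v)" if "v \<in> X" "0 \<le> s" for v s t
    by (rule path_set_integrable[OF w interpolant_measurable[OF J] interpolant_energy_bound[OF J _ pos(5) zero_less_one] that(2)])
  have g_int: "set_integrable lebesgue {s..t} (\<lambda>r. g r v)" if "v \<in> X" "0 \<le> s" for v s t
    unfolding g_def using that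
    by (intro set_integral_add(1) set_integral_diff(1) set_integrable_mult_right cbf_int J_int ue Ue)
  have weak0: "w t \<bullet> v = (u\<^sub>0 - U\<^sub>0) \<bullet> v - (LINT r:{0..t}|lebesgue. g r v)" if v: "v \<in> X" and t: "0 \<le> t" for v t
  proof -
    have vH: "v \<in> H_space Q" using V_subset_H X_V[OF v] by blast
    have 1: "(LINT s:{0..t}|lebesgue. cbf_form Q \<mu> \<alpha> \<beta> varpi (u s) v) = (LINT r:{0..t}|lebesgue. cbf \<mu> \<alpha> \<beta> (ue r) v)"
    proof (rule set_integral_lebesgue_cong_AE[OF cbf_int[OF ue v order_refl]])
      show "AE r in lborel. r \<in> {0..t} \<longrightarrow> cbf_form Q \<mu> \<alpha> \<beta> varpi (u r) v = cbf \<mu> \<alpha> \<beta> (ue r) v"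
        using ueX by eventually_elim (auto simp: ue_def cbf_form_eq_cbf)
    qed
    have 2: "(LINT s:{0..t}|lebesgue. cbf_form Q \<mu> \<alpha> \<beta> varpi (U s) v) = (LINT r:{0..t}|lebesgue. cbf \<mu> \<alpha> \<beta> (Ue r) v)"
    proof (rule set_integral_lebesgue_cong_AE[OF cbf_int[OF Ue v order_refl]])
      show "AE r in lborel. r \<in> {0..t} \<longrightarrow> cbf_form Q \<mu> \<alpha> \<beta> varpi (U r) v = cbf \<mu> \<alpha> \<beta> (Ue r) v"
        using UeX by eventually_elim (auto simp: Ue_def cbf_form_eq_cbf)
    qed
    have "(LINT s:{0..t}|lebesgue. helmholtz Q (J (U s - u s)) \<bullet> v) = (LINT r:{0..t}|lebesgue. (-1) * (J (w r) \<bullet> v))"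
    proof (rule set_integral_lebesgue_cong_AE[OF set_integrable_mult_right])
      show "set_integrable lebesgue {0..t} (\<lambda>r. J (w r) \<bullet> v)" by (rule J_int[OF v order_refl])
      show "AE r in lborel. r \<in> {0..t} \<longrightarrow> helmholtz Q (J (U r - u r)) \<bullet> v = (-1) * (J (w r) \<bullet> v)"
        using wX
      proof eventually_elim
        case (elim r)
        show ?case
        proof
          assume r: "r \<in> {0..t}"
          then have "w r \<in> X" "U r - u r = (-1) *\<^sub>R w r" using elim by (auto simp: w_def ue_def Ue_def)
          then show "helmholtz Q (J (U r - u r)) \<bullet> v = (-1) * (J (w r) \<bullet> v)"
            using interpolant_scaleR[OF J X_H1, of "w r" "-1"] by (simp add: helmholtz_inner[OF vH])
        qed
      qed
    qed
    then have 3: "(LINT s:{0..t}|lebesgue. helmholtz Q (J (U s - u s)) \<bullet> v) = - (LINT r:{0..t}|lebesgue. J (w r) \<bullet> v)"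
      unfolding set_integral_mult_right by simp
    have "(LINT r:{0..t}|lebesgue. g r v) = (LINT r:{0..t}|lebesgue. cbf \<mu> \<alpha> \<beta> (ue r) v)
        - (LINT r:{0..t}|lebesgue. cbf \<mu> \<alpha> \<beta> (Ue r) v) + \<sigma> * (LINT r:{0..t}|lebesgue. J (w r) \<bullet> v)"
      unfolding g_def
      using cbf_int[OF ue v order_refl, of t] cbf_int[OF Ue v order_refl, of t] J_int[OF v order_refl, of t]
      by (simp add: set_integral_add set_integral_diff)
    moreover have "w t \<bullet> v = u t \<bullet> v - U t \<bullet> v" using t by (simp add: w_def ue_def Ue_def inner_diff_left)
    ultimately show ?thesis
      using eq_u[OF v t] eq_U[OF v t] unfolding 1 2 3 by (simp add: inner_diff_left algebra_simps)
  qed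
  define m where "m r = lsc_energy (ue r) + lsc_energy (Ue r) + lsc_energy (w r)" for r
  have meas: "(\<lambda>r. lsc_energy (x r)) \<in> borel_measurable borel" if "continuous_on UNIV x" for x :: "real \<Rightarrow> 'd vfield"
    using measurable_compose[OF borel_measurable_continuous_onI[OF that] lsc_energy_borel_measurable] .
  note [measurable] = meas[OF uec] meas[OF Uec] meas[OF wc]
  define \<kappa> where "\<kappa> = 2 * \<alpha> + \<sigma> - 2 * c"
  have ineq: "(norm (w b))\<^sup>2 + \<kappa> * integral {a..b} (\<lambda>t. (norm (w t))\<^sup>2) \<le> (norm (w a))\<^sup>2" if ab: "0 \<le> a" "a \<le> b" for a b
  proof (rule energy_inequality[OF wc wX X_diff lsc_energy_borel_measurable _ _ lsc_energy_translation_continuity[OF w] g_int])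
    show "m \<in> borel_measurable borel" unfolding m_def by measurable
    show "(\<integral>\<^sup>+t. m t * indicator {0..T} t \<partial>lborel) < \<infinity>" for T
      using energy_path_lsc_energy_finite[OF ue, of T] energy_path_lsc_energy_finite[OF Ue, of T] energy_path_lsc_energy_finite[OF w, of T]
      unfolding m_def by (simp add: distrib_right nn_integral_add)
    show "(w t - w s) \<bullet> v = - (LINT r:{s..t}|lebesgue. g r v)" if "v \<in> X" "0 \<le> s" "s \<le> t" for v s t
    proof -
      have t: "0 \<le> t" using that by simp
      have "integral {0..s} (\<lambda>r. g r v) + integral {s..t} (\<lambda>r. g r v) = integral {0..t} (\<lambda>r. g r v)"
        using that by (intro Henstock_Kurzweil_Integration.integral_combine
            set_lebesgue_integral_eq_integral(1)[OF g_int]) auto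
      then show ?thesis
        unfolding inner_diff_left weak0[OF that(1) t] weak0[OF that(1,2)]
        using that by (simp add: set_lebesgue_integral_eq_integral(2)[OF g_int])
    qed
    show "AE r in lborel. 0 \<le> r \<longrightarrow> (\<forall>x\<in>X. \<forall>y\<in>X. g r (x - y) = g r x - g r y)"
      using ueX UeX
      by eventually_elim (auto simp: g_def cbf_diff inner_diff_right algebra_simps)
    show "AE r in lborel. 0 \<le> r \<longrightarrow> \<kappa> * (norm (w r))\<^sup>2 \<le> 2 * g r (w r)"
      using ueX UeX
    proof eventually_elim
      case (elim r)
      then show ?case
        using nudged_difference_coercive[OF _ _ J pos(3,4) l absorb small, of "ue r" "Ue r" \<alpha>]
        by (simp add: g_def w_def \<kappa>_def)
    qed
    show "\<exists>C\<ge>0. AE r in lborel. 0 \<le> r \<longrightarrow> (\<forall>d\<in>X. ennreal \<bar>g r d\<bar> \<le> ennreal e * m r + ennreal C * lsc_energy d)"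
      if e: "(0::real) < e" for e
    proof -
      define k where "k = e / K"
      have k: "0 < k" "k * K = e" using e K by (auto simp: k_def)
      define C1 where "C1 = \<mu> * (1 / k) + 1 / k ^ 3 + \<alpha> * (1 / k) + \<beta> * (1 / k) powr varpi"
      define C where "C = 2 * C1 + \<sigma> * (1 / k)"
      have C: "0 \<le> C" using k pos by (simp add: C_def C1_def)
      have le: "\<bar>g r d\<bar> \<le> e * (energy (ue r) + energy (Ue r) + energy (w r)) + C * energy d"
        if "ue r \<in> X" "Ue r \<in> X" "w r \<in> X" and d: "d \<in> X" for r d
      proof -
        have kK: "k * (\<mu> + 2 + \<alpha> + \<beta>) \<le> e" "k * (\<sigma> * (2 + 2 * (c\<^sub>0 * \<theta>\<^sup>2))) \<le> e"
          using K k by (auto simp flip: k(2) intro!: mult_left_mono)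
        have 1: "\<bar>cbf \<mu> \<alpha> \<beta> x d\<bar> \<le> e * energy x + C1 * energy d" if "x \<in> X" for x
        proof -
          have "\<bar>cbf \<mu> \<alpha> \<beta> x d\<bar> \<le> k * (\<mu> + 2 + \<alpha> + \<beta>) * energy x + C1 * energy d"
            unfolding C1_def by (rule cbf_bound[OF that d k(1) pos'])
          also have "k * (\<mu> + 2 + \<alpha> + \<beta>) * energy x \<le> e * energy x"
            by (rule mult_right_mono[OF kK(1) energy_nonneg])
          finally show ?thesis by simp
        qed
        have "\<sigma> * \<bar>J (w r) \<bullet> d\<bar> \<le> \<sigma> * (k * (2 + 2 * (c\<^sub>0 * \<theta>\<^sup>2)) * energy (w r) + 1 / k * energy d)"
          using pos by (intro mult_left_mono interpolant_energy_bound[OF J that(3) pos(5) k(1)]) auto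
        also have "\<dots> = k * (\<sigma> * (2 + 2 * (c\<^sub>0 * \<theta>\<^sup>2))) * energy (w r) + \<sigma> * (1 / k) * energy d"
          by (simp add: algebra_simps)
        also have "\<dots> \<le> e * energy (w r) + \<sigma> * (1 / k) * energy d"
          by (intro add_right_mono mult_right_mono[OF kK(2) energy_nonneg])
        finally have 2: "\<bar>\<sigma> * (J (w r) \<bullet> d)\<bar> \<le> e * energy (w r) + \<sigma> * (1 / k) * energy d"
          using pos by (simp add: abs_mult)
        have "\<bar>g r d\<bar> \<le> \<bar>cbf \<mu> \<alpha> \<beta> (ue r) d\<bar> + \<bar>cbf \<mu> \<alpha> \<beta> (Ue r) d\<bar> + \<bar>\<sigma> * (J (w r) \<bullet> d)\<bar>"
          unfolding g_def by linarith
        also have "\<dots> \<le> (e * energy (ue r) + C1 * energy d) + (e * energy (Ue r) + C1 * energy d) + (e * energy (w r) + \<sigma> * (1 / k) * energy d)"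
          by (intro add_mono 1 2 that)
        finally show ?thesis by (simp add: C_def algebra_simps)
      qed
      show ?thesis
      proof (intro exI[of _ C] conjI C)
        show "AE r in lborel. 0 \<le> r \<longrightarrow> (\<forall>d\<in>X. ennreal \<bar>g r d\<bar> \<le> ennreal e * m r + ennreal C * lsc_energy d)"
          using ueX UeX wX
        proof eventually_elim
          case (elim r)
          show ?case
          proof (intro impI ballI)
            fix d assume r: "0 \<le> r" and d: "d \<in> X"
            have X: "ue r \<in> X" "Ue r \<in> X" "w r \<in> X" using elim r by auto
            have "ennreal \<bar>g r d\<bar> \<le> ennreal (e * (energy (ue r) + energy (Ue r) + energy (w r)) + C * energy d)"
              by (rule ennreal_leI[OF le[OF X d]])
            also have "\<dots> = ennreal e * m r + ennreal C * lsc_energy d"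
              using e C by (simp add: m_def lsc_energy_eq_energy X d energy_nonneg ennreal_mult)
            finally show "ennreal \<bar>g r d\<bar> \<le> ennreal e * m r + ennreal C * lsc_energy d" .
          qed
        qed
      qed
    qed
  qed (use ab in auto)
  have decay: "(norm (w t))\<^sup>2 \<le> (norm (w 0))\<^sup>2 * exp (- \<kappa> * t)" if "0 \<le> t" for t
  proof (rule exponential_decay_from_integral_inequality[of "\<lambda>t. (norm (w t))\<^sup>2", OF _ _ _ ineq that])
    show "continuous_on UNIV (\<lambda>t. (norm (w t))\<^sup>2)" by (intro continuous_intros wc)
    show "0 < \<kappa>" using rate by (simp add: \<kappa>_def)
  qed auto
  have "norm (u t - U t) \<le> (norm (w 0) + 1) * exp (- (\<kappa> / 2) * t)" if t: "0 \<le> t" for t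
  proof -
    have "(exp (- (\<kappa> / 2) * t))\<^sup>2 = exp (- \<kappa> * t)"
      by (simp add: power2_eq_square exp_add[symmetric])
    then have "(norm (w t))\<^sup>2 \<le> (norm (w 0) * exp (- (\<kappa> / 2) * t))\<^sup>2"
      using decay[OF t] by (simp only: power_mult_distrib)
    then have "norm (w t) \<le> norm (w 0) * exp (- (\<kappa> / 2) * t)"
      by (rule power2_le_imp_le) simp
    also have "\<dots> \<le> (norm (w 0) + 1) * exp (- (\<kappa> / 2) * t)"
      by (intro mult_right_mono) auto
    finally show ?thesis
      using t by (simp add: w_def ue_def Ue_def)
  qed
  moreover have "0 < \<kappa> / 2" "0 < norm (w 0) + 1"
    using rate by (simp_all add: \<kappa>_def add_nonneg_pos)
  ultimately show ?thesis
    unfolding exponentially_fast_def by blast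
qed

end

theorem theorem8p4:
  fixes Q :: "(real^'d::finite) set"
    and \<mu> \<alpha> \<beta> varpi \<sigma> c\<^sub>0 \<theta> :: real
    and M :: "'w measure" and F :: "real \<Rightarrow> 'w measure"
    and C \<Upsilon> J :: "'d vfield \<Rightarrow> 'd vfield"
    and W u U :: "real \<Rightarrow> 'w \<Rightarrow> 'd vfield"
    and f :: "'d vfield \<Rightarrow> real"
    and u\<^sub>0 U\<^sub>0 :: "'d vfield"
  assumes "CARD('d) \<in> {2, 3}"
    and "bounded_smooth_domain Q"
    and "\<mu> > 0" "\<alpha> > 0" "\<beta> > 0"
    and "usual_conditions M F"
    and "trace_class_covariance (H_space Q) C"
    and "wiener_process M F (H_space Q) C W"
    and "\<Upsilon> \<in> L_Q (H_space Q) C"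
    and "c\<^sub>0 > 0" "\<theta> > 0" "interpolant Q c\<^sub>0 \<theta> J"
    and "\<sigma> > 0"
    and "f \<in> V_dual Q" "u\<^sub>0 \<in> H_space Q" "U\<^sub>0 \<in> H_space Q"
    and "scbf_solution Q \<mu> \<alpha> \<beta> varpi f M F (ito_integral M F (H_space Q) C W \<Upsilon>) u\<^sub>0 u"
    and "da_solution Q \<mu> \<alpha> \<beta> varpi f M F (ito_integral M F (H_space Q) C W \<Upsilon>) \<sigma> J u U\<^sub>0 U"
    and "(varpi = 3 \<and> 2 * \<beta> * \<mu> > 1 \<and>
            0 < \<sigma> \<and> \<sigma> \<le> 1 / (c\<^sub>0 * \<theta>\<^sup>2) * (2 * \<mu> - 1 / \<beta>)) \<or>
         (varpi > 3 \<and>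
            2 * varpi_hat \<mu> \<beta> varpi < 2 * \<alpha> + \<sigma> \<and> 2 * \<alpha> + \<sigma> \<le> 2 * \<alpha> + \<mu> / (c\<^sub>0 * \<theta>\<^sup>2)) \<or>
         (varpi > 3 \<and> 2 * \<beta> * \<mu> > 1 \<and>
            \<beta> < 2 * \<alpha> + \<sigma> \<and> 2 * \<alpha> + \<sigma> \<le> 2 * \<alpha> + 1 / (c\<^sub>0 * \<theta>\<^sup>2) * (2 * \<mu> - 1 / \<beta>))"
  shows "AE \<omega> in M. exponentially_fast (\<lambda>t. norm (u t \<omega> - U t \<omega>))"
proof -
  note pos = assms(3-5,13)
  define s where "s = c\<^sub>0 * \<theta>\<^sup>2"
  have s: "0 < s" using assms(10,11) by (simp add: s_def)
  have "3 \<le> varpi" using assms(19) by auto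
  interpret brinkman_forchheimer Q varpi
    by unfold_locales (use assms(2) \<open>3 \<le> varpi\<close> in \<open>auto simp: bounded_smooth_domain_def\<close>)
  \<comment> \<open>The constant \<open>l\<close> is the weight of the gradient in Young's inequality for the convection term, and \<open>c\<close> is what the damping
    fails to absorb.\<close>
  have "\<exists>l c. 0 < l \<and> (\<forall>r\<ge>0. 1 / (2 * l) * r\<^sup>2 \<le> \<beta> / 2 * r powr (varpi - 1) + c)
      \<and> \<sigma> * s \<le> 2 * \<mu> - l \<and> 0 < 2 * \<alpha> + \<sigma> - 2 * c"
    using assms(19) unfolding s_def[symmetric]
  proof (elim disjE conjE)
    assume "varpi = 3" and \<sigma>: "\<sigma> \<le> 1 / s * (2 * \<mu> - 1 / \<beta>)"
    show ?thesis
    proof (rule exI[of _ "1 / \<beta>"], rule exI[of _ 0], intro conjI allI impI)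
      show "\<sigma> * s \<le> 2 * \<mu> - 1 / \<beta>" using \<sigma> s by (simp add: pos_le_divide_eq)
      show "1 / (2 * (1 / \<beta>)) * r\<^sup>2 \<le> \<beta> / 2 * r powr (varpi - 1) + 0" if "0 \<le> r" for r
        using that \<open>varpi = 3\<close> by (cases "r = 0") auto
    qed (use pos in auto)
  next
    assume v: "3 < varpi" and rate: "2 * varpi_hat \<mu> \<beta> varpi < 2 * \<alpha> + \<sigma>" and \<sigma>: "2 * \<alpha> + \<sigma> \<le> 2 * \<alpha> + \<mu> / s"
    show ?thesis
    proof (rule exI[of _ \<mu>], rule exI[of _ "varpi_hat \<mu> \<beta> varpi"], intro conjI allI impI)
      show "\<sigma> * s \<le> 2 * \<mu> - \<mu>" using \<sigma> s by (simp add: pos_le_divide_eq)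
      show "1 / (2 * \<mu>) * r\<^sup>2 \<le> \<beta> / 2 * r powr (varpi - 1) + varpi_hat \<mu> \<beta> varpi" if "0 \<le> r" for r
        by (rule varpi_hat_bound[OF pos(1,3) v that])
    qed (use pos rate in auto)
  next
    assume v: "3 < varpi" and rate: "\<beta> < 2 * \<alpha> + \<sigma>" and \<sigma>: "2 * \<alpha> + \<sigma> \<le> 2 * \<alpha> + 1 / s * (2 * \<mu> - 1 / \<beta>)"
    show ?thesis
    proof (rule exI[of _ "1 / \<beta>"], rule exI[of _ "\<beta> / 2"], intro conjI allI impI)
      show "\<sigma> * s \<le> 2 * \<mu> - 1 / \<beta>" using \<sigma> s by (simp add: pos_le_divide_eq)
      fix r :: real assume r: "0 \<le> r"
      have "r\<^sup>2 \<le> r powr (varpi - 1) + 1"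
      proof (cases "r \<le> 1")
        case True
        then have "r\<^sup>2 \<le> 1" using r by (simp add: power_le_one)
        then show ?thesis by (simp add: add_increasing)
      next
        case False
        then have "r powr 2 \<le> r powr (varpi - 1)" using v by (intro powr_mono) auto
        then show ?thesis using False by simp
      qed
      then have "\<beta> / 2 * r\<^sup>2 \<le> \<beta> / 2 * (r powr (varpi - 1) + 1)" using pos by (intro mult_left_mono) auto
      then show "1 / (2 * (1 / \<beta>)) * r\<^sup>2 \<le> \<beta> / 2 * r powr (varpi - 1) + \<beta> / 2"
        by (simp add: distrib_left)
    qed (use pos rate in auto)
  qed
  then obtain l c where l: "0 < l" "\<And>r. 0 \<le> r \<Longrightarrow> 1 / (2 * l) * r\<^sup>2 \<le> \<beta> / 2 * r powr (varpi - 1) + c"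
    "\<sigma> * s \<le> 2 * \<mu> - l" "0 < 2 * \<alpha> + \<sigma> - 2 * c"
    by blast
  let ?Z = "ito_integral M F (H_space Q) C W \<Upsilon>"
  have AE_u: "AE \<omega> in M. solution_path Q varpi (\<lambda>t. u t \<omega>) \<and>
        (\<forall>v \<in> X. \<forall>t\<ge>0. u t \<omega> \<bullet> v + (LINT s:{0..t}|lebesgue. cbf_form Q \<mu> \<alpha> \<beta> varpi (u s \<omega>) v) =
           u\<^sub>0 \<bullet> v + (t * f v + ?Z t \<omega> \<bullet> v))"
    using assms(17) by (auto simp: scbf_solution_def X_def add.assoc elim!: eventually_mono)
  have AE_U: "AE \<omega> in M. solution_path Q varpi (\<lambda>t. U t \<omega>) \<and>
        (\<forall>v \<in> X. \<forall>t\<ge>0. U t \<omega> \<bullet> v + (LINT s:{0..t}|lebesgue. cbf_form Q \<mu> \<alpha> \<beta> varpi (U s \<omega>) v) =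
           U\<^sub>0 \<bullet> v + (t * f v + ?Z t \<omega> \<bullet> v)
           - \<sigma> * (LINT s:{0..t}|lebesgue. helmholtz Q (J (U s \<omega> - u s \<omega>)) \<bullet> v))"
    using assms(18) by (auto simp: da_solution_def X_def add.assoc elim!: eventually_mono)
  from AE_u AE_U show ?thesis
  proof eventually_elim
    case (elim \<omega>)
    show ?case
      by (rule nudged_path_synchronizes[OF pos(1-4) less_imp_le[OF assms(10)] assms(12) l(1,2) l(3)[unfolded s_def] l(4),
            where N = "\<lambda>t v. t * f v + ?Z t \<omega> \<bullet> v"])
         (use elim in blast)+
  qed
qed

end
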